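(* Let $K\ge1$ and $K'\ge0$ be constants, and let $f=u+iv$ be a harmonic $(K,K')$-quasiregular mapping in $\mathbb{D}$ with $v(0)=0$. $(\mathscr{B}_1)$ If $u\in\mathbf{h}^1$, then $v\in\mathbf{h}^q$ for all $q\in(0,1)$. $(\mathscr{B}_2)$ If $$\sup_{r\in[0,1)}\int_0^{2\pi}|u(re^{i\theta})|\log^+|u(re^{i\theta})|\,d\theta<\infty,$$ then $v\in\mathbf{h}^1$. $(\mathscr{B}_3)$ If $u\in\mathbf{h}^p$ for some $p\in(0,1)$, then $$M_p(r,v)=O\left(\left(\log\frac1{1-r}\right)^{1/p}\right)\quad\text{as } r\to1^-.$$ Moreover, for $p=1,\,1/2,\,1/3,\ldots$ this estimate is sharp: for each such $p$ there exists a harmonic $(K,K')$-quasiregular mapping $f=u+iv$ in $\mathbb{D}$ with $v(0)=0$ and $u\in\mathbf{h}^p$ for which $M_p(r,v)$ is not $o\left(\left(\log\frac1{1-r}\right)^{1/p}\right)$ as $r\to1^-$.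
   Context: $\mathbb{D}$ is the open unit disk in $\mathbb{C}$. For a complex-valued $f$ write $f_z=\frac12(f_x-if_y)$, $f_{\overline z}=\frac12(f_x+if_y)$, $\Lambda_f=|f_z|+|f_{\overline z}|$, and $J_f=|f_z|^2-|f_{\overline z}|^2$ (the Jacobian). For constants $K\ge1$, $K'\ge0$, a mapping $f:\mathbb{D}\to\mathbb{C}$ is $(K,K')$-quasiregular if (1) $f$ is absolutely continuous on lines with locally $L^2$-integrable partial derivatives ($ACL^2$) and $J_f\ge0$ a.e. in $\mathbb{D}$; and (2) $\Lambda_f^2\le KJ_f+K'$ a.e. in $\mathbb{D}$. A harmonic $(K,K')$-quasiregular mapping is a complex-valued harmonic function on $\mathbb{D}$ that is $(K,K')$-quasiregular. Here $u=\mathrm{Re}\,f$, $v=\mathrm{Im}\,f$. For $p\in(0,\infty)$ and $r\in[0,1)$, $M_p(r,f)=\left(\frac1{2\pi}\int_0^{2\pi}|f(re^{i\theta})|^p\,d\theta\right)^{1/p}$. $\mathbf{h}^p$ is the set of all harmonic functions $f$ on $\mathbb{D}$ with $\sup_{r\in[0,1)}M_p(r,f)<\infty$. $\log^+ x=\max\{0,\log x\}$, with $|u|\log^+|u|=0$ where $u=0$. *)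

theory Defs
  imports "HOL-Analysis.Analysis" "HOL-Library.Landau_Symbols"
begin

abbreviation unit_disc :: "complex set" where
  "unit_disc \<equiv> ball 0 1"

text \<open>
  Partial derivatives with respect to the real coordinates of $z = x + iy$.  Where the partial
  derivative does not exist the value is unspecified; for ACL maps this happens only on a null set.
\<close>

definition partial_x :: "(complex \<Rightarrow> 'a::real_normed_vector) \<Rightarrow> complex \<Rightarrow> 'a" where
  "partial_x f z = vector_derivative (\<lambda>t. f (Complex t (Im z))) (at (Re z))"

definition partial_y :: "(complex \<Rightarrow> 'a::real_normed_vector) \<Rightarrow> complex \<Rightarrow> 'a" where
  "partial_y f z = vector_derivative (\<lambda>t. f (Complex (Re z) t)) (at (Im z))"

definition has_partials_on :: "(complex \<Rightarrow> 'a::real_normed_vector) \<Rightarrow> complex set \<Rightarrow> bool" where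
  "has_partials_on f S \<longleftrightarrow>
     (\<forall>z\<in>S. (\<lambda>t. f (Complex t (Im z))) differentiable (at (Re z)) \<and>
            (\<lambda>t. f (Complex (Re z) t)) differentiable (at (Im z)))"

definition C1_on :: "(complex \<Rightarrow> 'a::real_normed_vector) \<Rightarrow> complex set \<Rightarrow> bool" where
  "C1_on f S \<longleftrightarrow>
     has_partials_on f S \<and> continuous_on S (partial_x f) \<and> continuous_on S (partial_y f)"

text \<open>
  Harmonic functions (intended for open sets): twice continuously differentiable with vanishing
  Laplacian.  The range type covers both real-valued and complex-valued functions.
\<close>

definition harmonic_on :: "(complex \<Rightarrow> 'a::real_normed_vector) \<Rightarrow> complex set \<Rightarrow> bool" where
  "harmonic_on f S \<longleftrightarrow>
     C1_on f S \<and> C1_on (partial_x f) S \<and> C1_on (partial_y f) S \<and>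
     (\<forall>z\<in>S. partial_x (partial_x f) z + partial_y (partial_y f) z = 0)"

definition wirtinger_z :: "(complex \<Rightarrow> complex) \<Rightarrow> complex \<Rightarrow> complex" where
  "wirtinger_z f z = (partial_x f z - \<i> * partial_y f z) / 2"

definition wirtinger_zbar :: "(complex \<Rightarrow> complex) \<Rightarrow> complex \<Rightarrow> complex" where
  "wirtinger_zbar f z = (partial_x f z + \<i> * partial_y f z) / 2"

definition Lambda :: "(complex \<Rightarrow> complex) \<Rightarrow> complex \<Rightarrow> real" where
  "Lambda f z = cmod (wirtinger_z f z) + cmod (wirtinger_zbar f z)"

definition Jacobian :: "(complex \<Rightarrow> complex) \<Rightarrow> complex \<Rightarrow> real" where
  "Jacobian f z = (cmod (wirtinger_z f z))\<^sup>2 - (cmod (wirtinger_zbar f z))\<^sup>2"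

text \<open>
  Absolute continuity on the compact interval $[s,t]$; \<open>I\<close> is a finite family of
  non-overlapping subintervals, each given by its pair of endpoints.
\<close>

definition abs_continuous_on_interval ::
    "real \<Rightarrow> real \<Rightarrow> (real \<Rightarrow> 'a::real_normed_vector) \<Rightarrow> bool" where
  "abs_continuous_on_interval s t g \<longleftrightarrow>
     (\<forall>\<epsilon>>0. \<exists>\<delta>>0. \<forall>I. finite I \<and> (\<forall>(a, b)\<in>I. s \<le> a \<and> a \<le> b \<and> b \<le> t) \<and>
        pairwise (\<lambda>(a, b) (c, d). disjnt {a<..<b} {c<..<d}) I \<and> (\<Sum>(a, b)\<in>I. b - a) < \<delta>
        \<longrightarrow> (\<Sum>(a, b)\<in>I. norm (g b - g a)) < \<epsilon>)"

text \<open>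
  As usual, continuity is part of the notion of absolute continuity on lines.
  \<open>cbox a b\<close> is the closed rectangle with lower left corner \<open>a\<close> and upper right corner \<open>b\<close>.
\<close>

definition ACL_on :: "(complex \<Rightarrow> complex) \<Rightarrow> complex set \<Rightarrow> bool" where
  "ACL_on f S \<longleftrightarrow> continuous_on S f \<and>
     (\<forall>a b. cbox a b \<subseteq> S \<longrightarrow>
        (AE y in lebesgue. y \<in> {Im a..Im b} \<longrightarrow>
           abs_continuous_on_interval (Re a) (Re b) (\<lambda>x. f (Complex x y))) \<and>
        (AE x in lebesgue. x \<in> {Re a..Re b} \<longrightarrow>
           abs_continuous_on_interval (Im a) (Im b) (\<lambda>y. f (Complex x y))))"

definition locally_L2_on :: "(complex \<Rightarrow> complex) \<Rightarrow> complex set \<Rightarrow> bool" where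
  "locally_L2_on g S \<longleftrightarrow>
     (\<forall>C. compact C \<and> C \<subseteq> S \<longrightarrow>
        set_borel_measurable lebesgue C g \<and> set_integrable lebesgue C (\<lambda>z. (cmod (g z))\<^sup>2))"

definition ACL2_on :: "(complex \<Rightarrow> complex) \<Rightarrow> complex set \<Rightarrow> bool" where
  "ACL2_on f S \<longleftrightarrow>
     ACL_on f S \<and> locally_L2_on (partial_x f) S \<and> locally_L2_on (partial_y f) S"

definition quasiregular :: "real \<Rightarrow> real \<Rightarrow> (complex \<Rightarrow> complex) \<Rightarrow> bool" where
  "quasiregular K K' f \<longleftrightarrow>
     ACL2_on f unit_disc \<and>
     (AE z in lebesgue. z \<in> unit_disc \<longrightarrow> Jacobian f z \<ge> 0) \<and>
     (AE z in lebesgue. z \<in> unit_disc \<longrightarrow> (Lambda f z)\<^sup>2 \<le> K * Jacobian f z + K')"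

definition harmonic_quasiregular :: "real \<Rightarrow> real \<Rightarrow> (complex \<Rightarrow> complex) \<Rightarrow> bool" where
  "harmonic_quasiregular K K' f \<longleftrightarrow> harmonic_on f unit_disc \<and> quasiregular K K' f"

definition integral_mean :: "real \<Rightarrow> real \<Rightarrow> (complex \<Rightarrow> 'a::real_normed_vector) \<Rightarrow> real" where
  "integral_mean p r f =
     (1 / (2 * pi) * integral {0..2 * pi} (\<lambda>\<theta>. norm (f (r * cis \<theta>)) powr p)) powr (1 / p)"

definition harmonic_hardy :: "real \<Rightarrow> (complex \<Rightarrow> 'a::real_normed_vector) set" where
  "harmonic_hardy p =
     {f. harmonic_on f unit_disc \<and> bdd_above ((\<lambda>r. integral_mean p r f) ` {0..<1})}"

definition log_plus :: "real \<Rightarrow> real" where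
  "log_plus x = max 0 (ln x)"

end

theory Submission
  imports Defs "HOL-Complex_Analysis.Complex_Analysis"
begin

text \<open>
  Write $u = \mathrm{Re} f = \mathrm{Re} F$ and $v = \mathrm{Im} f = \mathrm{Re} G$ with $F$, $G$ holomorphic;
  quasiregularity gives $|G'| \le K |F'| + \sqrt{K'}$.  In the coordinate $w = \log z = s + it$ all circle means
  become integrals over $t$.  For the first two claims, $(1 + u^2 + v^2)^{q/2} - M E(u)$ has Laplacian bounded
  above when $E'' \ge (1 + x^2)^{q/2 - 1}$ and $M$ is large, so its circle means are, as a function of $s$, concave
  up to a quadratic term and hence bounded; such an $E$ grows linearly if $q < 1$ and like $|x| \log |x|$ if $q = 1$.
  For $p < 1$, a local bound of $|F'|^p$ by area means of $|u|^p$ shows that the $p$-th power mean of $v$ increases by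
  a bounded amount each time $|s|$ is halved.  Sharpness is witnessed by $i^{n-1} ((1 + z)/(1 - z))^n$, whose real
  part vanishes on the boundary away from $1$.
\<close>

section \<open>Harmonic functions as real parts of holomorphic functions\<close>

text \<open>In the coordinate w the Laplacian is the plain sum of the second s- and t-derivatives.
  By periodicity the t-part integrates to zero, so a pointwise upper bound for the Laplacian bounds
  the second derivative of the mean. The Laplacian of E(u) is E''(u)|F'|^2, so a function of u alone
  can absorb the |G'|^2 created by v; this is where quasiregularity enters. Integrating |x|^(q-2)
  twice gives linear growth for q < 1 and an extra logarithm at q = 1, which explains the two
  different hypotheses on u. For p < 1 the obstacle is that |u|^p need not be subharmonic. Its mean
  value inequality survives with a worse constant, by looking at a maximum of |u|^p weighted by the
  distance to the boundary of the disc. Derivatives are estimated on discs of radius comparable to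
  |s|; the area factors cancel, so every halving costs the same, and about log(1/|s|) halvings lead
  from s = -1 to |s| of order 1 - r. Sharpness is tested at p = 1/n because the p-th power of |(1 +
  z)/(1 - z)|^n is then |(1 + z)/(1 - z)|, with circle integrals at least log(1/(1 - r)). The real
  part has bounded p-means, so the imaginary part must carry the logarithm.\<close>

lemma open_rectangle_subset:
  assumes "open S" "z \<in> S"
  obtains a b where "z \<in> box a b" "box a b \<subseteq> S"
  using assms open_contains_box by metis

lemma has_vector_derivative_Complex_left:
  "((\<lambda>t. Complex t y) has_vector_derivative 1) (at x)"
  unfolding Complex_eq by (auto intro!: derivative_eq_intros)

lemma has_vector_derivative_Complex_right:
  "((\<lambda>t. Complex x t) has_vector_derivative \<i>) (at y)"
  unfolding Complex_eq by (auto intro!: derivative_eq_intros)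

lemma open_horizontal_slice: "open S \<Longrightarrow> open {t. Complex t y \<in> S}"
  using continuous_open_preimage[of UNIV "\<lambda>t. Complex t y" S]
  by (simp add: vimage_def Complex_eq continuous_intros)

lemma open_vertical_slice: "open S \<Longrightarrow> open {t. Complex x t \<in> S}"
  using continuous_open_preimage[of UNIV "\<lambda>t. Complex x t" S]
  by (simp add: vimage_def Complex_eq continuous_intros)

lemma vector_derivative_on_slices:
  fixes h k :: "complex \<Rightarrow> 'a::real_normed_vector"
  assumes "open S" "z \<in> S" "\<And>w. w \<in> S \<Longrightarrow> h w = k w"
  shows "((\<lambda>t. k (Complex t (Im z))) has_vector_derivative d) (at (Re z)) \<Longrightarrow>
         ((\<lambda>t. h (Complex t (Im z))) has_vector_derivative d) (at (Re z))"
    and "((\<lambda>t. k (Complex (Re z) t)) has_vector_derivative d) (at (Im z)) \<Longrightarrow>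
         ((\<lambda>t. h (Complex (Re z) t)) has_vector_derivative d) (at (Im z))"
  by (rule has_vector_derivative_transform_within_open[OF _ open_horizontal_slice[OF assms(1), of "Im z"]];
      use assms in simp)
     (rule has_vector_derivative_transform_within_open[OF _ open_vertical_slice[OF assms(1), of "Re z"]];
      use assms in simp)

lemma C1_onI:
  assumes "\<And>z. z \<in> S \<Longrightarrow> ((\<lambda>t. f (Complex t (Im z))) has_vector_derivative p z) (at (Re z))"
    and "\<And>z. z \<in> S \<Longrightarrow> ((\<lambda>t. f (Complex (Re z) t)) has_vector_derivative q z) (at (Im z))"
    and "continuous_on S p" "continuous_on S q"
  shows "C1_on f S" and "\<And>z. z \<in> S \<Longrightarrow> partial_x f z = p z"
    and "\<And>z. z \<in> S \<Longrightarrow> partial_y f z = q z"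
proof -
  show px: "partial_x f z = p z" if "z \<in> S" for z
    unfolding partial_x_def by (rule vector_derivative_at[OF assms(1)[OF that]])
  show py: "partial_y f z = q z" if "z \<in> S" for z
    unfolding partial_y_def by (rule vector_derivative_at[OF assms(2)[OF that]])
  show "C1_on f S"
    unfolding C1_on_def has_partials_on_def
    using assms px py by (auto intro!: differentiableI_vector cong: continuous_on_cong)
qed

lemma C1_onD:
  assumes "C1_on f S"
  shows "z \<in> S \<Longrightarrow> ((\<lambda>t. f (Complex t (Im z))) has_vector_derivative partial_x f z) (at (Re z))"
    and "z \<in> S \<Longrightarrow> ((\<lambda>t. f (Complex (Re z) t)) has_vector_derivative partial_y f z) (at (Im z))"
    and "continuous_on S (partial_x f)" "continuous_on S (partial_y f)"
  using assms unfolding C1_on_def has_partials_on_def partial_x_def partial_y_def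
  by (auto simp: vector_derivative_works)

text \<open>Partial derivatives at a point of an open set see only nearby values. This is needed for
  second derivatives, because a first partial derivative is identified with a known function only on
  \<open>S\<close>.\<close>

lemma C1_on_cong:
  assumes "open S" "\<And>w. w \<in> S \<Longrightarrow> h w = k w" "C1_on k S"
  shows "C1_on h S" and "\<And>z. z \<in> S \<Longrightarrow> partial_x h z = partial_x k z"
    and "\<And>z. z \<in> S \<Longrightarrow> partial_y h z = partial_y k z"
  using C1_onI[OF vector_derivative_on_slices(1)[OF assms(1) _ assms(2) C1_onD(1)[OF assms(3)]]
      vector_derivative_on_slices(2)[OF assms(1) _ assms(2) C1_onD(2)[OF assms(3)]]
      C1_onD(3,4)[OF assms(3)]] by auto

lemma C1_on_bounded_linear:
  assumes "bounded_linear T" "C1_on f S"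
  shows "C1_on (\<lambda>z. T (f z)) S"
    and "\<And>z. z \<in> S \<Longrightarrow> partial_x (\<lambda>z. T (f z)) z = T (partial_x f z)"
    and "\<And>z. z \<in> S \<Longrightarrow> partial_y (\<lambda>z. T (f z)) z = T (partial_y f z)"
proof -
  note D = bounded_linear.has_vector_derivative[OF assms(1)]
  note C = bounded_linear.continuous_on[OF assms(1)]
  note I = C1_onI[OF D[OF C1_onD(1)[OF assms(2)]] D[OF C1_onD(2)[OF assms(2)]]
      C[OF C1_onD(3)[OF assms(2)]] C[OF C1_onD(4)[OF assms(2)]]]
  show "C1_on (\<lambda>z. T (f z)) S" using I(1) by auto
  show "partial_x (\<lambda>z. T (f z)) z = T (partial_x f z)" if "z \<in> S" for z using I(2) that by auto
  show "partial_y (\<lambda>z. T (f z)) z = T (partial_y f z)" if "z \<in> S" for z using I(3) that by auto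
qed

lemma harmonic_on_bounded_linear:
  assumes "bounded_linear T" "open S" "harmonic_on f S"
  shows "harmonic_on (\<lambda>z. T (f z)) S"
proof -
  have f: "C1_on f S" "C1_on (partial_x f) S" "C1_on (partial_y f) S"
    "\<And>z. z \<in> S \<Longrightarrow> partial_x (partial_x f) z + partial_y (partial_y f) z = 0"
    using assms(3) by (auto simp: harmonic_on_def)
  note L = C1_on_bounded_linear[OF assms(1)]
  note X = C1_on_cong[OF assms(2) L(2)[OF f(1)] L(1)[OF f(2)]]
  note Y = C1_on_cong[OF assms(2) L(3)[OF f(1)] L(1)[OF f(3)]]
  have "partial_x (partial_x (\<lambda>z. T (f z))) z + partial_y (partial_y (\<lambda>z. T (f z))) z = 0"
    if "z \<in> S" for z
  proof -
    interpret bounded_linear T by (rule assms(1))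
    show ?thesis
      using f(4)[OF that] X(2) Y(3) that L(2)[OF f(2) that] L(3)[OF f(3) that]
      by (simp add: add[symmetric] zero)
  qed
  then show ?thesis
    unfolding harmonic_on_def using L(1)[OF f(1)] X(1) Y(1) by auto
qed

lemma C1_on_holomorphic:
  assumes "f holomorphic_on S" "open S"
  shows "C1_on f S" and "\<And>z. z \<in> S \<Longrightarrow> partial_x f z = deriv f z"
    and "\<And>z. z \<in> S \<Longrightarrow> partial_y f z = \<i> * deriv f z"
proof -
  have D: "(f has_field_derivative deriv f z) (at z)" if "z \<in> S" for z
    using assms that holomorphic_derivI by blast
  have x: "((\<lambda>t. f (Complex t (Im z))) has_vector_derivative deriv f z) (at (Re z))"
    if "z \<in> S" for z
    using field_vector_diff_chain_at[OF has_vector_derivative_Complex_left[of "Im z" "Re z"], of f]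
      D[OF that] by (simp add: o_def)
  have y: "((\<lambda>t. f (Complex (Re z) t)) has_vector_derivative \<i> * deriv f z) (at (Im z))"
    if "z \<in> S" for z
    using field_vector_diff_chain_at[OF has_vector_derivative_Complex_right[of "Re z" "Im z"], of f]
      D[OF that] by (simp add: o_def)
  have c: "continuous_on S (deriv f)"
    by (intro holomorphic_on_imp_continuous_on holomorphic_deriv assms)
  note I = C1_onI[OF x y c continuous_on_mult_left[OF c]]
  show "C1_on f S" "\<And>z. z \<in> S \<Longrightarrow> partial_x f z = deriv f z"
    "\<And>z. z \<in> S \<Longrightarrow> partial_y f z = \<i> * deriv f z" using I by auto
qed

lemma harmonic_on_holomorphic:
  assumes "f holomorphic_on S" "open S"
  shows "harmonic_on f S"
proof -
  note f = C1_on_holomorphic[OF assms]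
  have h: "deriv f holomorphic_on S" "(\<lambda>z. \<i> * deriv f z) holomorphic_on S"
    by (intro holomorphic_intros holomorphic_deriv assms)+
  note g = C1_on_holomorphic[OF h(1) assms(2)] C1_on_holomorphic[OF h(2) assms(2)]
  note X = C1_on_cong[OF assms(2) f(2) g(1)] and Y = C1_on_cong[OF assms(2) f(3) g(4)]
  have "partial_x (partial_x f) z + partial_y (partial_y f) z = 0" if "z \<in> S" for z
  proof -
    have "deriv (\<lambda>z. \<i> * deriv f z) z = \<i> * deriv (deriv f) z"
      using that assms(2) h(1) by (intro deriv_cmult) (meson holomorphic_on_imp_differentiable_at)
    then show ?thesis using that X(2) Y(3) g(2,6) by (simp add: mult.assoc[symmetric])
  qed
  then show ?thesis unfolding harmonic_on_def using f(1) X(1) Y(1) by auto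
qed

text \<open>Continuous partial derivatives give total differentiability.
  \<open>has_derivative_partialsI\<close> works on a product set, so the argument runs on an open
  rectangle around \<open>z\<close> and is transported back along \<open>w\<close> to
  \<open>(Re w, Im w)\<close>.\<close>

lemma C1_on_has_derivative:
  fixes h :: "complex \<Rightarrow> real"
  assumes "C1_on h S" "open S" "z \<in> S"
  shows "(h has_derivative (\<lambda>w. Re w * partial_x h z + Im w * partial_y h z)) (at z)"
proof -
  obtain a b where ab: "z \<in> box a b" "box a b \<subseteq> S"
    using open_rectangle_subset assms by blast
  define X Y where "X = {Re a<..<Re b}" and "Y = {Im a<..<Im b}"
  have XY: "Complex x y \<in> S" if "x \<in> X" "y \<in> Y" for x y
    using ab that by (auto simp: X_def Y_def in_box_complex_iff subset_iff)
  have z: "Re z \<in> X" "Im z \<in> Y" using ab by (auto simp: X_def Y_def in_box_complex_iff)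
  have "((\<lambda>(x, y). h (Complex x y)) has_derivative
      (\<lambda>(tx, ty). tx *\<^sub>R partial_x h z + blinfun_mult_right (partial_y h (Complex (Re z) (Im z))) ty))
      (at (Re z, Im z) within X \<times> Y)"
  proof (rule has_derivative_partialsI)
    show "((\<lambda>x. h (Complex x (Im z))) has_derivative (\<lambda>tx. tx *\<^sub>R partial_x h z)) (at (Re z) within X)"
      using C1_onD(1)[OF assms(1,3)] has_derivative_at_withinI
      unfolding has_vector_derivative_def by blast
    show "((\<lambda>y. h (Complex x y)) has_derivative blinfun_apply (blinfun_mult_right (partial_y h (Complex x y))))
        (at y within Y)" if "x \<in> X" "y \<in> Y" for x y
      using C1_onD(2)[OF assms(1) XY[OF that]]
      by (auto simp: has_vector_derivative_def fun_eq_iff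
          intro!: has_derivative_at_withinI elim!: has_derivative_eq_rhs)
    have "continuous_on (X \<times> Y) (\<lambda>p. blinfun_mult_right (partial_y h (Complex (fst p) (snd p))))"
      unfolding Complex_eq
      apply (intro bounded_linear.continuous_on[OF bounded_linear_blinfun_mult_right]
          continuous_on_compose2[OF C1_onD(4)[OF assms(1)]] continuous_intros)
      using XY by (auto simp: Complex_eq)
    then show "continuous (at (Re z, Im z) within X \<times> Y)
        (\<lambda>(x, y). blinfun_mult_right (partial_y h (Complex x y)))"
      using z by (auto simp: continuous_on_eq_continuous_within case_prod_unfold)
    show "Im z \<in> Y" "convex Y" using z by (auto simp: Y_def)
  qed
  moreover have "at (Re z, Im z) within X \<times> Y = at (Re z, Im z)"
    using z by (intro at_within_open) (auto simp: X_def Y_def intro!: open_Times)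
  ultimately have D: "((\<lambda>p. h (Complex (fst p) (snd p))) has_derivative
      (\<lambda>p. fst p * partial_x h z + partial_y h z * snd p)) (at (Re z, Im z))"
    by (simp add: case_prod_unfold)
  have "((\<lambda>w. (Re w, Im w)) has_derivative (\<lambda>w. (Re w, Im w))) (at z)"
    by (auto intro!: derivative_eq_intros)
  from diff_chain_at[OF this, OF D]
  show ?thesis by (simp add: o_def mult.commute)
qed

text \<open>Write \<open>h\<close> as its value on the line x = \<open>x0\<close> plus the
  x-integral of \<open>partial_x h\<close>, differentiate in y under the integral sign, and then
  differentiate the result in x by the fundamental theorem of calculus.\<close>

lemma mixed_partials_commute:
  fixes h :: "complex \<Rightarrow> real"
  assumes "C1_on h S" "C1_on (partial_x h) S" "C1_on (partial_y h) S" "open S" "z \<in> S"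
  shows "partial_y (partial_x h) z = partial_x (partial_y h) z"
proof -
  obtain a b where ab: "z \<in> box a b" "box a b \<subseteq> S"
    using open_rectangle_subset assms by blast
  define X Y where "X = {Re a<..<Re b}" and "Y = {Im a<..<Im b}"
  have XY: "Complex x y \<in> S" if "x \<in> X" "y \<in> Y" for x y
    using ab that by (auto simp: X_def Y_def in_box_complex_iff subset_iff)
  have z: "Re z \<in> X" "Im z \<in> Y" using ab by (auto simp: X_def Y_def in_box_complex_iff)
  \<comment> \<open>A base point strictly to the left of \<open>Re z\<close>, so that
    \<open>Re z\<close> is interior to the interval of integration.\<close>
  obtain x0 where x0: "x0 \<in> X" "x0 < Re z"
    using dense[of "Re a" "Re z"] z by (auto simp: X_def)
  have X0: "{x0..x} \<subseteq> X" if "x \<in> X" for x using that x0 by (auto simp: X_def)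
  have cont: "continuous_on (Y \<times> {x0..x}) (\<lambda>(y, s). partial_y (partial_x h) (Complex s y))"
    if "x \<in> X" for x
    unfolding case_prod_unfold Complex_eq
    apply (intro continuous_on_compose2[OF C1_onD(4)[OF assms(2)]] continuous_intros)
    using XY X0[OF that] by (auto simp: Complex_eq)
  have cont': "continuous_on {x0..x} (\<lambda>s. k (Complex s y))"
    if "x \<in> X" "y \<in> Y" "continuous_on S k" for x y and k :: "complex \<Rightarrow> real"
    unfolding Complex_eq
    apply (intro continuous_on_compose2[OF that(3)] continuous_intros)
    using XY X0[OF that(1)] that by (auto simp: Complex_eq)
  have ftc: "h (Complex x y) = h (Complex x0 y) + integral {x0..x} (\<lambda>s. partial_x h (Complex s y))"
    if "x \<in> X" "y \<in> Y" "x0 \<le> x" for x y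
  proof -
    have "((\<lambda>s. partial_x h (Complex s y)) has_integral h (Complex x y) - h (Complex x0 y)) {x0..x}"
    proof (rule fundamental_theorem_of_calculus[OF that(3)])
      fix s assume "s \<in> {x0..x}"
      then have "Complex s y \<in> S" using X0[OF that(1)] XY that(2) by blast
      from C1_onD(1)[OF assms(1) this]
      show "((\<lambda>s. h (Complex s y)) has_vector_derivative partial_x h (Complex s y)) (at s within {x0..x})"
        by (auto intro: has_vector_derivative_at_within)
    qed
    then show ?thesis by (simp add: integral_unique)
  qed
  have uy: "partial_y h (Complex x (Im z)) = partial_y h (Complex x0 (Im z)) +
      integral {x0..x} (\<lambda>s. partial_y (partial_x h) (Complex s (Im z)))"
    if "x \<in> X" "x0 \<le> x" for x
  proof -
    have "((\<lambda>y. integral (cbox x0 x) (\<lambda>s. partial_x h (Complex s y))) has_field_derivative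
        integral (cbox x0 x) (\<lambda>s. partial_y (partial_x h) (Complex s (Im z)))) (at (Im z) within Y)"
    proof (rule leibniz_rule_field_derivative)
      show "((\<lambda>y. partial_x h (Complex s y)) has_field_derivative partial_y (partial_x h) (Complex s y))
          (at y within Y)" if "y \<in> Y" "s \<in> cbox x0 x" for y s
      proof -
        have "Complex s y \<in> S" using that XY X0[OF \<open>x \<in> X\<close>] by auto
        from C1_onD(2)[OF assms(2) this] show ?thesis
          by (auto simp: has_real_derivative_iff_has_vector_derivative intro: has_vector_derivative_at_within)
      qed
      show "(\<lambda>s. partial_x h (Complex s y)) integrable_on cbox x0 x" if "y \<in> Y" for y
        using cont'[OF \<open>x \<in> X\<close> that C1_onD(3)[OF assms(1)]] by (auto intro: integrable_continuous_real)
      show "continuous_on (Y \<times> cbox x0 x) (\<lambda>(y, s). partial_y (partial_x h) (Complex s y))"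
        using cont[OF \<open>x \<in> X\<close>] by simp
      show "Im z \<in> Y" "convex Y" using z by (auto simp: Y_def)
    qed
    moreover have "at (Im z) within Y = at (Im z)"
      using z by (intro at_within_open) (auto simp: Y_def)
    moreover have "((\<lambda>t. h (Complex x0 t)) has_field_derivative partial_y h (Complex x0 (Im z))) (at (Im z))"
      using C1_onD(2)[OF assms(1), of "Complex x0 (Im z)"] XY[OF x0(1) z(2)]
      by (simp add: has_real_derivative_iff_has_vector_derivative)
    ultimately have "((\<lambda>y. h (Complex x0 y) + integral {x0..x} (\<lambda>s. partial_x h (Complex s y)))
        has_field_derivative partial_y h (Complex x0 (Im z)) +
        integral {x0..x} (\<lambda>s. partial_y (partial_x h) (Complex s (Im z)))) (at (Im z))"
      by (auto intro!: derivative_intros)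
    then have "((\<lambda>y. h (Complex x y)) has_field_derivative partial_y h (Complex x0 (Im z)) +
        integral {x0..x} (\<lambda>s. partial_y (partial_x h) (Complex s (Im z)))) (at (Im z))"
      by (rule has_field_derivative_transform_within_open[where S = Y])
         (use z ftc[OF that(1) _ that(2)] in \<open>auto simp: Y_def\<close>)
    moreover have "((\<lambda>t. h (Complex x t)) has_field_derivative partial_y h (Complex x (Im z))) (at (Im z))"
      using C1_onD(2)[OF assms(1), of "Complex x (Im z)"] XY[OF that(1) z(2)]
      by (simp add: has_real_derivative_iff_has_vector_derivative)
    ultimately show ?thesis using DERIV_unique by blast
  qed
  obtain x1 where x1: "x1 \<in> X" "Re z < x1"
    using dense[of "Re z" "Re b"] z by (auto simp: X_def)
  have "((\<lambda>x. integral {x0..x} (\<lambda>s. partial_y (partial_x h) (Complex s (Im z)))) has_real_derivative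
      partial_y (partial_x h) (Complex (Re z) (Im z))) (at (Re z) within {x0..x1})"
    using cont'[OF x1(1) z(2) C1_onD(4)[OF assms(2)]] x0 x1
    by (intro integral_has_real_derivative) auto
  then have "((\<lambda>x. integral {x0..x} (\<lambda>s. partial_y (partial_x h) (Complex s (Im z)))) has_real_derivative
      partial_y (partial_x h) z) (at (Re z))"
    using at_within_interior[of "Re z" "{x0..x1}"] x0 x1 by simp
  then have "((\<lambda>x. partial_y h (Complex x0 (Im z)) +
      integral {x0..x} (\<lambda>s. partial_y (partial_x h) (Complex s (Im z)))) has_real_derivative
      partial_y (partial_x h) z) (at (Re z))"
    by (auto intro!: derivative_eq_intros)
  then have "((\<lambda>x. partial_y h (Complex x (Im z))) has_real_derivative partial_y (partial_x h) z) (at (Re z))"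
    by (rule has_field_derivative_transform_within_open[where S = "{x0<..<x1}"])
       (use x0 x1 in \<open>auto simp: X_def intro!: uy[symmetric]\<close>)
  moreover have "((\<lambda>x. partial_y h (Complex x (Im z))) has_real_derivative partial_x (partial_y h) z) (at (Re z))"
    using C1_onD(1)[OF assms(3,5)] by (simp add: has_real_derivative_iff_has_vector_derivative)
  ultimately show ?thesis using DERIV_unique by blast
qed

text \<open>\<open>partial_x h - \<i> * partial_y h\<close> satisfies the Cauchy-Riemann equations:
  one is Laplace's equation, the other the symmetry of the mixed partials. A primitive exists
  because the disc is convex.\<close>

lemma harmonic_on_disc_imp_Re_holomorphic:
  fixes h :: "complex \<Rightarrow> real"
  assumes "harmonic_on h unit_disc"
  obtains F where "F holomorphic_on unit_disc" "\<And>z. z \<in> unit_disc \<Longrightarrow> h z = Re (F z)"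
    "\<And>z. z \<in> unit_disc \<Longrightarrow> deriv F z = Complex (partial_x h z) (- partial_y h z)"
proof -
  have h: "C1_on h unit_disc" "C1_on (partial_x h) unit_disc" "C1_on (partial_y h) unit_disc"
    "\<And>z. z \<in> unit_disc \<Longrightarrow> partial_x (partial_x h) z + partial_y (partial_y h) z = 0"
    using assms by (auto simp: harmonic_on_def)
  define g where "g z = Complex (partial_x h z) (- partial_y h z)" for z
  have "(g has_field_derivative Complex (partial_x (partial_x h) z) (- partial_x (partial_y h) z)) (at z)"
    if z: "z \<in> unit_disc" for z
  proof -
    have eq: "partial_y (partial_x h) z = partial_x (partial_y h) z"
      "partial_y (partial_y h) z = - partial_x (partial_x h) z"
      using mixed_partials_commute[OF h(1-3) open_ball z] h(4)[OF z] by auto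
    show ?thesis
      unfolding has_field_derivative_def g_def Complex_eq
      apply (rule derivative_eq_intros C1_on_has_derivative[OF h(2) open_ball z]
          C1_on_has_derivative[OF h(3) open_ball z] refl)+
      by (auto simp: complex_eq_iff fun_eq_iff eq algebra_simps)
  qed
  then have "g holomorphic_on unit_disc"
    unfolding holomorphic_on_open[OF open_ball] by blast
  then obtain F0 where "\<And>z. z \<in> unit_disc \<Longrightarrow> (F0 has_field_derivative g z) (at z within unit_disc)"
    using holomorphic_convex_primitive'[of unit_disc g] by auto
  then have F0: "\<And>z. z \<in> unit_disc \<Longrightarrow> (F0 has_field_derivative g z) (at z)"
    by (simp add: at_within_open[OF _ open_ball])
  \<comment> \<open>The added real constant makes \<open>Re (F 0) = h 0\<close>, so the constant
    difference found below is zero.\<close>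
  define F where "F z = F0 z + of_real (h 0 - Re (F0 0))" for z
  have F: "(F has_field_derivative g z) (at z)" if "z \<in> unit_disc" for z
    unfolding F_def using F0[OF that] by (auto intro!: derivative_eq_intros)
  have const: "((\<lambda>z. h z - Re (F z)) has_derivative (\<lambda>w. 0)) (at z within unit_disc)"
    if z: "z \<in> unit_disc" for z
  proof (rule has_derivative_at_withinI)
    have "((\<lambda>z. Re (F z)) has_derivative (\<lambda>w. Re (g z * w))) (at z)"
      using F[OF z] unfolding has_field_derivative_def by (auto intro!: derivative_eq_intros)
    then show "((\<lambda>z. h z - Re (F z)) has_derivative (\<lambda>w. 0)) (at z)"
      using C1_on_has_derivative[OF h(1) open_ball z]
      by (auto intro!: has_derivative_diff[THEN has_derivative_eq_rhs] simp: g_def fun_eq_iff)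
  qed
  obtain c where c: "\<And>z. z \<in> unit_disc \<Longrightarrow> h z - Re (F z) = c"
    using has_derivative_zero_constant[OF convex_ball const] by blast
  have "c = 0" using c[of 0] by (simp add: F_def)
  have "h z = Re (F z)" if "z \<in> unit_disc" for z using c[OF that] \<open>c = 0\<close> by simp
  moreover have "F holomorphic_on unit_disc"
    unfolding holomorphic_on_open[OF open_ball] using F by blast
  moreover have "\<And>z. z \<in> unit_disc \<Longrightarrow> deriv F z = Complex (partial_x h z) (- partial_y h z)"
    using DERIV_imp_deriv[OF F] by (simp add: g_def)
  ultimately show ?thesis using that by blast
qed

text \<open>The points where the inequality fails form an open null set, hence an empty one. This
  turns the almost everywhere condition of quasiregularity into a pointwise one.\<close>

lemma AE_lebesgue_nonneg_imp_nonneg: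
  fixes g :: "'a::euclidean_space \<Rightarrow> real"
  assumes "open S" "continuous_on S g" "AE z in lebesgue. z \<in> S \<longrightarrow> 0 \<le> g z" "z \<in> S"
  shows "0 \<le> g z"
proof -
  define N where "N = {z \<in> S. g z < 0}"
  have "N = S \<inter> g -` {..<0}" by (auto simp: N_def)
  then have "open N" using continuous_open_preimage[OF assms(2,1) open_lessThan[of 0]] by simp
  moreover have "AE z in lebesgue. z \<notin> N" using assms(3) by (auto simp: N_def)
  then have "N \<in> null_sets lebesgue"
    using \<open>open N\<close> by (subst AE_iff_null_sets) auto
  ultimately have "N = {}"
    using open_not_negligible negligible_iff_null_sets by blast
  then show ?thesis using assms(4) by (force simp: N_def)
qed

text \<open>Otherwise both \<open>a\<close> and \<open>a - K * b\<close> exceed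
  \<open>sqrt L\<close>, so their product exceeds \<open>L\<close>. It is applied with
  \<open>a\<close> = |G'| and \<open>b\<close> = |F'|.\<close>

lemma le_of_square_le:
  fixes a b K L :: real
  assumes "a\<^sup>2 \<le> K * b * a + L" "0 \<le> a" "0 \<le> b" "0 \<le> K" "0 \<le> L"
  shows "a \<le> K * b + sqrt L"
proof (rule ccontr)
  assume "\<not> a \<le> K * b + sqrt L"
  then have *: "sqrt L < a - K * b" by simp
  moreover have "a - K * b \<le> a" using assms by simp
  ultimately have "sqrt L < a" by linarith
  then have "sqrt L * sqrt L < a * (a - K * b)"
    using * assms by (intro mult_strict_mono') auto
  then show False using assms by (simp add: power2_eq_square algebra_simps)
qed

text \<open>
  If $\mathrm{Re} f = \mathrm{Re} F$ and $\mathrm{Im} f = \mathrm{Re} G$, then $2 f_z = F' + i G'$ and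
  $2 f_{\overline z} = \overline{F' - i G'}$, so $\Lambda_f \ge |G'|$ and $J_f \le |F'| |G'|$.
\<close>

lemma harmonic_quasiregular_holomorphic_parts:
  assumes "harmonic_quasiregular K K' f" "0 \<le> K" "0 \<le> K'"
  obtains F G where "F holomorphic_on unit_disc" "G holomorphic_on unit_disc"
    "\<And>z. z \<in> unit_disc \<Longrightarrow> Re (f z) = Re (F z)" "\<And>z. z \<in> unit_disc \<Longrightarrow> Im (f z) = Re (G z)"
    "\<And>z. z \<in> unit_disc \<Longrightarrow> cmod (deriv G z) \<le> K * cmod (deriv F z) + sqrt K'"
proof -
  have f: "harmonic_on f unit_disc" "C1_on f unit_disc"
    and qr: "AE z in lebesgue. z \<in> unit_disc \<longrightarrow> (Lambda f z)\<^sup>2 \<le> K * Jacobian f z + K'"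
    using assms(1) by (auto simp: harmonic_quasiregular_def harmonic_on_def quasiregular_def)
  obtain F where F: "F holomorphic_on unit_disc" "\<And>z. z \<in> unit_disc \<Longrightarrow> Re (f z) = Re (F z)"
    "\<And>z. z \<in> unit_disc \<Longrightarrow>
      deriv F z = Complex (partial_x (\<lambda>z. Re (f z)) z) (- partial_y (\<lambda>z. Re (f z)) z)"
    using harmonic_on_disc_imp_Re_holomorphic
      [OF harmonic_on_bounded_linear[OF bounded_linear_Re open_ball f(1)]] by metis
  obtain G where G: "G holomorphic_on unit_disc" "\<And>z. z \<in> unit_disc \<Longrightarrow> Im (f z) = Re (G z)"
    "\<And>z. z \<in> unit_disc \<Longrightarrow>
      deriv G z = Complex (partial_x (\<lambda>z. Im (f z)) z) (- partial_y (\<lambda>z. Im (f z)) z)"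
    using harmonic_on_disc_imp_Re_holomorphic
      [OF harmonic_on_bounded_linear[OF bounded_linear_Im open_ball f(1)]] by metis
  have "cmod (deriv G z) \<le> K * cmod (deriv F z) + sqrt K'" if z: "z \<in> unit_disc" for z
  proof -
    define a b where "a = deriv F z" and "b = deriv G z"
    have ab: "a = Complex (Re (partial_x f z)) (- Re (partial_y f z))"
      "b = Complex (Im (partial_x f z)) (- Im (partial_y f z))"
      using F(3)[OF z] G(3)[OF z] z C1_on_bounded_linear(2,3)[OF bounded_linear_Re f(2)]
        C1_on_bounded_linear(2,3)[OF bounded_linear_Im f(2)] by (auto simp: a_def b_def)
    have w: "wirtinger_z f z = (a + \<i> * b) / 2" "wirtinger_zbar f z = cnj (a - \<i> * b) / 2"
      by (auto simp: wirtinger_z_def wirtinger_zbar_def ab complex_eq_iff)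
    have "2 * cmod b = cmod ((a + \<i> * b) - (a - \<i> * b))" by (simp add: norm_mult)
    also have "\<dots> \<le> cmod (a + \<i> * b) + cmod (a - \<i> * b)" by (rule norm_triangle_ineq4)
    also have "\<dots> = 2 * Lambda f z" by (simp add: Lambda_def w norm_divide del: complex_cnj_diff)
    finally have "(cmod b)\<^sup>2 \<le> (Lambda f z)\<^sup>2" by (intro power_mono) auto
    moreover have "Jacobian f z \<le> cmod a * cmod b"
    proof -
      have "Jacobian f z = Im a * Re b - Re a * Im b"
        by (simp add: Jacobian_def w norm_divide power_divide cmod_power2 del: complex_cnj_diff)
           (simp add: power2_eq_square field_simps)
      also have "\<dots> = Im (a * cnj b)" by simp
      also have "\<dots> \<le> cmod (a * cnj b)" by (metis abs_Im_le_cmod abs_le_D1)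
      finally show ?thesis by (simp add: norm_mult)
    qed
    moreover have "0 \<le> K * Jacobian f z + K' - (Lambda f z)\<^sup>2"
    proof (rule AE_lebesgue_nonneg_imp_nonneg[OF open_ball _ _ z])
      show "continuous_on unit_disc (\<lambda>z. K * Jacobian f z + K' - (Lambda f z)\<^sup>2)"
        unfolding Lambda_def Jacobian_def wirtinger_z_def wirtinger_zbar_def
        by (intro continuous_intros C1_onD[OF f(2)]) auto
    qed (use qr in auto)
    ultimately have "(cmod b)\<^sup>2 \<le> K * (cmod a * cmod b) + K'"
      using mult_left_mono[of "Jacobian f z" "cmod a * cmod b" K] assms(2) by linarith
    then show ?thesis
      using assms(2,3) by (intro le_of_square_le) (auto simp: a_def b_def mult.assoc)
  qed
  then show ?thesis using that F(1,2) G(1,2) by blast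
qed

section \<open>Almost superharmonic test functions\<close>

text \<open>The Cauchy-Riemann equations on coordinate lines. The third formula serves to
  differentiate the second one again: the second t-derivative of \<open>Re \<Phi>\<close> is minus
  the real part of the second complex derivative.\<close>

lemma real_derivative_Re_slices:
  assumes "\<Phi> holomorphic_on S" "open S" "Complex s t \<in> S"
  shows "((\<lambda>s. Re (\<Phi> (Complex s t))) has_real_derivative Re (deriv \<Phi> (Complex s t))) (at s)"
    and "((\<lambda>t. Re (\<Phi> (Complex s t))) has_real_derivative - Im (deriv \<Phi> (Complex s t))) (at t)"
    and "((\<lambda>t. Im (\<Phi> (Complex s t))) has_real_derivative Re (deriv \<Phi> (Complex s t))) (at t)"
proof -
  note f = C1_on_holomorphic[OF assms(1,2)]
  have x: "((\<lambda>s. \<Phi> (Complex s t)) has_vector_derivative deriv \<Phi> (Complex s t)) (at s)"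
    using C1_onD(1)[OF f(1) assms(3)] f(2)[OF assms(3)] by simp
  have y: "((\<lambda>t. \<Phi> (Complex s t)) has_vector_derivative \<i> * deriv \<Phi> (Complex s t)) (at t)"
    using C1_onD(2)[OF f(1) assms(3)] f(3)[OF assms(3)] by simp
  note R = bounded_linear.has_vector_derivative[OF bounded_linear_Re]
    and I = bounded_linear.has_vector_derivative[OF bounded_linear_Im]
  show "((\<lambda>s. Re (\<Phi> (Complex s t))) has_real_derivative Re (deriv \<Phi> (Complex s t))) (at s)"
    using R[OF x] by (simp add: has_real_derivative_iff_has_vector_derivative)
  show "((\<lambda>t. Re (\<Phi> (Complex s t))) has_real_derivative - Im (deriv \<Phi> (Complex s t))) (at t)"
    using R[OF y] by (simp add: has_real_derivative_iff_has_vector_derivative)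
  show "((\<lambda>t. Im (\<Phi> (Complex s t))) has_real_derivative Re (deriv \<Phi> (Complex s t))) (at t)"
    using I[OF y] by (simp add: has_real_derivative_iff_has_vector_derivative)
qed

definition test_fun :: "real \<Rightarrow> real \<Rightarrow> (real \<Rightarrow> real) \<Rightarrow> real \<Rightarrow> real \<Rightarrow> real" where
  "test_fun q M E a b = (1 + a\<^sup>2 + b\<^sup>2) powr (q / 2) - M * E a"

text \<open>The first derivative of \<open>test_fun\<close> along a curve through
  \<open>(a, b)\<close> with velocity \<open>(a1, b1)\<close>, where \<open>E1\<close> stands for
  the derivative of \<open>E\<close>.\<close>

definition test_fun1 ::
    "real \<Rightarrow> real \<Rightarrow> (real \<Rightarrow> real) \<Rightarrow> real \<Rightarrow> real \<Rightarrow> real \<Rightarrow> real \<Rightarrow> real" where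
  "test_fun1 q M E1 a b a1 b1 =
     q * (1 + a\<^sup>2 + b\<^sup>2) powr (q / 2 - 1) * (a * a1 + b * b1) - M * (E1 a * a1)"

text \<open>The second derivative along such a curve, with acceleration \<open>(a2, b2)\<close>.
  Keeping position, velocity and acceleration as separate arguments lets one formula serve both the
  s- and the t-direction.\<close>

definition test_fun2 ::
    "real \<Rightarrow> real \<Rightarrow> (real \<Rightarrow> real) \<Rightarrow> (real \<Rightarrow> real) \<Rightarrow>
     real \<Rightarrow> real \<Rightarrow> real \<Rightarrow> real \<Rightarrow> real \<Rightarrow> real \<Rightarrow> real" where
  "test_fun2 q M E1 E2 a b a1 b1 a2 b2 =
     q * (q - 2) * (1 + a\<^sup>2 + b\<^sup>2) powr (q / 2 - 2) * (a * a1 + b * b1)\<^sup>2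
     + q * (1 + a\<^sup>2 + b\<^sup>2) powr (q / 2 - 1) * (a1\<^sup>2 + a * a2 + b1\<^sup>2 + b * b2)
     - M * (E2 a * a1\<^sup>2 + E1 a * a2)"

lemma one_plus_squares_pos: "(0::real) < 1 + a\<^sup>2 + b\<^sup>2"
  by (simp add: add_pos_nonneg)

lemma has_derivative_test_fun:
  assumes "(a has_real_derivative a1) (at x)" "(b has_real_derivative b1) (at x)"
    and "\<And>x. (E has_real_derivative E1 x) (at x)"
  shows "((\<lambda>x. test_fun q M E (a x) (b x)) has_real_derivative
    test_fun1 q M E1 (a x) (b x) a1 b1) (at x)"
proof -
  define Q where "Q x = 1 + (a x)\<^sup>2 + (b x)\<^sup>2" for x
  have Qpos: "0 < Q x" by (simp add: Q_def one_plus_squares_pos)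
  have Q: "(Q has_real_derivative 2 * (a x * a1 + b x * b1)) (at x)"
    unfolding Q_def by (rule derivative_eq_intros assms refl)+ (simp add: algebra_simps)
  have "((\<lambda>x. Q x powr (q / 2)) has_real_derivative
      q / 2 * Q x powr (q / 2 - 1) * (2 * (a x * a1 + b x * b1))) (at x)"
    using DERIV_chain2[OF has_real_derivative_powr[OF Qpos] Q, of "q / 2"] by simp
  then show ?thesis
    unfolding test_fun_def test_fun1_def Q_def[symmetric]
    by (rule DERIV_cong[OF DERIV_diff[OF _ DERIV_cmult[OF DERIV_chain2[OF assms(3) assms(1)]]]])
       (auto simp: algebra_simps)
qed

lemma has_derivative_test_fun1:
  assumes "(a has_real_derivative a1 x) (at x)" "(b has_real_derivative b1 x) (at x)"
    and "(a1 has_real_derivative a2) (at x)" "(b1 has_real_derivative b2) (at x)"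
    and "\<And>x. (E1 has_real_derivative E2 x) (at x)"
  shows "((\<lambda>x. test_fun1 q M E1 (a x) (b x) (a1 x) (b1 x)) has_real_derivative
    test_fun2 q M E1 E2 (a x) (b x) (a1 x) (b1 x) a2 b2) (at x)"
proof -
  define Q where "Q x = 1 + (a x)\<^sup>2 + (b x)\<^sup>2" for x
  have Qpos: "0 < Q x" by (simp add: Q_def one_plus_squares_pos)
  have Q: "(Q has_real_derivative 2 * (a x * a1 x + b x * b1 x)) (at x)"
    unfolding Q_def by (rule derivative_eq_intros assms refl)+ (simp add: algebra_simps)
  have "((\<lambda>x. Q x powr (q / 2 - 1)) has_real_derivative
      (q / 2 - 1) * Q x powr (q / 2 - 1 - 1) * (2 * (a x * a1 x + b x * b1 x))) (at x)"
    using DERIV_chain2[OF has_real_derivative_powr[OF Qpos] Q, of "q / 2 - 1"] by simp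
  then have P: "((\<lambda>x. Q x powr (q / 2 - 1)) has_real_derivative
      (q - 2) * Q x powr (q / 2 - 2) * (a x * a1 x + b x * b1 x)) (at x)"
    by (simp add: algebra_simps)
  show ?thesis
    unfolding test_fun1_def test_fun2_def Q_def[symmetric]
    by (rule derivative_eq_intros P assms DERIV_chain2[OF assms(5)] refl)+
       (simp add: algebra_simps power2_eq_square)
qed

text \<open>Here \<open>\<phi>\<close>, \<open>\<gamma>\<close> are the complex derivatives of the
  two functions, and the accelerations \<open>c\<close>, \<open>d\<close> cancel between the two
  directions. The term with factor q(q - 2) is negative and is dropped. Squaring \<open>le\<close>
  gives |gamma|^2 <= 2 K^2 |phi|^2 + 2 L^2, and \<open>M\<close> is the value for which the
  remaining |phi|^2 terms cancel.\<close>

lemma test_fun2_laplacian_le: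
  fixes q K L a b c d :: real and \<phi> \<gamma> :: complex
  assumes q: "0 < q" "q \<le> 1" and E2: "(1 + a\<^sup>2) powr (q / 2 - 1) \<le> E2 a"
    and le: "cmod \<gamma> \<le> K * cmod \<phi> + L" and KL: "0 \<le> K" "0 \<le> L"
    and M: "M = q * (1 + 2 * K\<^sup>2)"
  shows "test_fun2 q M E1 E2 a b (Re \<phi>) (Re \<gamma>) c d
      + test_fun2 q M E1 E2 a b (- Im \<phi>) (- Im \<gamma>) (- c) (- d) \<le> 2 * L\<^sup>2"
proof -
  define Q where "Q = 1 + a\<^sup>2 + b\<^sup>2"
  define R where "R = Q powr (q / 2 - 1)"
  have Q: "1 \<le> Q" by (simp add: Q_def)
  have R: "0 \<le> R" "R \<le> 1" "R \<le> E2 a"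
  proof -
    show "0 \<le> R" by (simp add: R_def)
    show "R \<le> 1" unfolding R_def using Q q powr_mono[of "q / 2 - 1" 0 Q] by simp
    have "R \<le> (1 + a\<^sup>2) powr (q / 2 - 1)"
      unfolding R_def Q_def using q by (intro powr_mono2') (auto simp: add_pos_nonneg)
    with E2 show "R \<le> E2 a" by simp
  qed
  have sq: "(cmod z)\<^sup>2 = (Re z)\<^sup>2 + (Im z)\<^sup>2" for z by (simp add: cmod_power2)
  have "(cmod \<gamma>)\<^sup>2 \<le> (K * cmod \<phi> + L)\<^sup>2"
    using le by (intro power_mono) auto
  also have "\<dots> \<le> 2 * K\<^sup>2 * (cmod \<phi>)\<^sup>2 + 2 * L\<^sup>2"
    using zero_le_power2[of "K * cmod \<phi> - L"] by (simp add: power2_eq_square algebra_simps)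
  finally have g: "(cmod \<gamma>)\<^sup>2 \<le> 2 * K\<^sup>2 * (cmod \<phi>)\<^sup>2 + 2 * L\<^sup>2" .
  have "test_fun2 q M E1 E2 a b (Re \<phi>) (Re \<gamma>) c d
      + test_fun2 q M E1 E2 a b (- Im \<phi>) (- Im \<gamma>) (- c) (- d)
    = q * (q - 2) * Q powr (q / 2 - 2) * ((a * Re \<phi> + b * Re \<gamma>)\<^sup>2 + (a * Im \<phi> + b * Im \<gamma>)\<^sup>2)
      + q * R * ((cmod \<phi>)\<^sup>2 + (cmod \<gamma>)\<^sup>2) - M * E2 a * (cmod \<phi>)\<^sup>2"
    unfolding test_fun2_def Q_def[symmetric] R_def[symmetric] sq
    by (simp add: power2_eq_square algebra_simps)
  also have "\<dots> \<le> q * R * ((cmod \<phi>)\<^sup>2 + (cmod \<gamma>)\<^sup>2) - M * E2 a * (cmod \<phi>)\<^sup>2"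
  proof -
    have "q * (q - 2) * Q powr (q / 2 - 2) * ((a * Re \<phi> + b * Re \<gamma>)\<^sup>2 + (a * Im \<phi> + b * Im \<gamma>)\<^sup>2) \<le> 0"
      using q by (intro mult_nonpos_nonneg mult_nonneg_nonpos) auto
    then show ?thesis by simp
  qed
  also have "\<dots> \<le> q * R * ((cmod \<phi>)\<^sup>2 + (2 * K\<^sup>2 * (cmod \<phi>)\<^sup>2 + 2 * L\<^sup>2)) - M * R * (cmod \<phi>)\<^sup>2"
  proof -
    have "q * R * ((cmod \<phi>)\<^sup>2 + (cmod \<gamma>)\<^sup>2) \<le> q * R * ((cmod \<phi>)\<^sup>2 + (2 * K\<^sup>2 * (cmod \<phi>)\<^sup>2 + 2 * L\<^sup>2))"
      using g q R by (intro mult_left_mono) auto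
    moreover have "M * R * (cmod \<phi>)\<^sup>2 \<le> M * E2 a * (cmod \<phi>)\<^sup>2"
      using q R by (intro mult_right_mono mult_left_mono) (auto simp: M)
    ultimately show ?thesis by linarith
  qed
  also have "\<dots> = (q * R) * (2 * L\<^sup>2)" by (simp add: M algebra_simps)
  also have "\<dots> \<le> 1 * (2 * L\<^sup>2)"
    using q R by (intro mult_right_mono mult_le_one) auto
  finally show ?thesis by simp
qed

text \<open>Integrate the one-sided bound twice from -1 over an interval of length at most one. An
  upper bound for \<open>n2\<close> suffices because only an upper bound for \<open>n\<close> is
  wanted.\<close>

lemma second_derivative_bound_imp_bounded:
  fixes n n1 n2 :: "real \<Rightarrow> real"
  assumes "\<And>s. s < 0 \<Longrightarrow> (n has_real_derivative n1 s) (at s)"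
    and "\<And>s. s < 0 \<Longrightarrow> (n1 has_real_derivative n2 s) (at s)"
    and "\<And>s. s < 0 \<Longrightarrow> n2 s \<le> C" and "0 \<le> C"
  obtains B where "\<And>s. -1 \<le> s \<Longrightarrow> s < 0 \<Longrightarrow> n s \<le> B"
proof
  fix s :: real assume s: "-1 \<le> s" "s < 0"
  have n1: "n1 x \<le> n1 (-1) + C" if x: "-1 \<le> x" "x < 0" for x
  proof -
    have "n1 x - C * x \<le> n1 (-1) - C * (-1)"
    proof (rule DERIV_nonpos_imp_nonincreasing[of "-1" x "\<lambda>x. n1 x - C * x"])
      fix y assume y: "-1 \<le> y" "y \<le> x"
      have "((\<lambda>x. n1 x - C * x) has_real_derivative n2 y - C) (at y)"
        using y x by (auto intro!: derivative_eq_intros assms(2))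
      moreover have "n2 y - C \<le> 0" using assms(3)[of y] x y by simp
      ultimately show "\<exists>d. ((\<lambda>x. n1 x - C * x) has_real_derivative d) (at y) \<and> d \<le> 0" by blast
    qed (use x in auto)
    moreover have "C * x \<le> 0" using x assms(4) by (simp add: mult_nonneg_nonpos)
    ultimately show ?thesis by linarith
  qed
  define D where "D = n1 (-1) + C"
  have "n s - D * s \<le> n (-1) - D * (-1)"
  proof (rule DERIV_nonpos_imp_nonincreasing[of "-1" s "\<lambda>x. n x - D * x"])
    fix y assume y: "-1 \<le> y" "y \<le> s"
    have "((\<lambda>x. n x - D * x) has_real_derivative n1 y - D) (at y)"
      using y s by (auto intro!: derivative_eq_intros assms(1))
    moreover have "n1 y - D \<le> 0" using n1[of y] s y by (simp add: D_def)
    ultimately show "\<exists>d. ((\<lambda>x. n x - D * x) has_real_derivative d) (at y) \<and> d \<le> 0" by blast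
  qed (use s in auto)
  \<comment> \<open>\<open>D\<close> may be negative, in which case \<open>D * s\<close> is
    positive; hence the absolute value.\<close>
  moreover have "D * s \<le> \<bar>D\<bar>"
  proof -
    have "D * s \<le> \<bar>D\<bar> * \<bar>s\<bar>" by (metis abs_ge_self abs_mult)
    also have "\<dots> \<le> \<bar>D\<bar> * 1" using s by (intro mult_left_mono) auto
    finally show ?thesis by simp
  qed
  ultimately show "n s \<le> n (-1) + 2 * \<bar>D\<bar>" by linarith
qed

lemma left_half_plane_open: "open {w. Re w < 0}"
  by (simp add: open_halfspace_Re_lt)

text \<open>Differentiating twice under the integral, the second s-derivative of the mean is the
  integral of \<open>\<psi>2\<close>. The second t-derivative \<open>\<chi>2\<close> integrates to
  zero over a period, so it may be added for free; the sum is the Laplacian, bounded by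
  \<open>2 * L^2\<close>.\<close>

lemma integral_test_fun_bounded:
  fixes \<Phi> \<Gamma> :: "complex \<Rightarrow> complex"
  assumes hol: "\<Phi> holomorphic_on {w. Re w < 0}" "\<Gamma> holomorphic_on {w. Re w < 0}"
    and per: "\<And>w. \<Phi> (w + 2 * pi * \<i>) = \<Phi> w" "\<And>w. \<Gamma> (w + 2 * pi * \<i>) = \<Gamma> w"
    and le: "\<And>w. Re w < 0 \<Longrightarrow> cmod (deriv \<Gamma> w) \<le> K * cmod (deriv \<Phi> w) + L"
    and KL: "0 \<le> K" "0 \<le> L" and q: "0 < q" "q \<le> 1"
    and E: "\<And>x. (E has_real_derivative E1 x) (at x)" "\<And>x. (E1 has_real_derivative E2 x) (at x)"
      "continuous_on UNIV E2" "\<And>x. (1 + x\<^sup>2) powr (q / 2 - 1) \<le> E2 x"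
    and M: "M = q * (1 + 2 * K\<^sup>2)"
  obtains B where "\<And>s. -1 \<le> s \<Longrightarrow> s < 0 \<Longrightarrow> integral {0..2 * pi}
    (\<lambda>t. test_fun q M E (Re (\<Phi> (Complex s t))) (Re (\<Gamma> (Complex s t)))) \<le> B"
proof -
  note op = left_half_plane_open
  have hol1: "deriv \<Phi> holomorphic_on {w. Re w < 0}" "deriv \<Gamma> holomorphic_on {w. Re w < 0}"
    by (intro holomorphic_deriv hol op)+
  have hol2: "deriv (deriv \<Phi>) holomorphic_on {w. Re w < 0}" "deriv (deriv \<Gamma>) holomorphic_on {w. Re w < 0}"
    by (intro holomorphic_deriv hol1 op)+
  let ?S = "{..<0} \<times> (UNIV :: real set)"
  have cont: "continuous_on ?S (\<lambda>p. f (Complex (fst p) (snd p)))"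
    if "f holomorphic_on {w. Re w < 0}" for f
    unfolding Complex_eq
    by (intro continuous_on_compose2[OF holomorphic_on_imp_continuous_on[OF that]] continuous_intros) auto
  have cE: "continuous_on UNIV E" "continuous_on UNIV E1"
    using E(1,2) DERIV_continuous_on by blast+
  define \<psi> where "\<psi> s t = test_fun q M E (Re (\<Phi> (Complex s t))) (Re (\<Gamma> (Complex s t)))" for s t
  define \<psi>1 where "\<psi>1 s t = test_fun1 q M E1 (Re (\<Phi> (Complex s t))) (Re (\<Gamma> (Complex s t)))
    (Re (deriv \<Phi> (Complex s t))) (Re (deriv \<Gamma> (Complex s t)))" for s t
  define \<psi>2 where "\<psi>2 s t = test_fun2 q M E1 E2 (Re (\<Phi> (Complex s t))) (Re (\<Gamma> (Complex s t)))
    (Re (deriv \<Phi> (Complex s t))) (Re (deriv \<Gamma> (Complex s t)))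
    (Re (deriv (deriv \<Phi>) (Complex s t))) (Re (deriv (deriv \<Gamma>) (Complex s t)))" for s t
  \<comment> \<open>\<open>\<chi>1\<close> and \<open>\<chi>2\<close> are the first two
    t-derivatives of \<open>\<psi>\<close>; the minus signs come from the Cauchy-Riemann
    equations.\<close>
  define \<chi>1 where "\<chi>1 s t = test_fun1 q M E1 (Re (\<Phi> (Complex s t))) (Re (\<Gamma> (Complex s t)))
    (- Im (deriv \<Phi> (Complex s t))) (- Im (deriv \<Gamma> (Complex s t)))" for s t
  define \<chi>2 where "\<chi>2 s t = test_fun2 q M E1 E2 (Re (\<Phi> (Complex s t))) (Re (\<Gamma> (Complex s t)))
    (- Im (deriv \<Phi> (Complex s t))) (- Im (deriv \<Gamma> (Complex s t)))
    (- Re (deriv (deriv \<Phi>) (Complex s t))) (- Re (deriv (deriv \<Gamma>) (Complex s t)))" for s t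
  have d1: "((\<lambda>s. \<psi> s t) has_real_derivative \<psi>1 s t) (at s)" if "s < 0" for s t
    unfolding \<psi>_def \<psi>1_def
    by (intro has_derivative_test_fun real_derivative_Re_slices(1)[OF hol(1) op]
        real_derivative_Re_slices(1)[OF hol(2) op] E(1)) (use that in simp_all)
  have d2: "((\<lambda>s. \<psi>1 s t) has_real_derivative \<psi>2 s t) (at s)" if "s < 0" for s t
    unfolding \<psi>1_def \<psi>2_def
    by (intro has_derivative_test_fun1 real_derivative_Re_slices(1)[OF hol(1) op]
        real_derivative_Re_slices(1)[OF hol(2) op] real_derivative_Re_slices(1)[OF hol1(1) op]
        real_derivative_Re_slices(1)[OF hol1(2) op] E(2)) (use that in simp_all)
  have d3: "((\<lambda>t. \<chi>1 s t) has_real_derivative \<chi>2 s t) (at t)" if "s < 0" for s t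
    unfolding \<chi>1_def \<chi>2_def
    by (intro has_derivative_test_fun1 real_derivative_Re_slices(2)[OF hol(1) op]
        real_derivative_Re_slices(2)[OF hol(2) op] DERIV_minus[OF real_derivative_Re_slices(3)[OF hol1(1) op]]
        DERIV_minus[OF real_derivative_Re_slices(3)[OF hol1(2) op]] E(2)) (use that in simp_all)
  have Q0: "1 + (x::real)\<^sup>2 + y\<^sup>2 \<noteq> 0" for x y using one_plus_squares_pos[of x y] by linarith
  have c: "continuous_on ?S (\<lambda>p. \<psi> (fst p) (snd p))" "continuous_on ?S (\<lambda>p. \<psi>1 (fst p) (snd p))"
    "continuous_on ?S (\<lambda>p. \<psi>2 (fst p) (snd p))" "continuous_on ?S (\<lambda>p. \<chi>2 (fst p) (snd p))"
    unfolding \<psi>_def \<psi>1_def \<psi>2_def \<chi>2_def test_fun_def test_fun1_def test_fun2_def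
    by (intro continuous_intros cont hol hol1 hol2 continuous_on_compose2[OF cE(1)]
        continuous_on_compose2[OF cE(2)] continuous_on_compose2[OF E(3)]; simp add: Q0)+
  have int: "f s integrable_on {0..2 * pi}"
    if "continuous_on ?S (\<lambda>p. f (fst p) (snd p))" "s < 0" for f :: "real \<Rightarrow> real \<Rightarrow> real" and s
  proof -
    have "continuous_on {0..2 * pi} (Pair s)" by (intro continuous_intros)
    then show ?thesis
      using continuous_on_compose2[OF that(1), of "{0..2*pi}" "Pair s"] that(2)
      by (intro integrable_continuous_real) auto
  qed
  have leibniz: "((\<lambda>s. integral {0..2 * pi} (f s)) has_real_derivative integral {0..2 * pi} (g s)) (at s)"
    if "\<And>s t. s < 0 \<Longrightarrow> ((\<lambda>s. f s t) has_real_derivative g s t) (at s)"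
      "continuous_on ?S (\<lambda>p. f (fst p) (snd p))" "continuous_on ?S (\<lambda>p. g (fst p) (snd p))" "s < 0"
    for f g :: "real \<Rightarrow> real \<Rightarrow> real" and s
  proof -
    have "((\<lambda>s. integral (cbox 0 (2 * pi)) (f s)) has_real_derivative integral (cbox 0 (2 * pi)) (g s))
        (at s within {..<0})"
    proof (rule leibniz_rule_field_derivative)
      show "((\<lambda>s. f s t) has_real_derivative g s t) (at s within {..<0})" if "s \<in> {..<0}" for s t
        using that \<open>\<And>s t. s < 0 \<Longrightarrow> ((\<lambda>s. f s t) has_real_derivative g s t) (at s)\<close>
        by (auto intro: has_field_derivative_at_within)
      show "f s integrable_on cbox 0 (2 * pi)" if "s \<in> {..<0}" for s
        using int[OF \<open>continuous_on ?S (\<lambda>p. f (fst p) (snd p))\<close>] that by simp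
      show "continuous_on ({..<0} \<times> cbox 0 (2 * pi)) (\<lambda>(x, y). g x y)"
        using that(3) by (auto simp: case_prod_unfold intro: continuous_on_subset)
    qed (use that in auto)
    then show ?thesis using at_within_open[of s "{..<0}"] that(4) by simp
  qed
  have "integral {0..2 * pi} (\<psi>2 s) \<le> 4 * pi * L\<^sup>2" if s: "s < 0" for s
  proof -
    have shift: "Complex s (2 * pi) = Complex s 0 + 2 * pi * \<i>" by (simp add: complex_eq_iff)
    \<comment> \<open>Since the period is assumed on the whole plane, the two translates of
      \<open>f\<close> are the same function, and \<open>deriv\<close> agrees without any appeal to
      differentiability.\<close>
    have per': "deriv f (Complex s (2 * pi)) = deriv f (Complex s 0)"
      if "\<And>w. f (w + 2 * pi * \<i>) = f w" for f :: "complex \<Rightarrow> complex"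
    proof -
      have "f \<circ> (+) (Complex s (2 * pi)) = f \<circ> (+) (Complex s 0)"
      proof
        fix x
        have "Complex s (2 * pi) + x = (Complex s 0 + x) + 2 * pi * \<i>" by (simp add: shift)
        then show "(f \<circ> (+) (Complex s (2 * pi))) x = (f \<circ> (+) (Complex s 0)) x" by (simp only: o_apply that)
      qed
      then show ?thesis
        using deriv_shift_0[of f "Complex s (2 * pi)"] deriv_shift_0[of f "Complex s 0"] by simp
    qed
    have "\<chi>1 s (2 * pi) = \<chi>1 s 0"
      unfolding \<chi>1_def using per'[of \<Phi>, OF per(1)] per'[of \<Gamma>, OF per(2)] per(1)[of "Complex s 0"] per(2)[of "Complex s 0"]
      by (simp add: shift)
    moreover have "(\<chi>2 s has_integral \<chi>1 s (2 * pi) - \<chi>1 s 0) {0..2 * pi}"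
      using d3[OF s] by (intro fundamental_theorem_of_calculus)
        (auto simp: has_real_derivative_iff_has_vector_derivative intro: has_vector_derivative_at_within)
    ultimately have "integral {0..2 * pi} (\<chi>2 s) = 0" by (simp add: integral_unique)
    then have "integral {0..2 * pi} (\<psi>2 s) = integral {0..2 * pi} (\<lambda>t. \<psi>2 s t + \<chi>2 s t)"
      using int[OF c(3) s] int[OF c(4) s] by (simp add: integral_add)
    also have "\<dots> \<le> integral {0..2 * pi} (\<lambda>t. 2 * L\<^sup>2)"
    proof (rule integral_le)
      show "(\<lambda>t. \<psi>2 s t + \<chi>2 s t) integrable_on {0..2 * pi}"
        using int[OF c(3) s] int[OF c(4) s] by (rule integrable_add)
      show "\<psi>2 s t + \<chi>2 s t \<le> 2 * L\<^sup>2" for t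
        unfolding \<psi>2_def \<chi>2_def
        by (rule test_fun2_laplacian_le[OF q E(4) le KL M]) (use s in simp)
    qed auto
    finally show ?thesis by simp
  qed
  then obtain B where "\<And>s. -1 \<le> s \<Longrightarrow> s < 0 \<Longrightarrow> integral {0..2 * pi} (\<psi> s) \<le> B"
    using second_derivative_bound_imp_bounded[OF leibniz[OF d1 c(1,2)] leibniz[OF d2 c(2,3)]]
    by (metis mult_nonneg_nonneg pi_ge_zero zero_le_numeral zero_le_power2)
  then show ?thesis using that unfolding \<psi>_def by blast
qed

section \<open>From circles in the disc to vertical segments in the left half-plane\<close>

lemma cball_subset_disc: "r < 1 \<Longrightarrow> cball 0 r \<subseteq> (unit_disc :: complex set)"
  by auto

lemma continuous_on_norm_powr:
  "continuous_on S g \<Longrightarrow> 0 < q \<Longrightarrow> continuous_on S (\<lambda>x. norm (g x) powr q)" for q :: real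
  by (rule continuous_on_powr') (auto intro: continuous_intros)

lemma continuous_on_circle:
  assumes "continuous_on unit_disc g" "0 \<le> r" "r < 1"
  shows "continuous_on S (\<lambda>\<theta>. g (complex_of_real r * cis \<theta>))"
  by (rule continuous_on_compose2[OF assms(1)]) (use assms in \<open>auto intro!: continuous_intros simp: norm_mult\<close>)

lemma exp_Complex_ln: "0 < r \<Longrightarrow> exp (Complex (ln r) t) = complex_of_real r * cis t"
  by (simp add: exp_eq_polar)

lemma holomorphic_disc_comp_exp:
  assumes "F holomorphic_on unit_disc"
  shows "(\<lambda>w. F (exp w)) holomorphic_on {w. Re w < 0}"
    and "Re w < 0 \<Longrightarrow> deriv (\<lambda>w. F (exp w)) w = deriv F (exp w) * exp w"
    and "F (exp (w + 2 * pi * \<i>)) = F (exp w)"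
proof -
  show "(\<lambda>w. F (exp w)) holomorphic_on {w. Re w < 0}"
    using holomorphic_on_compose_gen[OF holomorphic_on_exp assms, of "{w. Re w < 0}"]
    by (simp add: o_def image_subset_iff)
  show "deriv (\<lambda>w. F (exp w)) w = deriv F (exp w) * exp w" if "Re w < 0"
  proof (rule DERIV_imp_deriv)
    have "(F has_field_derivative deriv F (exp w)) (at (exp w))"
      using that by (intro holomorphic_derivI[OF assms open_ball]) simp
    then show "((\<lambda>w. F (exp w)) has_field_derivative deriv F (exp w) * exp w) (at w)"
      by (rule DERIV_chain2[OF _ DERIV_exp])
  qed
  show "F (exp (w + 2 * pi * \<i>)) = F (exp w)"
    by (simp add: exp_add exp_two_pi_i)
qed

text \<open>Both derivatives acquire the factor \<open>exp w\<close>, of modulus less than 1: it is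
  common to the two main terms and only shrinks the constant \<open>L\<close>.\<close>

lemma deriv_comp_exp_le:
  assumes "F holomorphic_on unit_disc" "G holomorphic_on unit_disc"
    and "\<And>z. z \<in> unit_disc \<Longrightarrow> cmod (deriv G z) \<le> K * cmod (deriv F z) + L"
    and "0 \<le> L" "Re w < 0"
  shows "cmod (deriv (\<lambda>w. G (exp w)) w) \<le> K * cmod (deriv (\<lambda>w. F (exp w)) w) + L"
proof -
  have "cmod (deriv G (exp w)) * exp (Re w) \<le> (K * cmod (deriv F (exp w)) + L) * exp (Re w)"
    using assms(5) by (intro mult_right_mono assms(3)) auto
  also have "\<dots> \<le> K * (cmod (deriv F (exp w)) * exp (Re w)) + L"
    using mult_left_mono[of "exp (Re w)" 1 L] assms(4,5) by (simp add: algebra_simps)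
  finally show ?thesis
    by (simp add: holomorphic_disc_comp_exp(2) assms norm_mult)
qed

text \<open>Taking p-th powers and roots is monotone, so the root and the normalisation in
  \<open>integral_mean\<close> can be discarded.\<close>

lemma harmonic_hardy_iff:
  assumes "0 < p"
  shows "u \<in> harmonic_hardy p \<longleftrightarrow> harmonic_on u unit_disc \<and>
    (\<exists>B. \<forall>r\<in>{0..<1}. integral {0..2 * pi} (\<lambda>\<theta>. norm (u (complex_of_real r * cis \<theta>)) powr p) \<le> B)"
proof -
  define I where "I r = integral {0..2 * pi} (\<lambda>\<theta>. norm (u (complex_of_real r * cis \<theta>)) powr p)" for r
  \<comment> \<open>No integrability is known for a general \<open>u\<close>; a non-integrable
    function has integral 0 by default.\<close>
  have I: "0 \<le> I r" for r
    unfolding I_def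
    by (cases "(\<lambda>\<theta>. norm (u (complex_of_real r * cis \<theta>)) powr p) integrable_on {0..2 * pi}")
       (auto intro: integral_nonneg simp: not_integrable_integral)
  have "bdd_above ((\<lambda>r. integral_mean p r u) ` {0..<1}) \<longleftrightarrow> (\<exists>B. \<forall>r\<in>{0..<1}. I r \<le> B)"
  proof
    assume "bdd_above ((\<lambda>r. integral_mean p r u) ` {0..<1})"
    then obtain B where B: "\<And>r. r \<in> {0..<1} \<Longrightarrow> (1 / (2 * pi) * I r) powr (1 / p) \<le> B"
      unfolding bdd_above_def integral_mean_def I_def[symmetric] by blast
    have "I r \<le> 2 * pi * B powr p" if "r \<in> {0..<1}" for r
    proof -
      have "1 / (2 * pi) * I r = ((1 / (2 * pi) * I r) powr (1 / p)) powr p"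
        using assms I[of r] by (simp add: powr_powr)
      also have "\<dots> \<le> B powr p"
        using B[OF that] assms by (intro powr_mono2) auto
      finally show ?thesis by (simp add: field_simps)
    qed
    then show "\<exists>B. \<forall>r\<in>{0..<1}. I r \<le> B" by blast
  next
    assume "\<exists>B. \<forall>r\<in>{0..<1}. I r \<le> B"
    then obtain B where B: "\<And>r. r \<in> {0..<1} \<Longrightarrow> I r \<le> B" by blast
    have "(1 / (2 * pi) * I r) powr (1 / p) \<le> (1 / (2 * pi) * B) powr (1 / p)" if "r \<in> {0..<1}" for r
      using B[OF that] I[of r] assms by (intro powr_mono2 mult_left_mono) auto
    then show "bdd_above ((\<lambda>r. integral_mean p r u) ` {0..<1})"
      unfolding bdd_above_def integral_mean_def I_def[symmetric] by blast
  qed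
  then show ?thesis by (auto simp: harmonic_hardy_def I_def)
qed

lemma harmonic_hardyI:
  assumes "0 < p" "harmonic_on u unit_disc"
    and "\<And>r. r \<in> {0..<1} \<Longrightarrow>
      integral {0..2 * pi} (\<lambda>\<theta>. norm (u (complex_of_real r * cis \<theta>)) powr p) \<le> B"
  shows "u \<in> harmonic_hardy p"
  using assms(2,3) unfolding harmonic_hardy_iff[OF assms(1)] by blast

text \<open>The common core of the first two claims: it remains only to supply an \<open>E\<close>
  with large enough second derivative and to control the means of \<open>E(u)\<close>.\<close>

lemma integral_mean_Im_le:
  assumes f: "harmonic_quasiregular K K' f" "0 \<le> K" "0 \<le> K'" and q: "0 < q" "q \<le> 1"
    and E: "\<And>x. (E has_real_derivative E1 x) (at x)" "\<And>x. (E1 has_real_derivative E2 x) (at x)"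
      "continuous_on UNIV E2" "\<And>x. (1 + x\<^sup>2) powr (q / 2 - 1) \<le> E2 x"
  obtains M B where "0 \<le> M" "\<And>r. 0 \<le> r \<Longrightarrow> r < 1 \<Longrightarrow>
    integral {0..2 * pi} (\<lambda>\<theta>. \<bar>Im (f (complex_of_real r * cis \<theta>))\<bar> powr q)
      \<le> M * integral {0..2 * pi} (\<lambda>\<theta>. E (Re (f (complex_of_real r * cis \<theta>)))) + B"
proof -
  obtain F G where FG: "F holomorphic_on unit_disc" "G holomorphic_on unit_disc"
    "\<And>z. z \<in> unit_disc \<Longrightarrow> Re (f z) = Re (F z)" "\<And>z. z \<in> unit_disc \<Longrightarrow> Im (f z) = Re (G z)"
    "\<And>z. z \<in> unit_disc \<Longrightarrow> cmod (deriv G z) \<le> K * cmod (deriv F z) + sqrt K'"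
    using harmonic_quasiregular_holomorphic_parts[OF f] by blast
  define M where "M = q * (1 + 2 * K\<^sup>2)"
  define T where "T z = test_fun q M E (Re (F z)) (Re (G z))" for z
  have cont: "continuous_on unit_disc F" "continuous_on unit_disc G"
    using FG(1,2) holomorphic_on_imp_continuous_on by blast+
  have cE: "continuous_on UNIV E"
    using E(1) DERIV_continuous_on by blast
  have cEF: "continuous_on unit_disc (\<lambda>z. E (Re (F z)))"
    by (rule continuous_on_compose2[OF cE continuous_on_Re[OF cont(1)]]) simp
  have Q0: "1 + (x::real)\<^sup>2 + y\<^sup>2 \<noteq> 0" for x y using one_plus_squares_pos[of x y] by linarith
  have cT: "continuous_on unit_disc T"
    unfolding T_def test_fun_def
    by (intro continuous_intros cont continuous_on_compose2[OF cE]; simp add: Q0)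
  obtain B1 where B1: "\<And>s. -1 \<le> s \<Longrightarrow> s < 0 \<Longrightarrow> integral {0..2 * pi}
      (\<lambda>t. test_fun q M E (Re (F (exp (Complex s t)))) (Re (G (exp (Complex s t))))) \<le> B1"
    using integral_test_fun_bounded[OF holomorphic_disc_comp_exp(1)[OF FG(1)]
        holomorphic_disc_comp_exp(1)[OF FG(2)] holomorphic_disc_comp_exp(3)[OF FG(1)]
        holomorphic_disc_comp_exp(3)[OF FG(2)] deriv_comp_exp_le[OF FG(1,2,5)]
        f(2) real_sqrt_ge_zero[OF f(3)] q E M_def] f(3) by (metis real_sqrt_ge_0_iff)
  \<comment> \<open>The half-plane estimate covers s >= -1, that is radii from exp(-1) on; smaller
    radii lie in a compact disc where \<open>T\<close> is bounded.\<close>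
  have "compact (T ` cball 0 (exp (-1)))"
    using cball_subset_disc[of "exp (-1)"]
    by (intro compact_continuous_image continuous_on_subset[OF cT]) auto
  then obtain B2 where B2: "\<And>z. z \<in> cball 0 (exp (-1)) \<Longrightarrow> T z \<le> B2"
    using compact_imp_bounded bounded_imp_bdd_above by (fastforce simp: bdd_above_def)
  define B where "B = max B1 (2 * pi * B2)"
  have int: "(\<lambda>\<theta>. g (complex_of_real r * cis \<theta>)) integrable_on {0..2 * pi}"
    if "continuous_on unit_disc g" "0 \<le> r" "r < 1" for g :: "complex \<Rightarrow> real" and r
    by (intro integrable_continuous_real continuous_on_circle that)
  have TB: "integral {0..2 * pi} (\<lambda>\<theta>. T (complex_of_real r * cis \<theta>)) \<le> B" if r: "0 \<le> r" "r < 1" for r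
  proof (cases "r \<le> exp (-1)")
    case True
    have "integral {0..2 * pi} (\<lambda>\<theta>. T (complex_of_real r * cis \<theta>)) \<le> integral {0..2 * pi} (\<lambda>\<theta>. B2)"
      using r True by (intro integral_le int[OF cT] B2) (auto simp: norm_mult)
    then show ?thesis by (simp add: B_def)
  next
    case False
    have "0 < r" using False exp_gt_zero[of "-1::real"] by linarith
    moreover have "-1 \<le> ln r" using False \<open>0 < r\<close> by (simp add: ln_ge_iff)
    ultimately show ?thesis using B1[of "ln r"] r by (simp add: exp_Complex_ln T_def B_def)
  qed
  show ?thesis
  proof
    show "0 \<le> M" using q by (simp add: M_def)
    fix r :: real assume r: "0 \<le> r" "r < 1"
    have disc: "complex_of_real r * cis \<theta> \<in> unit_disc" for \<theta> using r by (simp add: norm_mult)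
    have "integral {0..2 * pi} (\<lambda>\<theta>. \<bar>Im (f (complex_of_real r * cis \<theta>))\<bar> powr q)
      = integral {0..2 * pi} (\<lambda>\<theta>. \<bar>Re (G (complex_of_real r * cis \<theta>))\<bar> powr q)"
      using FG(4)[OF disc] by simp
    also have "\<dots> \<le> integral {0..2 * pi} (\<lambda>\<theta>. T (complex_of_real r * cis \<theta>)
        + M * E (Re (F (complex_of_real r * cis \<theta>))))"
    proof (rule integral_le)
      show "(\<lambda>\<theta>. \<bar>Re (G (complex_of_real r * cis \<theta>))\<bar> powr q) integrable_on {0..2 * pi}"
        using int[OF continuous_on_norm_powr[OF continuous_on_Re[OF cont(2)] q(1)] r] by simp
      show "(\<lambda>\<theta>. T (complex_of_real r * cis \<theta>) + M * E (Re (F (complex_of_real r * cis \<theta>))))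
          integrable_on {0..2 * pi}"
        by (rule int[OF continuous_on_add[OF cT continuous_on_mult_left[OF cEF]] r])
      show "\<bar>Re (G (complex_of_real r * cis \<theta>))\<bar> powr q \<le> T (complex_of_real r * cis \<theta>)
          + M * E (Re (F (complex_of_real r * cis \<theta>)))" for \<theta>
      proof -
        \<comment> \<open>This is the only lower bound needed: the first term of
          \<open>test_fun\<close> dominates the q-th power of |v|, so |v|^q is at most
          \<open>T\<close> plus \<open>M\<close> times \<open>E(u)\<close>.\<close>
        have "\<bar>b\<bar> powr q \<le> (1 + a\<^sup>2 + b\<^sup>2) powr (q / 2)" for a b :: real
        proof -
          have "b\<^sup>2 = \<bar>b\<bar> powr 2" by (cases "b = 0") simp_all
          then have "\<bar>b\<bar> powr q = (b\<^sup>2) powr (q / 2)" by (simp only: powr_powr) simp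
          also have "\<dots> \<le> (1 + a\<^sup>2 + b\<^sup>2) powr (q / 2)" using q by (intro powr_mono2) auto
          finally show ?thesis .
        qed
        then show ?thesis by (simp add: T_def test_fun_def)
      qed
    qed
    also have "\<dots> = integral {0..2 * pi} (\<lambda>\<theta>. T (complex_of_real r * cis \<theta>))
        + M * integral {0..2 * pi} (\<lambda>\<theta>. E (Re (F (complex_of_real r * cis \<theta>))))"
    proof -
      have "(\<lambda>\<theta>. E (Re (F (complex_of_real r * cis \<theta>)))) integrable_on {0..2 * pi}"
        by (rule int[OF cEF r])
      then show ?thesis using int[OF cT r] by (simp add: integral_add integrable_on_mult_right)
    qed
    also have "\<dots> \<le> M * integral {0..2 * pi} (\<lambda>\<theta>. E (Re (f (complex_of_real r * cis \<theta>)))) + B"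
      using TB[OF r] FG(3)[OF disc] by simp
    finally show "integral {0..2 * pi} (\<lambda>\<theta>. \<bar>Im (f (complex_of_real r * cis \<theta>))\<bar> powr q)
      \<le> M * integral {0..2 * pi} (\<lambda>\<theta>. E (Re (f (complex_of_real r * cis \<theta>)))) + B" .
  qed
qed

section \<open>The choices of E for q < 1 and for q = 1\<close>

lemma has_derivative_one_plus_square_powr:
  fixes x \<alpha> :: real
  shows "((\<lambda>x. (1 + x\<^sup>2) powr \<alpha>) has_real_derivative 2 * \<alpha> * x * (1 + x\<^sup>2) powr (\<alpha> - 1)) (at x)"
proof -
  have Q: "((\<lambda>x. 1 + x\<^sup>2) has_real_derivative 2 * x) (at x)"
    by (auto intro!: derivative_eq_intros)
  have "0 < 1 + x\<^sup>2" by (simp add: add_pos_nonneg)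
  from DERIV_chain2[OF has_real_derivative_powr[OF this] Q, of \<alpha>] show ?thesis
    by (simp add: mult_ac)
qed

text \<open>The factor x^2 of the product rule is written as (1 + x^2) - 1, so that only powers of 1
  + x^2 remain and can be compared by their exponents.\<close>

lemma has_derivative_id_times_one_plus_square_powr:
  fixes x \<alpha> :: real
  shows "((\<lambda>x. 2 * \<alpha> * x * (1 + x\<^sup>2) powr (\<alpha> - 1)) has_real_derivative
    2 * \<alpha> * (2 * \<alpha> - 1) * (1 + x\<^sup>2) powr (\<alpha> - 1) - 4 * \<alpha> * (\<alpha> - 1) * (1 + x\<^sup>2) powr (\<alpha> - 2)) (at x)"
proof -
  have "((\<lambda>x. 2 * \<alpha> * x * (1 + x\<^sup>2) powr (\<alpha> - 1)) has_real_derivative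
      2 * \<alpha> * (1 + x\<^sup>2) powr (\<alpha> - 1)
      + (2 * (\<alpha> - 1) * x * (1 + x\<^sup>2) powr (\<alpha> - 1 - 1)) * (2 * \<alpha> * x)) (at x)"
    by (rule DERIV_cong[OF DERIV_mult[OF DERIV_cmult_Id has_derivative_one_plus_square_powr]]) simp
  moreover have "(1 + x\<^sup>2) powr (\<alpha> - 1) = (1 + x\<^sup>2) * (1 + x\<^sup>2) powr (\<alpha> - 2)"
    using powr_add[of "1 + x\<^sup>2" 1 "\<alpha> - 2"] by (simp add: add_pos_nonneg)
  ultimately show ?thesis
    by (simp add: algebra_simps power2_eq_square)
qed

theorem Im_in_harmonic_hardy_less_one:
  assumes f: "harmonic_quasiregular K K' f" "0 \<le> K" "0 \<le> K'" and q: "0 < q" "q < 1"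
    and u: "(\<lambda>z. Re (f z)) \<in> harmonic_hardy 1"
  shows "(\<lambda>z. Im (f z)) \<in> harmonic_hardy q"
proof -
  define c where "c = q * (1 - q)"
  have c: "0 < c" using q by (simp add: c_def)
  define g1 where "g1 \<alpha> x = 2 * \<alpha> * x * (1 + x\<^sup>2) powr (\<alpha> - 1)" for \<alpha> x :: real
  define g2 where "g2 \<alpha> x = 2 * \<alpha> * (2 * \<alpha> - 1) * (1 + x\<^sup>2) powr (\<alpha> - 1)
    - 4 * \<alpha> * (\<alpha> - 1) * (1 + x\<^sup>2) powr (\<alpha> - 2)" for \<alpha> x :: real
  \<comment> \<open>The second derivative of -(1 + x^2)^(q/2) has leading term
    \<open>c * (1 + x^2) powr (q / 2 - 1)\<close>, as desired, and a lower order term of the wrong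
    sign. Twice the square root, whose own second derivative is (1 + x^2)^(-3/2), compensates the
    latter and still grows linearly.\<close>
  define E where "E x = (2 * (1 + x\<^sup>2) powr (1 / 2) - (1 + x\<^sup>2) powr (q / 2)) / c" for x
  define E1 where "E1 x = (2 * g1 (1 / 2) x - g1 (q / 2) x) / c" for x
  define E2 where "E2 x = (2 * g2 (1 / 2) x - g2 (q / 2) x) / c" for x
  have d1: "(E has_real_derivative E1 x) (at x)" for x
    unfolding E_def E1_def g1_def
    by (intro DERIV_cdivide DERIV_diff DERIV_cmult has_derivative_one_plus_square_powr)
  have d2: "(E1 has_real_derivative E2 x) (at x)" for x
    unfolding E1_def E2_def g1_def g2_def
    by (intro DERIV_cdivide DERIV_diff DERIV_cmult has_derivative_id_times_one_plus_square_powr)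
  have nz: "1 + (x::real)\<^sup>2 \<noteq> 0" for x using zero_le_power2[of x] by linarith
  have cE2: "continuous_on UNIV E2"
    unfolding E2_def g2_def
    by (intro continuous_on_divide continuous_on_diff continuous_on_mult continuous_on_const
        continuous_on_powr continuous_on_add continuous_on_power continuous_on_id)
       (use c nz in simp_all)
  have E2: "(1 + x\<^sup>2) powr (q / 2 - 1) \<le> E2 x" for x
  proof -
    define X where "X = 1 + x\<^sup>2"
    have X: "1 \<le> X" by (simp add: X_def)
    have le: "X powr (q / 2 - 2) \<le> X powr (1 / 2 - 2)"
      using q X by (intro powr_mono) auto
    \<comment> \<open>The wrong-signed term on the left is dominated by the contribution of the
      square root, since q/2 - 2 < 1/2 - 2 and \<open>X\<close> is at least 1.\<close>
    have "q * (2 - q) * X powr (q / 2 - 2) \<le> 2 * X powr (1 / 2 - 2)"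
    proof (rule mult_mono[OF _ le])
      show "q * (2 - q) \<le> 2" using zero_le_power2[of "1 - q"] by (simp add: power2_eq_square algebra_simps)
    qed auto
    then have "c * X powr (q / 2 - 1) \<le> 2 * g2 (1 / 2) x - g2 (q / 2) x"
      unfolding g2_def X_def[symmetric] c_def by (simp add: field_simps)
    then show ?thesis using c by (simp add: E2_def X_def field_simps)
  qed
  obtain M B where MB: "0 \<le> M" "\<And>r. 0 \<le> r \<Longrightarrow> r < 1 \<Longrightarrow>
      integral {0..2 * pi} (\<lambda>\<theta>. \<bar>Im (f (complex_of_real r * cis \<theta>))\<bar> powr q)
      \<le> M * integral {0..2 * pi} (\<lambda>\<theta>. E (Re (f (complex_of_real r * cis \<theta>)))) + B"
    using integral_mean_Im_le[OF f q(1) less_imp_le[OF q(2)] d1 d2 cE2 E2] by blast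
  obtain A where A: "\<And>r. 0 \<le> r \<Longrightarrow> r < 1 \<Longrightarrow>
      integral {0..2 * pi} (\<lambda>\<theta>. norm (Re (f (complex_of_real r * cis \<theta>))) powr 1) \<le> A"
    using u unfolding harmonic_hardy_iff[OF zero_less_one] Ball_def atLeastLessThan_iff by blast
  have fh: "harmonic_on f unit_disc" using f(1) by (simp add: harmonic_quasiregular_def)
  have cf: "continuous_on unit_disc f"
    using f(1) by (simp add: harmonic_quasiregular_def quasiregular_def ACL2_on_def ACL_on_def)
  have cE: "continuous_on UNIV E" using d1 DERIV_continuous_on by blast
  have E_le: "E x \<le> 2 / c + 2 / c * \<bar>x\<bar>" for x
  proof -
    have "(1 + x\<^sup>2) powr (1 / 2) = sqrt (1 + x\<^sup>2)" by (simp add: powr_half_sqrt)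
    also have "\<dots> \<le> 1 + \<bar>x\<bar>" using sqrt_add_le_add_sqrt[of 1 "x\<^sup>2"] by simp
    finally have "2 * (1 + x\<^sup>2) powr (1 / 2) - (1 + x\<^sup>2) powr (q / 2) \<le> 2 + 2 * \<bar>x\<bar>"
      using powr_ge_zero[of "1 + x\<^sup>2" "q / 2"] by linarith
    from divide_right_mono[OF this less_imp_le[OF c]] show ?thesis
      by (simp add: E_def add_divide_distrib)
  qed
  have int: "(\<lambda>\<theta>. g (f (complex_of_real r * cis \<theta>))) integrable_on {0..2 * pi}"
    if "continuous_on UNIV g" "0 \<le> r" "r < 1" for g :: "complex \<Rightarrow> real" and r
    using continuous_on_compose2[OF that(1) cf]
    by (intro integrable_continuous_real continuous_on_circle[where g = "\<lambda>z. g (f z)"] that) auto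
  have "integral {0..2 * pi} (\<lambda>\<theta>. norm (Im (f (complex_of_real r * cis \<theta>))) powr q)
      \<le> M * (4 * pi / c + 2 / c * A) + B" if r: "r \<in> {0..<1}" for r
  proof -
    have ca: "continuous_on UNIV (\<lambda>z. \<bar>Re z\<bar>)" by (intro continuous_intros)
    have "integral {0..2 * pi} (\<lambda>\<theta>. E (Re (f (complex_of_real r * cis \<theta>))))
      \<le> integral {0..2 * pi} (\<lambda>\<theta>. 2 / c + 2 / c * \<bar>Re (f (complex_of_real r * cis \<theta>))\<bar>)"
      using r by (intro integral_le E_le int[where g = "\<lambda>z. E (Re z)"] integrable_add
          integrable_on_mult_right int[OF ca] continuous_on_compose2[OF cE] continuous_intros) auto
    also have "\<dots> = 4 * pi / c + 2 / c * integral {0..2 * pi} (\<lambda>\<theta>. \<bar>Re (f (complex_of_real r * cis \<theta>))\<bar>)"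
      using r by (subst integral_add[OF integrable_const_ivl integrable_on_mult_right[OF int[OF ca]]]) simp_all
    also have "\<dots> \<le> 4 * pi / c + 2 / c * A"
      using A[of r] r c by (intro add_left_mono mult_left_mono) auto
    finally have "M * integral {0..2 * pi} (\<lambda>\<theta>. E (Re (f (complex_of_real r * cis \<theta>))))
      \<le> M * (4 * pi / c + 2 / c * A)" by (rule mult_left_mono[OF _ MB(1)])
    then show ?thesis using MB(2)[of r] r by simp
  qed
  then show ?thesis
    by (rule harmonic_hardyI[OF q(1) harmonic_on_bounded_linear[OF bounded_linear_Im open_ball fh]])
qed

text \<open>In this form the function is visibly continuous, also where its argument
  vanishes.\<close>

lemma log_plus_abs: "log_plus \<bar>x\<bar> = ln (max 1 \<bar>x\<bar>)"
  by (cases "x = 0"; cases "1 \<le> \<bar>x\<bar>") (auto simp: log_plus_def max_def)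

text \<open>arsinh |x| is at most ln(2|x| + 1). For |x| >= 3 this is at most ln 3 + ln |x|, and ln 3
  <= 2 <= 2 ln |x| accounts for the factor 3; for |x| < 3 the bound ln(1 + y) <= y gives 3 * 6 =
  18.\<close>

lemma arsinh_times_le: "x * arsinh x \<le> 3 * (\<bar>x\<bar> * log_plus \<bar>x\<bar>) + 18" for x :: real
proof -
  have "x * arsinh x = \<bar>x\<bar> * arsinh \<bar>x\<bar>" by (auto simp: abs_if)
  also have "arsinh \<bar>x\<bar> \<le> ln (2 * \<bar>x\<bar> + 1)"
  proof -
    have "sqrt (1 + x\<^sup>2) \<le> 1 + \<bar>x\<bar>" using sqrt_add_le_add_sqrt[of 1 "x\<^sup>2"] by simp
    then show ?thesis
      unfolding arsinh_real_def by (subst ln_le_cancel_iff) (auto simp: add.commute add_pos_nonneg intro!: add_nonneg_pos)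
  qed
  then have "\<bar>x\<bar> * arsinh \<bar>x\<bar> \<le> \<bar>x\<bar> * ln (2 * \<bar>x\<bar> + 1)" by (rule mult_left_mono) simp
  also have "\<dots> \<le> 3 * (\<bar>x\<bar> * log_plus \<bar>x\<bar>) + 18"
  proof (cases "3 \<le> \<bar>x\<bar>")
    case True
    have "exp 1 \<le> \<bar>x\<bar>" using True exp_le by linarith
    then have l: "1 \<le> ln \<bar>x\<bar>" using True by (subst ln_ge_iff) auto
    have "ln (2 * \<bar>x\<bar> + 1) \<le> ln (3 * \<bar>x\<bar>)" using True by (subst ln_le_cancel_iff) auto
    also have "\<dots> = ln 3 + ln \<bar>x\<bar>" using True by (subst ln_mult) auto
    also have "\<dots> \<le> 3 * log_plus \<bar>x\<bar>"
      using l ln_le_minus_one[of "3::real"] by (simp add: log_plus_def)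
    finally have "\<bar>x\<bar> * ln (2 * \<bar>x\<bar> + 1) \<le> \<bar>x\<bar> * (3 * log_plus \<bar>x\<bar>)" by (rule mult_left_mono) simp
    then show ?thesis by simp
  next
    case False
    have "ln (2 * \<bar>x\<bar> + 1) \<le> 2 * \<bar>x\<bar>"
      using ln_add_one_self_le_self[of "2 * \<bar>x\<bar>"] by (simp add: add.commute)
    then have "\<bar>x\<bar> * ln (2 * \<bar>x\<bar> + 1) \<le> 3 * 6"
      using False by (intro mult_mono) auto
    then show ?thesis by (simp add: log_plus_def add_increasing)
  qed
  finally show ?thesis .
qed

theorem Im_in_harmonic_hardy_one:
  assumes f: "harmonic_quasiregular K K' f" "0 \<le> K" "0 \<le> K'"
    and u: "bdd_above ((\<lambda>r. integral {0..2 * pi} (\<lambda>\<theta>. \<bar>Re (f (complex_of_real r * cis \<theta>))\<bar>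
      * log_plus \<bar>Re (f (complex_of_real r * cis \<theta>))\<bar>)) ` {0..<1})"
  shows "(\<lambda>z. Im (f z)) \<in> harmonic_hardy 1"
proof -
  \<comment> \<open>The second primitive of (1 + x^2)^(-1/2), so the requirement on the second
    derivative holds with equality.\<close>
  define E where "E x = x * arsinh x - (1 + x\<^sup>2) powr (1 / 2)" for x :: real
  have nz: "1 + (x::real)\<^sup>2 \<noteq> 0" for x using zero_le_power2[of x] by linarith
  have root: "(1 + x\<^sup>2) powr - (1 / 2) = 1 / sqrt (x\<^sup>2 + 1)" for x :: real
    using powr_minus[of "1 + x\<^sup>2" "1 / 2"] by (simp add: powr_half_sqrt inverse_eq_divide add.commute)
  have d1: "(E has_real_derivative arsinh x) (at x)" for x
    unfolding E_def
    by (rule DERIV_cong[OF DERIV_diff[OF DERIV_mult[OF DERIV_ident arsinh_real_has_field_derivative]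
          has_derivative_one_plus_square_powr]]) (simp add: root)
  have d2: "(arsinh has_real_derivative (1 + x\<^sup>2) powr (1 / 2 - 1)) (at x)" for x :: real
    using arsinh_real_has_field_derivative[of x UNIV] by (simp add: root)
  have cE2: "continuous_on UNIV (\<lambda>x::real. (1 + x\<^sup>2) powr (1 / 2 - 1))"
    by (intro continuous_on_powr continuous_on_add continuous_on_const continuous_on_power continuous_on_id)
       (simp_all add: nz)
  obtain M B where MB: "0 \<le> M" "\<And>r. 0 \<le> r \<Longrightarrow> r < 1 \<Longrightarrow>
      integral {0..2 * pi} (\<lambda>\<theta>. \<bar>Im (f (complex_of_real r * cis \<theta>))\<bar> powr 1)
      \<le> M * integral {0..2 * pi} (\<lambda>\<theta>. E (Re (f (complex_of_real r * cis \<theta>)))) + B"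
    by (rule integral_mean_Im_le[OF f zero_less_one order_refl d1 d2 cE2 order_refl]) (rule that)
  define I where "I r = integral {0..2 * pi} (\<lambda>\<theta>. \<bar>Re (f (complex_of_real r * cis \<theta>))\<bar>
    * log_plus \<bar>Re (f (complex_of_real r * cis \<theta>))\<bar>)" for r
  have "bdd_above (I ` {0..<1})" using u unfolding I_def .
  then obtain A where A: "\<And>r. r \<in> {0..<1} \<Longrightarrow> I r \<le> A"
    unfolding bdd_above_def by blast
  have fh: "harmonic_on f unit_disc" using f(1) by (simp add: harmonic_quasiregular_def)
  have cf: "continuous_on unit_disc f"
    using f(1) by (simp add: harmonic_quasiregular_def quasiregular_def ACL2_on_def ACL_on_def)
  have cE: "continuous_on UNIV E" using d1 DERIV_continuous_on by blast
  have E_le: "E x \<le> 18 + 3 * (\<bar>x\<bar> * log_plus \<bar>x\<bar>)" for x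
    using arsinh_times_le[of x] powr_ge_zero[of "1 + x\<^sup>2" "1 / 2"] unfolding E_def by linarith
  have int: "(\<lambda>\<theta>. g (f (complex_of_real r * cis \<theta>))) integrable_on {0..2 * pi}"
    if "continuous_on UNIV g" "0 \<le> r" "r < 1" for g :: "complex \<Rightarrow> real" and r
    using continuous_on_compose2[OF that(1) cf]
    by (intro integrable_continuous_real continuous_on_circle[where g = "\<lambda>z. g (f z)"] that) auto
  have "integral {0..2 * pi} (\<lambda>\<theta>. norm (Im (f (complex_of_real r * cis \<theta>))) powr 1)
      \<le> M * (36 * pi + 3 * A) + B" if r: "r \<in> {0..<1}" for r
  proof -
    have ca: "continuous_on UNIV (\<lambda>z. \<bar>Re z\<bar> * log_plus \<bar>Re z\<bar>)"
      unfolding log_plus_abs by (intro continuous_intros) auto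
    have "integral {0..2 * pi} (\<lambda>\<theta>. E (Re (f (complex_of_real r * cis \<theta>))))
      \<le> integral {0..2 * pi} (\<lambda>\<theta>. 18 + 3 * (\<bar>Re (f (complex_of_real r * cis \<theta>))\<bar>
        * log_plus \<bar>Re (f (complex_of_real r * cis \<theta>))\<bar>))"
      using r by (intro integral_le E_le int[where g = "\<lambda>z. E (Re z)"] integrable_add
          integrable_on_mult_right int[OF ca] continuous_on_compose2[OF cE] continuous_intros) auto
    also have "\<dots> = 36 * pi + 3 * integral {0..2 * pi} (\<lambda>\<theta>. \<bar>Re (f (complex_of_real r * cis \<theta>))\<bar>
        * log_plus \<bar>Re (f (complex_of_real r * cis \<theta>))\<bar>)"
      using r by (subst integral_add[OF integrable_const_ivl integrable_on_mult_right[OF int[OF ca]]]) simp_all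
    also have "\<dots> \<le> 36 * pi + 3 * A"
      using A[OF r] unfolding I_def by (intro add_left_mono mult_left_mono) auto
    finally have "M * integral {0..2 * pi} (\<lambda>\<theta>. E (Re (f (complex_of_real r * cis \<theta>))))
      \<le> M * (36 * pi + 3 * A)" by (rule mult_left_mono[OF _ MB(1)])
    then show ?thesis using MB(2)[of r] r by simp
  qed
  then show ?thesis
    by (rule harmonic_hardyI[OF zero_less_one harmonic_on_bounded_linear[OF bounded_linear_Im open_ball fh]])
qed

section \<open>Growth of the means for exponents below one\<close>

lemma measurable_Complex [measurable (raw)]:
  assumes [measurable]: "f \<in> borel_measurable M" "g \<in> borel_measurable M"
  shows "(\<lambda>x. Complex (f x) (g x)) \<in> borel_measurable M"
  unfolding Complex_eq by measurable

text \<open>Encoded as an iterated one-dimensional integral, so that translations and rotations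
  reduce to \<open>nn_integral_real_affine\<close> and Fubini; extended nonnegative values avoid
  integrability conditions.\<close>

definition area_integral :: "(complex \<Rightarrow> ennreal) \<Rightarrow> ennreal" where
  "area_integral g = (\<integral>\<^sup>+x. \<integral>\<^sup>+y. g (Complex x y) \<partial>lborel \<partial>lborel)"

lemma area_integral_mono:
  "(\<And>w. g w \<le> h w) \<Longrightarrow> area_integral g \<le> area_integral h"
  unfolding area_integral_def by (intro nn_integral_mono) auto

lemma area_integral_cmult:
  assumes [measurable]: "g \<in> borel_measurable borel"
  shows "area_integral (\<lambda>w. c * g w) = c * area_integral g"
  unfolding area_integral_def
  by (subst nn_integral_cmult[symmetric], measurable) (subst nn_integral_cmult, auto)

lemma area_integral_translate:
  assumes [measurable]: "g \<in> borel_measurable borel"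
  shows "area_integral (\<lambda>w. g (z + w)) = area_integral g"
proof -
  have "area_integral g = (\<integral>\<^sup>+x. \<integral>\<^sup>+y. g (Complex (Re z + 1 * x) y) \<partial>lborel \<partial>lborel)"
    unfolding area_integral_def
    by (subst nn_integral_real_affine[of _ 1 "Re z"]) auto
  also have "\<dots> = (\<integral>\<^sup>+x. \<integral>\<^sup>+y. g (Complex (Re z + 1 * x) (Im z + 1 * y)) \<partial>lborel \<partial>lborel)"
    by (rule nn_integral_cong, subst nn_integral_real_affine[of _ 1 "Im z"]) auto
  also have "\<dots> = area_integral (\<lambda>w. g (z + w))"
  proof -
    have "Complex (Re z + 1 * x) (Im z + 1 * y) = z + Complex x y" for x y
      by (simp add: complex_eq_iff)
    then show ?thesis unfolding area_integral_def by simp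
  qed
  finally show ?thesis ..
qed

text \<open>
  For \<^term>\<open>cos t \<noteq> 0\<close> the rotation matrix is the product of a lower triangular, a diagonal and an
  upper triangular matrix; each factor is an affine change of a single coordinate.
\<close>

lemma area_integral_rotate:
  assumes [measurable]: "g \<in> borel_measurable borel" and c: "cos t \<noteq> 0"
  shows "area_integral (\<lambda>w. g (cis t * w)) = area_integral g"
proof -
  define a b where "a = cos t" and "b = sin t"
  have a: "a \<noteq> 0" and ab: "a * a + b * b = 1"
    using c sin_cos_squared_add2[of t] by (auto simp: a_def b_def)
  \<comment> \<open>The integrand after the substitution of \<open>- b * y + a * x\<close> for the
    first coordinate. The second coordinate \<open>b * x + a * y\<close> takes the stated form
    because a^2 + b^2 = 1.\<close>
  define h where "h x y = g (Complex x (b * x / a + y / a))" for x y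
  have [measurable]: "case_prod h \<in> borel_measurable (lborel \<Otimes>\<^sub>M lborel)"
    "(\<lambda>x. h x y) \<in> borel_measurable borel" for y
    unfolding h_def case_prod_unfold by measurable
  have rot: "cis t * Complex x y = Complex (- b * y + a * x) (b * x + a * y)" for x y
    by (simp add: complex_eq_iff a_def b_def)
  have eq: "g (cis t * Complex x y) = h (- b * y + a * x) y" for x y
  proof -
    have "b * x + a * y = b * (- b * y + a * x) / a + y / a"
      using a ab by (simp add: field_simps) (simp add: distrib_left[symmetric] mult.assoc[symmetric]
          distrib_right[symmetric])
    then show ?thesis by (simp only: rot h_def)
  qed
  have "\<bar>a\<bar> * area_integral (\<lambda>w. g (cis t * w))
      = \<bar>a\<bar> * (\<integral>\<^sup>+y. \<integral>\<^sup>+x. g (cis t * Complex x y) \<partial>lborel \<partial>lborel)"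
    unfolding area_integral_def by (subst lborel_pair.Fubini') auto
  also have "\<dots> = (\<integral>\<^sup>+y. \<bar>a\<bar> * (\<integral>\<^sup>+x. h (- b * y + a * x) y \<partial>lborel) \<partial>lborel)"
    unfolding eq by (subst nn_integral_cmult) auto
  also have "\<dots> = (\<integral>\<^sup>+y. \<integral>\<^sup>+x. h x y \<partial>lborel \<partial>lborel)"
    by (rule nn_integral_cong) (rule nn_integral_real_affine[OF _ a, symmetric], measurable)
  also have "\<dots> = (\<integral>\<^sup>+x. \<integral>\<^sup>+y. h x y \<partial>lborel \<partial>lborel)"
    by (rule lborel_pair.Fubini') measurable
  also have "\<dots> = (\<integral>\<^sup>+x. \<bar>a\<bar> * (\<integral>\<^sup>+y. g (Complex x y) \<partial>lborel) \<partial>lborel)"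
  proof (rule nn_integral_cong)
    fix x
    have "(\<integral>\<^sup>+y. g (Complex x y) \<partial>lborel) = \<bar>1 / a\<bar> * (\<integral>\<^sup>+y. g (Complex x (b * x / a + 1 / a * y)) \<partial>lborel)"
      using a by (intro nn_integral_real_affine) auto
    also have "\<dots> = \<bar>1 / a\<bar> * (\<integral>\<^sup>+y. h x y \<partial>lborel)" by (simp add: h_def)
    finally have "\<bar>a\<bar> * (\<integral>\<^sup>+y. g (Complex x y) \<partial>lborel) = ennreal \<bar>a\<bar> * ennreal \<bar>1 / a\<bar> * (\<integral>\<^sup>+y. h x y \<partial>lborel)"
      by (simp add: mult.assoc)
    also have "ennreal \<bar>a\<bar> * ennreal \<bar>1 / a\<bar> = 1"
      using a by (subst ennreal_mult[symmetric]) auto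
    finally show "(\<integral>\<^sup>+y. h x y \<partial>lborel) = \<bar>a\<bar> * (\<integral>\<^sup>+y. g (Complex x y) \<partial>lborel)" by simp
  qed
  also have "\<dots> = \<bar>a\<bar> * area_integral g"
    unfolding area_integral_def by (subst nn_integral_cmult) auto
  finally show ?thesis using a by (simp add: ennreal_mult_cancel_left)
qed

text \<open>The disc contains the concentric square of side \<open>\<rho>\<close>. This crude bound
  is enough and avoids polar coordinates.\<close>

lemma area_integral_cball_ge:
  assumes "0 < \<rho>"
  shows "ennreal (\<rho>\<^sup>2) \<le> area_integral (indicator (cball 0 \<rho>))"
proof -
  let ?I = "{- \<rho> / 2 .. \<rho> / 2}"
  have "ennreal (\<rho>\<^sup>2) = (\<integral>\<^sup>+x. \<integral>\<^sup>+y. indicator ?I x * indicator ?I y \<partial>lborel \<partial>lborel)"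
    using assms by (simp add: nn_integral_cmult nn_integral_multc ennreal_mult[symmetric] power2_eq_square)
  also have "\<dots> \<le> area_integral (indicator (cball 0 \<rho>))"
    unfolding area_integral_def
  proof (intro nn_integral_mono)
    fix x y :: real
    have "Complex x y \<in> cball 0 \<rho>" if "x \<in> ?I" "y \<in> ?I"
      using cmod_le[of "Complex x y"] that by (auto simp: abs_if split: if_splits)
    then show "(indicator ?I x * indicator ?I y :: ennreal) \<le> indicator (cball 0 \<rho>) (Complex x y)"
      by (auto simp: indicator_def)
  qed
  finally show ?thesis .
qed

text \<open>Cauchy's formula on the unit circle for the rescaled function. The circle is given by a
  starting vector \<open>w\<close> rather than a radius, so that the identity can later be
  integrated over all \<open>w\<close> in a disc.\<close>

lemma has_integral_circle_mean:
  fixes \<Phi> :: "complex \<Rightarrow> complex"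
  assumes "\<Phi> holomorphic_on S" "open S" "cball z (cmod w) \<subseteq> S"
  shows "((\<lambda>t. \<Phi> (z + cis t * w)) has_integral 2 * pi * \<Phi> z) {0..2 * pi}"
proof -
  define f where "f \<zeta> = \<Phi> (z + \<zeta> * w)" for \<zeta>
  have "f holomorphic_on cball 0 1"
    unfolding f_def
  proof (rule holomorphic_on_compose_gen[OF _ assms(1), unfolded o_def])
    show "(\<lambda>\<zeta>. z + \<zeta> * w) holomorphic_on cball 0 1" by (intro holomorphic_intros)
    have "z + \<zeta> * w \<in> cball z (cmod w)" if "\<zeta> \<in> cball 0 1" for \<zeta>
      using that mult_right_mono[of "cmod \<zeta>" 1 "cmod w"] by (simp add: dist_norm norm_mult)
    then show "(\<lambda>\<zeta>. z + \<zeta> * w) ` cball 0 1 \<subseteq> S" using assms(3) by blast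
  qed
  then have "((\<lambda>u. f u / (u - 0)) has_contour_integral 2 * of_real pi * \<i> * f 0) (circlepath 0 1)"
    by (rule Cauchy_integral_circlepath_simple) simp
  then have "((\<lambda>t. f (cis t) * \<i>) has_integral 2 * of_real pi * \<i> * f 0) {0..2 * pi}"
    unfolding circlepath_def has_contour_integral_part_circlepath_iff[of 0 "2 * pi", simplified]
    by simp
  from has_integral_mult_left[OF this, of "- \<i>"] show ?thesis
    by (simp add: f_def mult_ac)
qed

section \<open>Mean value inequalities over discs and local bounds for the derivative\<close>

lemma nn_integral_eq_integral_interval:
  fixes f :: "real \<Rightarrow> real"
  assumes "continuous_on {a..b} f" "\<And>x. x \<in> {a..b} \<Longrightarrow> 0 \<le> f x"
  shows "(\<integral>\<^sup>+x. indicator {a..b} x * ennreal (f x) \<partial>lborel) = ennreal (integral {a..b} f)"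
proof -
  have "(\<integral>\<^sup>+x. ennreal (indicator {a..b} x * f x) \<partial>lborel) = ennreal (integral {a..b} f)"
    using assms by (intro nn_integral_has_integral_lebesgue integrable_integral integrable_continuous_real)
  then show ?thesis by (simp add: ennreal_mult' ennreal_indicator)
qed

lemma borel_measurable_indicator_times_ennreal:
  assumes "A \<in> sets borel" "continuous_on A f"
  shows "(\<lambda>x. indicator A x * ennreal (f x)) \<in> borel_measurable borel"
proof -
  have [measurable]: "(\<lambda>x. indicator A x *\<^sub>R f x) \<in> borel_measurable borel"
    by (rule borel_measurable_continuous_on_indicator[OF assms])
  have "(\<lambda>x. ennreal (indicator A x *\<^sub>R f x)) \<in> borel_measurable borel" by measurable
  then show ?thesis by (simp add: ennreal_mult' ennreal_indicator)
qed

lemma AE_cos_nonzero: "AE t in lborel. cos t \<noteq> (0::real)"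
proof -
  have "{t::real. cos t = 0} \<subseteq> range (\<lambda>i::int. of_int i * (pi / 2))"
    by (auto simp: cos_zero_iff_int)
  then have "countable {t::real. cos t = 0}" by (rule countable_subset) auto
  then have "AE t in lborel. t \<notin> {t::real. cos t = 0}"
    by (intro AE_not_in countable_imp_null_set_lborel)
  then show ?thesis by simp
qed

text \<open>Integrate the circle mean inequality over all \<open>w\<close> in the disc and exchange
  the integrals: for fixed \<open>t\<close> the inner area integral is that of a rotated and
  translated function, hence independent of \<open>t\<close>. Both sides then carry the factor 2
  pi.\<close>

lemma area_mean_value:
  assumes hol: "\<Phi> holomorphic_on S" "open S" and sub: "cball z \<rho> \<subseteq> S" and \<rho>: "0 < \<rho>"
  shows "ennreal (\<rho>\<^sup>2 * \<bar>Re (\<Phi> z)\<bar>) \<le> area_integral (\<lambda>w. indicator (cball z \<rho>) w * ennreal \<bar>Re (\<Phi> w)\<bar>)"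
proof -
  define G :: "complex \<Rightarrow> ennreal" where "G w = indicator (cball z \<rho>) w * ennreal \<bar>Re (\<Phi> w)\<bar>" for w
  have cont: "continuous_on S \<Phi>" by (rule holomorphic_on_imp_continuous_on[OF hol(1)])
  have [measurable]: "G \<in> borel_measurable borel"
    unfolding G_def
    by (intro borel_measurable_indicator_times_ennreal continuous_intros continuous_on_subset[OF cont sub]) simp
  let ?J = "indicator {0..2 * pi} :: real \<Rightarrow> ennreal"
  have circle: "ennreal (2 * pi * \<bar>Re (\<Phi> z)\<bar>) * indicator (cball 0 \<rho>) w
      \<le> (\<integral>\<^sup>+t. ?J t * G (z + cis t * w) \<partial>lborel)" for w
  proof (cases "w \<in> cball 0 \<rho>")
    case True
    have mem: "z + cis t * w \<in> cball z \<rho>" for t using True by (simp add: dist_norm norm_mult)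
    have "cball z (cmod w) \<subseteq> S" using True sub by auto
    from has_integral_circle_mean[OF hol this]
    have I: "((\<lambda>t. \<Phi> (z + cis t * w)) has_integral 2 * pi * \<Phi> z) {0..2 * pi}" .
    have "((\<lambda>t. Re (\<Phi> (z + cis t * w))) has_integral 2 * pi * Re (\<Phi> z)) {0..2 * pi}"
      using has_integral_linear[OF I bounded_linear_Re] by (simp add: o_def)
    then have I': "integral {0..2 * pi} (\<lambda>t. Re (\<Phi> (z + cis t * w))) = 2 * pi * Re (\<Phi> z)"
      "(\<lambda>t. Re (\<Phi> (z + cis t * w))) integrable_on {0..2 * pi}"
      by (auto simp: integral_unique)
    have c: "continuous_on {0..2 * pi} (\<lambda>t. \<bar>Re (\<Phi> (z + cis t * w))\<bar>)"
      using mem sub by (intro continuous_intros continuous_on_compose2[OF cont]) auto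
    have "2 * pi * \<bar>Re (\<Phi> z)\<bar> = \<bar>integral {0..2 * pi} (\<lambda>t. Re (\<Phi> (z + cis t * w)))\<bar>"
      by (simp add: I' abs_mult)
    also have "\<dots> \<le> integral {0..2 * pi} (\<lambda>t. \<bar>Re (\<Phi> (z + cis t * w))\<bar>)"
      using integral_norm_bound_integral[OF I'(2) integrable_continuous_real[OF c]] by simp
    finally have "ennreal (2 * pi * \<bar>Re (\<Phi> z)\<bar>) \<le> (\<integral>\<^sup>+t. ?J t * ennreal \<bar>Re (\<Phi> (z + cis t * w))\<bar> \<partial>lborel)"
      by (subst nn_integral_eq_integral_interval[OF c]) (auto intro: ennreal_leI)
    then show ?thesis using True mem by (simp add: G_def)
  qed simp
  have "ennreal (2 * pi) * ennreal (\<rho>\<^sup>2 * \<bar>Re (\<Phi> z)\<bar>) = ennreal (2 * pi * \<bar>Re (\<Phi> z)\<bar>) * ennreal (\<rho>\<^sup>2)"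
    by (simp add: ennreal_mult[symmetric] mult_ac)
  also have "\<dots> \<le> ennreal (2 * pi * \<bar>Re (\<Phi> z)\<bar>) * area_integral (indicator (cball 0 \<rho>))"
    by (intro mult_left_mono area_integral_cball_ge \<rho>) simp
  also have "\<dots> = area_integral (\<lambda>w. ennreal (2 * pi * \<bar>Re (\<Phi> z)\<bar>) * indicator (cball 0 \<rho>) w)"
    by (rule area_integral_cmult[symmetric, OF borel_measurable_indicator]) simp
  also have "\<dots> \<le> area_integral (\<lambda>w. \<integral>\<^sup>+t. ?J t * G (z + cis t * w) \<partial>lborel)"
    by (intro area_integral_mono circle)
  also have "\<dots> = (\<integral>\<^sup>+x. \<integral>\<^sup>+t. \<integral>\<^sup>+y. ?J t * G (z + cis t * Complex x y) \<partial>lborel \<partial>lborel \<partial>lborel)"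
    unfolding area_integral_def
    by (rule nn_integral_cong, rule lborel_pair.Fubini') (simp add: case_prod_unfold cis.code Complex_eq, measurable)
  also have "\<dots> = (\<integral>\<^sup>+t. \<integral>\<^sup>+x. \<integral>\<^sup>+y. ?J t * G (z + cis t * Complex x y) \<partial>lborel \<partial>lborel \<partial>lborel)"
    by (rule lborel_pair.Fubini') (simp add: case_prod_unfold cis.code Complex_eq, measurable)
  also have "\<dots> = (\<integral>\<^sup>+t. ?J t * area_integral (\<lambda>w. G (z + cis t * w)) \<partial>lborel)"
    by (rule nn_integral_cong) (subst area_integral_cmult[symmetric], auto simp: area_integral_def)
  \<comment> \<open>Rotation invariance was proved only for angles with nonzero cosine; the
    exceptional angles are countable.\<close>
  also have "\<dots> = (\<integral>\<^sup>+t. ?J t * area_integral G \<partial>lborel)"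
    using AE_cos_nonzero
  proof (intro nn_integral_cong_AE, elim eventually_mono)
    fix t :: real assume "cos t \<noteq> 0"
    then show "?J t * area_integral (\<lambda>w. G (z + cis t * w)) = ?J t * area_integral G"
      using area_integral_rotate[of "\<lambda>w. G (z + w)" t] area_integral_translate[of G z] by simp
  qed
  also have "\<dots> = ennreal (2 * pi) * area_integral G"
    by (subst nn_integral_multc) auto
  finally show ?thesis
    unfolding G_def by (subst (asm) ennreal_mult_le_mult_iff) auto
qed

text \<open>Let \<open>w0\<close> maximise |u|^p times the squared distance to the boundary circle.
  On a smaller disc around \<open>w0\<close> the function |u| is at most a constant multiple of its
  value at \<open>w0\<close>, so |u| = |u|^(1-p) |u|^p is controlled by |u|^p there, and the linear
  case applies at \<open>w0\<close>. Maximality carries the result back to \<open>z\<close>.\<close>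

lemma area_mean_value_powr:
  assumes hol: "\<Phi> holomorphic_on S" "open S" and sub: "cball z \<rho> \<subseteq> S" and \<rho>: "0 < \<rho>"
    and p: "0 < p" "p < 1"
  shows "ennreal (\<rho>\<^sup>2 * \<bar>Re (\<Phi> z)\<bar> powr p) \<le> ennreal (4 powr (1 / p))
    * area_integral (\<lambda>w. indicator (cball z \<rho>) w * ennreal (\<bar>Re (\<Phi> w)\<bar> powr p))"
proof -
  define U where "U w = \<bar>Re (\<Phi> w)\<bar>" for w
  \<comment> \<open>The weight is squared to match the scaling of area; as it vanishes on the
    boundary circle, a maximum with nonzero value is interior.\<close>
  define h where "h w = U w powr p * (\<rho> - dist z w)\<^sup>2" for w
  have cont: "continuous_on S \<Phi>" by (rule holomorphic_on_imp_continuous_on[OF hol(1)])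
  have cU: "continuous_on (cball z \<rho>) (\<lambda>w. U w powr p)"
    using continuous_on_norm_powr[OF continuous_on_Re[OF continuous_on_subset[OF cont sub]] p(1)]
    by (simp add: U_def)
  have "continuous_on (cball z \<rho>) h"
    unfolding h_def by (intro continuous_intros cU)
  then obtain w0 where w0: "w0 \<in> cball z \<rho>" "\<And>w. w \<in> cball z \<rho> \<Longrightarrow> h w \<le> h w0"
    using continuous_attains_sup[of "cball z \<rho>" h] \<rho> by auto
  have hz: "\<rho>\<^sup>2 * U z powr p \<le> h w0"
    using w0(2)[of z] \<rho> by (simp add: h_def mult.commute)
  show ?thesis
  proof (cases "h w0 = 0")
    case True
    then have "\<rho>\<^sup>2 * U z powr p = 0" using hz \<rho> by (intro antisym) auto
    then have "ennreal (\<rho>\<^sup>2 * \<bar>Re (\<Phi> z)\<bar> powr p) = 0" by (simp only: U_def ennreal_0)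
    then show ?thesis by (metis zero_le)
  next
    case False
    define d where "d = \<rho> - dist z w0"
    define u where "u = U w0"
    have d: "0 < d" and u: "0 < u"
      using False w0(1) by (auto simp: h_def d_def u_def U_def less_le)
    have sub': "cball w0 (d / 2) \<subseteq> cball z \<rho>"
    proof
      fix w assume "w \<in> cball w0 (d / 2)"
      then show "w \<in> cball z \<rho>" using dist_triangle[of z w w0] d by (simp add: d_def)
    qed
    define c where "c = (4 powr (1 / p) * u) powr (1 - p)"
    \<comment> \<open>Points within \<open>d / 2\<close> of \<open>w0\<close> keep distance at least
      \<open>d / 2\<close> from the boundary, so maximality gives
      \<open>U w powr p <= 4 * u powr p\<close>, with 4 the square of the ratio of the two
      distances.\<close>
    have Uw: "U w \<le> c * U w powr p" if w: "w \<in> cball w0 (d / 2)" for w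
    proof -
      have "d / 2 \<le> \<rho> - dist z w" using dist_triangle[of z w w0] w by (simp add: d_def)
      then have "U w powr p * (d / 2)\<^sup>2 \<le> h w"
        unfolding h_def using d by (intro mult_left_mono power_mono) auto
      also have "\<dots> \<le> u powr p * d\<^sup>2"
        using w0(2)[of w] sub' w by (auto simp: h_def u_def d_def)
      finally have "U w powr p \<le> 4 * u powr p" using d by (simp add: power_divide field_simps)
      then have "(U w powr p) powr (1 / p) \<le> (4 * u powr p) powr (1 / p)"
        using p by (intro powr_mono2) auto
      then have "U w \<le> 4 powr (1 / p) * u"
        using p u by (simp add: powr_powr powr_mult U_def)
      then have "U w powr (1 - p) \<le> c"
        unfolding c_def using p by (intro powr_mono2) (auto simp: U_def)
      then have "U w powr (1 - p) * U w powr p \<le> c * U w powr p" by (rule mult_right_mono) simp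
      then show ?thesis by (simp add: powr_add[symmetric] U_def)
    qed
    let ?A = "area_integral (\<lambda>w. indicator (cball z \<rho>) w * ennreal (U w powr p))"
    have "ennreal ((d / 2)\<^sup>2 * u) \<le> area_integral (\<lambda>w. indicator (cball w0 (d / 2)) w * ennreal (U w))"
      unfolding u_def U_def using sub' sub d by (intro area_mean_value[OF hol]) auto
    also have "\<dots> \<le> area_integral (\<lambda>w. ennreal c * (indicator (cball z \<rho>) w * ennreal (U w powr p)))"
    proof (rule area_integral_mono)
      fix w
      show "indicator (cball w0 (d / 2)) w * ennreal (U w)
          \<le> ennreal c * (indicator (cball z \<rho>) w * ennreal (U w powr p))"
      proof (cases "w \<in> cball w0 (d / 2)")
        case True
        then have "w \<in> cball z \<rho>" using sub' by blast
        then show ?thesis using True Uw[OF True] by (simp add: ennreal_mult[symmetric] c_def ennreal_leI)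
      qed simp
    qed
    also have "\<dots> = ennreal c * ?A"
      by (intro area_integral_cmult borel_measurable_indicator_times_ennreal cU) simp
    finally have main: "ennreal ((d / 2)\<^sup>2 * u) \<le> ennreal c * ?A" .
    have k: "4 * u powr (p - 1) * c = 4 powr (1 / p)"
    proof -
      have "u powr (p - 1) * u powr (1 - p) = 1" using u by (simp add: powr_add[symmetric])
      moreover have "(4::real) * 4 powr ((1 - p) / p) = 4 powr (1 / p)"
        using powr_add[of 4 1 "(1 - p) / p"] p by (simp add: diff_divide_distrib)
      moreover have "4 * u powr (p - 1) * c
          = (u powr (p - 1) * u powr (1 - p)) * (4 * 4 powr ((1 - p) / p))"
        using u by (simp add: c_def powr_mult powr_powr)
      ultimately show ?thesis by simp
    qed
    have "ennreal (\<rho>\<^sup>2 * U z powr p) \<le> ennreal (u powr p * d\<^sup>2)"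
      using hz by (intro ennreal_leI) (simp add: h_def u_def d_def)
    also have "u powr p * d\<^sup>2 = 4 * u powr (p - 1) * ((d / 2)\<^sup>2 * u)"
    proof -
      have "u powr p = u powr (p - 1) * u"
        using u powr_add[of u "p - 1" 1] by simp
      then show ?thesis by (simp add: power_divide)
    qed
    also have "ennreal (4 * u powr (p - 1) * ((d / 2)\<^sup>2 * u)) = ennreal (4 * u powr (p - 1)) * ennreal ((d / 2)\<^sup>2 * u)"
      using u by (intro ennreal_mult) auto
    also have "\<dots> \<le> ennreal (4 * u powr (p - 1)) * (ennreal c * ?A)"
      by (intro mult_left_mono main) simp
    also have "\<dots> = ennreal (4 * u powr (p - 1) * c) * ?A"
      by (subst ennreal_mult) (auto simp: c_def mult.assoc)
    finally show ?thesis by (simp only: k) (simp add: U_def)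
  qed
qed

text \<open>In Cauchy's formula for the derivative the conjugate of \<open>\<Phi>\<close> may be
  added, since its integral against \<open>cis (- t)\<close> vanishes: it is the conjugate of a
  circle mean of \<open>\<Phi> \<zeta> * (\<zeta> - z)\<close>, which is zero at the centre. The sum
  is twice the real part.\<close>

lemma deriv_bound_by_Re:
  assumes hol: "\<Phi> holomorphic_on S" "open S" and sub: "cball z \<rho> \<subseteq> S" and \<rho>: "0 < \<rho>"
    and m: "\<And>w. w \<in> cball z \<rho> \<Longrightarrow> \<bar>Re (\<Phi> w)\<bar> \<le> m"
  shows "\<rho> * cmod (deriv \<Phi> z) \<le> 2 * m"
proof -
  define w where "w t = z + complex_of_real \<rho> * cis t" for t
  have mem: "w t \<in> cball z \<rho>" for t using \<rho> by (simp add: w_def dist_norm norm_mult)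
  have cont: "continuous_on S \<Phi>" by (rule holomorphic_on_imp_continuous_on[OF hol(1)])
  have "((\<lambda>u. \<Phi> u / (u - z) ^ Suc 1) has_contour_integral
      (2 * pi * \<i>) / fact 1 * (deriv ^^ 1) \<Phi> z) (circlepath z \<rho>)"
    using sub \<rho> ball_subset_cball[of z \<rho>]
    by (intro Cauchy_has_contour_integral_higher_derivative_circlepath continuous_on_subset[OF cont]
        holomorphic_on_subset[OF hol(1)]) auto
  then have "((\<lambda>t. \<Phi> (w t) / (complex_of_real \<rho> * cis t)\<^sup>2 * complex_of_real \<rho> * \<i> * cis t)
      has_integral 2 * pi * \<i> * deriv \<Phi> z) {0..2 * pi}"
    unfolding circlepath_def
    by (subst (asm) has_contour_integral_part_circlepath_iff) (simp_all add: w_def numeral_2_eq_2)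
  from has_integral_mult_left[OF this, of "- \<i> * \<rho>"]
  have "((\<lambda>t. \<Phi> (w t) * cis (- t)) has_integral complex_of_real (2 * pi * \<rho>) * deriv \<Phi> z) {0..2 * pi}"
  proof (rule has_integral_eq_rhs[OF has_integral_eq[rotated]])
    show "\<Phi> (w t) / (complex_of_real \<rho> * cis t)\<^sup>2 * complex_of_real \<rho> * \<i> * cis t * (- \<i> * \<rho>)
        = \<Phi> (w t) * cis (- t)" for t
      using \<rho> by (simp add: power2_eq_square field_simps cis_mult[symmetric] flip: cis_inverse)
  qed (simp add: mult_ac)
  moreover have "((\<lambda>t. cnj (\<Phi> (w t)) * cis (- t)) has_integral 0) {0..2 * pi}"
  proof -
    have h: "(\<lambda>\<zeta>. \<Phi> \<zeta> * (\<zeta> - z)) holomorphic_on S" by (intro holomorphic_intros hol)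
    have "((\<lambda>t. \<Phi> (w t) * (cis t * \<rho>)) has_integral 0) {0..2 * pi}"
      using has_integral_circle_mean[OF h hol(2), of z "complex_of_real \<rho>"] sub \<rho>
      by (simp add: w_def mult.commute)
    from has_integral_mult_left[OF has_integral_linear[OF this bounded_linear_cnj], of "inverse \<rho>"]
    show ?thesis using \<rho> by (simp add: o_def cis_cnj mult.assoc)
  qed
  ultimately have "((\<lambda>t. \<Phi> (w t) * cis (- t) + cnj (\<Phi> (w t)) * cis (- t)) has_integral
      complex_of_real (2 * pi * \<rho>) * deriv \<Phi> z + 0) (cbox 0 (2 * pi))"
    unfolding box_real by (rule has_integral_add)
  then have "cmod (complex_of_real (2 * pi * \<rho>) * deriv \<Phi> z + 0) \<le> 2 * m * measure lborel (cbox 0 (2 * pi))"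
  proof (rule has_integral_bound[rotated])
    show "0 \<le> 2 * m" using m[OF mem[of 0]] by simp
    show "cmod (\<Phi> (w t) * cis (- t) + cnj (\<Phi> (w t)) * cis (- t)) \<le> 2 * m" for t
      using m[OF mem[of t]]
      by (simp add: distrib_right[symmetric] norm_mult complex_add_cnj)
  qed
  then show ?thesis using \<rho> by (simp add: norm_mult)
qed

text \<open>The derivative is bounded by the maximum of |Re Phi| on the disc of radius
  \<open>\<rho>\<close>. The mean value inequality is applied at the maximising point, whose own
  disc of radius \<open>\<rho>\<close> lies in the doubled one.\<close>

lemma deriv_powr_local_bound:
  assumes hol: "\<Phi> holomorphic_on S" "open S" and sub: "cball z (2 * \<rho>) \<subseteq> S" and \<rho>: "0 < \<rho>"
    and p: "0 < p" "p < 1"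
  shows "ennreal (\<rho>\<^sup>2 * (\<rho> * cmod (deriv \<Phi> z)) powr p) \<le> ennreal (2 powr p * 4 powr (1 / p))
    * area_integral (\<lambda>w. indicator (cball z (2 * \<rho>)) w * ennreal (\<bar>Re (\<Phi> w)\<bar> powr p))"
proof -
  have cont: "continuous_on S \<Phi>" by (rule holomorphic_on_imp_continuous_on[OF hol(1)])
  have sub': "cball w \<rho> \<subseteq> cball z (2 * \<rho>)" if "w \<in> cball z \<rho>" for w
  proof
    fix v assume "v \<in> cball w \<rho>"
    then show "v \<in> cball z (2 * \<rho>)" using that dist_triangle[of z v w] by simp
  qed
  have "cball z \<rho> \<subseteq> S" using sub \<rho> by (auto simp: subset_iff)
  then have "continuous_on (cball z \<rho>) (\<lambda>w. \<bar>Re (\<Phi> w)\<bar>)"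
    by (intro continuous_intros continuous_on_subset[OF cont])
  then obtain w0 where w0: "w0 \<in> cball z \<rho>" "\<And>w. w \<in> cball z \<rho> \<Longrightarrow> \<bar>Re (\<Phi> w)\<bar> \<le> \<bar>Re (\<Phi> w0)\<bar>"
    using continuous_attains_sup[of "cball z \<rho>" "\<lambda>w. \<bar>Re (\<Phi> w)\<bar>"] \<rho> by auto
  have "\<rho> * cmod (deriv \<Phi> z) \<le> 2 * \<bar>Re (\<Phi> w0)\<bar>"
    by (rule deriv_bound_by_Re[OF hol \<open>cball z \<rho> \<subseteq> S\<close> \<rho> w0(2)])
  then have "(\<rho> * cmod (deriv \<Phi> z)) powr p \<le> (2 * \<bar>Re (\<Phi> w0)\<bar>) powr p"
    using \<rho> p by (intro powr_mono2) auto
  then have "\<rho>\<^sup>2 * (\<rho> * cmod (deriv \<Phi> z)) powr p \<le> 2 powr p * (\<rho>\<^sup>2 * \<bar>Re (\<Phi> w0)\<bar> powr p)"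
    using mult_left_mono[of _ _ "\<rho>\<^sup>2"] by (fastforce simp: powr_mult mult_ac)
  then have "ennreal (\<rho>\<^sup>2 * (\<rho> * cmod (deriv \<Phi> z)) powr p)
      \<le> ennreal (2 powr p) * ennreal (\<rho>\<^sup>2 * \<bar>Re (\<Phi> w0)\<bar> powr p)"
    by (subst ennreal_mult[symmetric]) (auto intro: ennreal_leI)
  also have "\<dots> \<le> ennreal (2 powr p) * (ennreal (4 powr (1 / p))
      * area_integral (\<lambda>w. indicator (cball w0 \<rho>) w * ennreal (\<bar>Re (\<Phi> w)\<bar> powr p)))"
    using sub sub'[OF w0(1)] by (intro mult_left_mono area_mean_value_powr[OF hol] \<rho> p) auto
  also have "\<dots> \<le> ennreal (2 powr p) * (ennreal (4 powr (1 / p))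
      * area_integral (\<lambda>w. indicator (cball z (2 * \<rho>)) w * ennreal (\<bar>Re (\<Phi> w)\<bar> powr p)))"
    using sub'[OF w0(1)] by (intro mult_left_mono area_integral_mono mult_right_mono) (auto simp: indicator_def)
  finally show ?thesis by (simp add: ennreal_mult mult.assoc)
qed

text \<open>After scaling the sum to 1 this is x <= x^p on [0, 1].\<close>

lemma add_powr_le:
  fixes a b p :: real
  assumes "0 \<le> a" "0 \<le> b" "0 < p" "p \<le> 1"
  shows "(a + b) powr p \<le> a powr p + b powr p"
proof (cases "a + b = 0")
  case False
  then have ab: "0 < a + b" using assms by linarith
  have le: "x \<le> x powr p" if "0 \<le> x" "x \<le> 1" for x :: real
    using that assms powr_mono'[of p 1 x] by (cases "x = 0") auto
  have "1 = a / (a + b) + b / (a + b)" using ab by (simp add: add_divide_distrib[symmetric])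
  also have "\<dots> \<le> (a / (a + b)) powr p + (b / (a + b)) powr p"
    using ab assms by (intro add_mono le) auto
  also have "\<dots> = (a powr p + b powr p) / (a + b) powr p"
    using ab assms by (simp add: powr_divide add_divide_distrib)
  finally show ?thesis using ab by (simp add: field_simps)
qed (use assms in simp)

section \<open>Summing the local bounds over one period\<close>

lemma nn_integral_periodic_shift:
  fixes h :: "real \<Rightarrow> ennreal"
  assumes [measurable]: "h \<in> borel_measurable borel" and per: "\<And>y. h (y + c) = h y"
  shows "(\<integral>\<^sup>+y. indicator {a + c..b + c} y * h y \<partial>lborel) = (\<integral>\<^sup>+y. indicator {a..b} y * h y \<partial>lborel)"
proof -
  have "(\<integral>\<^sup>+y. indicator {a + c..b + c} y * h y \<partial>lborel)
      = (\<integral>\<^sup>+y. indicator {a + c..b + c} (c + 1 * y) * h (c + 1 * y) \<partial>lborel)"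
    by (subst nn_integral_real_affine[of _ 1 c]) auto
  also have "\<dots> = (\<integral>\<^sup>+y. indicator {a..b} y * h y \<partial>lborel)"
    using per by (intro nn_integral_cong) (auto simp: indicator_def add.commute)
  finally show ?thesis .
qed

lemma nn_integral_periodic_three:
  fixes h :: "real \<Rightarrow> ennreal"
  assumes h[measurable]: "h \<in> borel_measurable borel" and per: "\<And>y. h (y + 2 * pi) = h y"
  shows "(\<integral>\<^sup>+y. indicator {- 2 * pi..4 * pi} y * h y \<partial>lborel)
    \<le> 3 * (\<integral>\<^sup>+y. indicator {0..2 * pi} y * h y \<partial>lborel)"
proof -
  let ?N = "\<lambda>a b. \<integral>\<^sup>+y. indicator {a..b} y * h y \<partial>lborel"
  have "?N (- 2 * pi) (4 * pi) \<le> (\<integral>\<^sup>+y. indicator {- 2 * pi..0} y * h y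
      + (indicator {0..2 * pi} y * h y + indicator {2 * pi..4 * pi} y * h y) \<partial>lborel)"
    by (intro nn_integral_mono) (auto simp: indicator_def)
  also have "\<dots> = ?N (- 2 * pi) 0 + (?N 0 (2 * pi) + ?N (2 * pi) (4 * pi))"
    by (subst nn_integral_add, simp, simp)+ simp
  also have "?N (- 2 * pi) 0 = ?N 0 (2 * pi)"
    using nn_integral_periodic_shift[OF h per, of "- 2 * pi" 0] by simp
  also have "?N (2 * pi) (4 * pi) = ?N 0 (2 * pi)"
    using nn_integral_periodic_shift[OF h per, of 0 "2 * pi"] by simp
  also have "?N 0 (2 * pi) + (?N 0 (2 * pi) + ?N 0 (2 * pi)) = 3 * ?N 0 (2 * pi)"
  proof -
    have "(3::ennreal) = 1 + (1 + 1)" by simp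
    then show ?thesis by (simp only: distrib_right mult_1)
  qed
  finally show ?thesis .
qed

text \<open>Exchange the integrals: a given height y lies in the windows of a set of t of measure at
  most \<open>4 * \<rho>\<close>, and the windows centred in [0, 2 pi] stay within three periods.
  Hence 12 = 4 * 3.\<close>

lemma nn_integral_sliding_window:
  fixes g :: "complex \<Rightarrow> ennreal"
  assumes [measurable]: "g \<in> borel_measurable borel" and \<rho>: "0 < \<rho>" "2 * \<rho> \<le> 2 * pi"
    and per: "\<And>w. g (w + 2 * pi * \<i>) = g w"
    and A: "\<And>x. x \<in> {a..b} \<Longrightarrow> (\<integral>\<^sup>+y. indicator {0..2 * pi} y * g (Complex x y) \<partial>lborel) \<le> ennreal A"
    and ab: "a \<le> b" "0 \<le> A"
  shows "(\<integral>\<^sup>+t. indicator {0..2 * pi} t * area_integral (\<lambda>w. indicator {a..b} (Re w)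
      * (indicator {t - 2 * \<rho>..t + 2 * \<rho>} (Im w) * g w)) \<partial>lborel) \<le> ennreal (12 * \<rho> * A * (b - a))"
proof -
  let ?J = "indicator {0..2 * pi} :: real \<Rightarrow> ennreal"
  let ?W = "\<lambda>t y. indicator {t - 2 * \<rho>..t + 2 * \<rho>} y :: ennreal"
  \<comment> \<open>Written as a condition on \<open>y - t\<close>, the window is seen to be
    measurable in both variables jointly, as Fubini requires.\<close>
  have W: "?W t y = (if \<bar>y - t\<bar> \<le> 2 * \<rho> then 1 else 0)" for t y
    by (auto simp: indicator_def)
  have [measurable]: "(\<lambda>p. ?W (f p) (k p)) \<in> borel_measurable M"
    if [measurable]: "f \<in> borel_measurable M" "k \<in> borel_measurable M" for f k and M :: "'c measure"
    unfolding W by measurable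
  have window: "(\<integral>\<^sup>+t. ?J t * ?W t y \<partial>lborel) \<le> ennreal (4 * \<rho>) * indicator {- 2 * pi..4 * pi} y" for y
  proof -
    have "(\<integral>\<^sup>+t. ?J t * ?W t y \<partial>lborel)
        \<le> (\<integral>\<^sup>+t. indicator {y - 2 * \<rho>..y + 2 * \<rho>} t * indicator {- 2 * pi..4 * pi} y \<partial>lborel)"
      using \<rho> by (intro nn_integral_mono) (auto simp: indicator_def)
    also have "\<dots> = ennreal (4 * \<rho>) * indicator {- 2 * pi..4 * pi} y"
      using \<rho> by (subst nn_integral_multc) auto
    finally show ?thesis .
  qed
  have "(\<integral>\<^sup>+t. ?J t * area_integral (\<lambda>w. indicator {a..b} (Re w) * (?W t (Im w) * g w)) \<partial>lborel)
      = (\<integral>\<^sup>+t. \<integral>\<^sup>+x. \<integral>\<^sup>+y. ?J t * (indicator {a..b} x * (?W t y * g (Complex x y))) \<partial>lborel \<partial>lborel \<partial>lborel)"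
    unfolding area_integral_def by (simp add: nn_integral_cmult)
  also have "\<dots> = (\<integral>\<^sup>+x. \<integral>\<^sup>+t. \<integral>\<^sup>+y. ?J t * (indicator {a..b} x * (?W t y * g (Complex x y))) \<partial>lborel \<partial>lborel \<partial>lborel)"
    by (rule lborel_pair.Fubini') (simp add: case_prod_unfold)
  also have "\<dots> = (\<integral>\<^sup>+x. \<integral>\<^sup>+y. \<integral>\<^sup>+t. ?J t * (indicator {a..b} x * (?W t y * g (Complex x y))) \<partial>lborel \<partial>lborel \<partial>lborel)"
    by (rule nn_integral_cong, rule lborel_pair.Fubini') (simp add: case_prod_unfold)
  also have "\<dots> = (\<integral>\<^sup>+x. \<integral>\<^sup>+y. (indicator {a..b} x * g (Complex x y)) * (\<integral>\<^sup>+t. ?J t * ?W t y \<partial>lborel) \<partial>lborel \<partial>lborel)"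
    by (intro nn_integral_cong) (subst nn_integral_cmult[symmetric], simp, simp add: mult_ac)
  also have "\<dots> \<le> (\<integral>\<^sup>+x. \<integral>\<^sup>+y. (indicator {a..b} x * g (Complex x y))
      * (ennreal (4 * \<rho>) * indicator {- 2 * pi..4 * pi} y) \<partial>lborel \<partial>lborel)"
    by (intro nn_integral_mono mult_left_mono window) simp
  also have "\<dots> = (\<integral>\<^sup>+x. (ennreal (4 * \<rho>) * indicator {a..b} x)
      * (\<integral>\<^sup>+y. indicator {- 2 * pi..4 * pi} y * g (Complex x y) \<partial>lborel) \<partial>lborel)"
    by (intro nn_integral_cong) (subst nn_integral_cmult[symmetric], simp, simp add: mult_ac)
  also have "\<dots> = (\<integral>\<^sup>+x. ennreal (4 * \<rho>) * (indicator {a..b} x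
      * (\<integral>\<^sup>+y. indicator {- 2 * pi..4 * pi} y * g (Complex x y) \<partial>lborel)) \<partial>lborel)"
    by (simp only: mult.assoc)
  also have "\<dots> \<le> (\<integral>\<^sup>+x. ennreal (4 * \<rho>) * (indicator {a..b} x * ennreal (3 * A)) \<partial>lborel)"
  proof (rule nn_integral_mono, rule mult_left_mono)
    fix x
    show "indicator {a..b} x * (\<integral>\<^sup>+y. indicator {- 2 * pi..4 * pi} y * g (Complex x y) \<partial>lborel)
        \<le> indicator {a..b} x * ennreal (3 * A)"
    proof (cases "x \<in> {a..b}")
      case True
      have "g (Complex x (y + 2 * pi)) = g (Complex x y)" for y
      proof -
        have "Complex x (y + 2 * pi) = Complex x y + 2 * pi * \<i>" by (simp add: complex_eq_iff)
        then show ?thesis using per by simp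
      qed
      then have "(\<integral>\<^sup>+y. indicator {- 2 * pi..4 * pi} y * g (Complex x y) \<partial>lborel)
          \<le> 3 * (\<integral>\<^sup>+y. indicator {0..2 * pi} y * g (Complex x y) \<partial>lborel)"
        by (intro nn_integral_periodic_three) measurable
      also have "\<dots> \<le> 3 * ennreal A" by (intro mult_left_mono A True) simp
      finally show ?thesis using True ab by (simp add: ennreal_mult)
    qed simp
  qed simp
  also have "\<dots> = ennreal (4 * \<rho>) * (ennreal (b - a) * ennreal (3 * A))"
    using ab by (simp add: nn_integral_cmult nn_integral_multc)
  also have "\<dots> = ennreal (12 * \<rho> * A * (b - a))"
    using ab \<rho> by (simp add: ennreal_mult[symmetric] mult_ac)
  finally show ?thesis .
qed

text \<open>For each \<open>t\<close> the increment is estimated by the mean value theorem and the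
  local derivative bound, then integrated with the sliding window estimate. The bound does not
  depend on \<open>s1\<close> and \<open>s2\<close>, because the areas on both sides are of order
  \<open>\<rho>^2\<close>.\<close>

lemma integral_powr_increment_le:
  fixes \<Phi> \<Gamma> :: "complex \<Rightarrow> complex"
  assumes hol: "\<Phi> holomorphic_on {w. Re w < 0}" "\<Gamma> holomorphic_on {w. Re w < 0}"
    and per: "\<And>w. \<Phi> (w + 2 * pi * \<i>) = \<Phi> w"
    and le: "\<And>w. Re w < 0 \<Longrightarrow> cmod (deriv \<Gamma> w) \<le> K * cmod (deriv \<Phi> w) + L"
    and KL: "0 \<le> K" "0 \<le> L" and p: "0 < p" "p < 1"
    and A: "\<And>s. s < 0 \<Longrightarrow> integral {0..2 * pi} (\<lambda>t. \<bar>Re (\<Phi> (Complex s t))\<bar> powr p) \<le> A"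
    and s: "-1 \<le> s1" "s1 < s2" "s2 \<le> s1 / 2" "s1 < 0"
  shows "integral {0..2 * pi} (\<lambda>t. \<bar>Re (\<Gamma> (Complex s2 t)) - Re (\<Gamma> (Complex s1 t))\<bar> powr p)
    \<le> (4 * K) powr p * (2 powr p * 4 powr (1 / p)) * 96 * A + 2 * pi * (4 * L) powr p"
proof -
  note op = left_half_plane_open
  \<comment> \<open>Discs of radius \<open>2 * \<rho>\<close>, half of |s2|, around points with real
    part at most \<open>s2\<close> stay in the half-plane, while \<open>s2 - s1\<close> is at most
    |s2|, that is \<open>4 * \<rho>\<close>.\<close>
  define \<rho> where "\<rho> = - s2 / 4"
  have \<rho>: "0 < \<rho>" "\<rho> \<le> 1 / 4" "s2 = - 4 * \<rho>" "s2 - s1 \<le> 4 * \<rho>" using s by (auto simp: \<rho>_def)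
  define c where "c = 2 powr p * 4 powr (1 / p)"
  define D where "D t = \<bar>Re (\<Gamma> (Complex s2 t)) - Re (\<Gamma> (Complex s1 t))\<bar>" for t
  let ?J = "indicator {0..2 * pi} :: real \<Rightarrow> ennreal"
  have slice: "continuous_on UNIV (\<lambda>t. f (Complex s t))"
    if "f holomorphic_on {w. Re w < 0}" "s < 0" for f :: "complex \<Rightarrow> complex" and s
    unfolding Complex_eq
    by (intro continuous_on_compose2[OF holomorphic_on_imp_continuous_on[OF that(1)]] continuous_intros)
       (use that in auto)
  have cU: "continuous_on S (\<lambda>t. \<bar>Re (\<Phi> (Complex s t))\<bar> powr p)" if "s < 0" for s S
    using continuous_on_norm_powr[OF continuous_on_Re[OF slice[OF hol(1) that]] p(1)]
    by (auto intro: continuous_on_subset)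
  have "s2 < 0" using \<rho> by simp
  have "continuous_on UNIV (\<lambda>t. Re (\<Gamma> (Complex s2 t)) - Re (\<Gamma> (Complex s1 t)))"
    by (intro continuous_intros slice[OF hol(2)] \<open>s2 < 0\<close> s)
  from continuous_on_norm_powr[OF this p(1)]
  have cD: "continuous_on S (\<lambda>t. D t powr p)" for S
    by (auto simp: D_def intro: continuous_on_subset)
  have "0 \<le> integral {0..2 * pi} (\<lambda>t. \<bar>Re (\<Phi> (Complex (- 1) t))\<bar> powr p)"
    by (intro integral_nonneg integrable_continuous_real cU) auto
  then have A0: "0 \<le> A" using A[of "-1"] by simp
  define g :: "complex \<Rightarrow> ennreal" where "g w = indicator {w. Re w < 0} w * ennreal (\<bar>Re (\<Phi> w)\<bar> powr p)" for w
  have g_meas [measurable]: "g \<in> borel_measurable borel"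
    unfolding g_def
    using continuous_on_norm_powr[OF continuous_on_Re[OF holomorphic_on_imp_continuous_on[OF hol(1)]] p(1)] op
    by (intro borel_measurable_indicator_times_ennreal) auto
  \<comment> \<open>The intermediate point of the mean value theorem depends on \<open>t\<close> in
    an uncontrolled way. Replacing the disc around it by a rectangle that contains all candidate
    discs gives a bound that is independent of this point and measurable in
    \<open>t\<close>.\<close>
  define X where "X t = area_integral (\<lambda>w. indicator {s1 - 2 * \<rho>..s2 + 2 * \<rho>} (Re w)
    * (indicator {t - 2 * \<rho>..t + 2 * \<rho>} (Im w) * g w))" for t
  have X: "ennreal (\<rho>\<^sup>2 * (\<rho> * cmod (deriv \<Phi> (Complex \<sigma> t))) powr p) \<le> ennreal c * X t"
    if \<sigma>: "s1 \<le> \<sigma>" "\<sigma> \<le> s2" for \<sigma> t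
  proof -
    have mem: "\<bar>Re w - \<sigma>\<bar> \<le> 2 * \<rho> \<and> \<bar>Im w - t\<bar> \<le> 2 * \<rho>" if "w \<in> cball (Complex \<sigma> t) (2 * \<rho>)" for w
      using that abs_Re_le_cmod[of "w - Complex \<sigma> t"] abs_Im_le_cmod[of "w - Complex \<sigma> t"]
      by (simp add: dist_norm norm_minus_commute)
    have neg: "Re w < 0" if "w \<in> cball (Complex \<sigma> t) (2 * \<rho>)" for w
      using mem[OF that] \<sigma> \<rho> by linarith
    have "ennreal (\<rho>\<^sup>2 * (\<rho> * cmod (deriv \<Phi> (Complex \<sigma> t))) powr p) \<le> ennreal c
      * area_integral (\<lambda>w. indicator (cball (Complex \<sigma> t) (2 * \<rho>)) w * ennreal (\<bar>Re (\<Phi> w)\<bar> powr p))"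
      unfolding c_def using neg by (intro deriv_powr_local_bound[OF hol(1) op] \<rho> p) auto
    also have "\<dots> \<le> ennreal c * X t"
      unfolding X_def
    proof (intro mult_left_mono area_integral_mono)
      fix w
      show "indicator (cball (Complex \<sigma> t) (2 * \<rho>)) w * ennreal (\<bar>Re (\<Phi> w)\<bar> powr p)
          \<le> indicator {s1 - 2 * \<rho>..s2 + 2 * \<rho>} (Re w)
            * (indicator {t - 2 * \<rho>..t + 2 * \<rho>} (Im w) * g w)"
      proof (cases "w \<in> cball (Complex \<sigma> t) (2 * \<rho>)")
        case True
        have "Re w \<in> {s1 - 2 * \<rho>..s2 + 2 * \<rho>}" "Im w \<in> {t - 2 * \<rho>..t + 2 * \<rho>}" "w \<in> {w. Re w < 0}"
          using mem[OF True] neg[OF True] \<sigma> by auto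
        then show ?thesis using True by (simp add: g_def)
      qed simp
    qed simp
    finally show ?thesis .
  qed
  have D: "ennreal (\<rho>\<^sup>2 * D t powr p) \<le> ennreal ((4 * K) powr p) * (ennreal c * X t) + ennreal (\<rho>\<^sup>2 * (4 * L) powr p)"
    for t
  proof -
    have "\<exists>\<sigma>>s1. \<sigma> < s2 \<and> Re (\<Gamma> (Complex s2 t)) - Re (\<Gamma> (Complex s1 t))
        = (s2 - s1) * Re (deriv \<Gamma> (Complex \<sigma> t))"
      using s by (intro MVT2 real_derivative_Re_slices(1)[OF hol(2) op]) auto
    then obtain \<sigma> where \<sigma>: "s1 < \<sigma>" "\<sigma> < s2"
      "Re (\<Gamma> (Complex s2 t)) - Re (\<Gamma> (Complex s1 t)) = (s2 - s1) * Re (deriv \<Gamma> (Complex \<sigma> t))" by blast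
    let ?d = "cmod (deriv \<Phi> (Complex \<sigma> t))"
    have "D t = (s2 - s1) * \<bar>Re (deriv \<Gamma> (Complex \<sigma> t))\<bar>"
      unfolding D_def \<sigma>(3) using s by (simp add: abs_mult)
    also have "\<dots> \<le> 4 * \<rho> * (K * ?d + L)"
      using \<rho> s \<sigma> le[of "Complex \<sigma> t"] abs_Re_le_cmod[of "deriv \<Gamma> (Complex \<sigma> t)"]
      by (intro mult_mono) auto
    also have "\<dots> = 4 * K * (\<rho> * ?d) + \<rho> * (4 * L)" by (simp add: algebra_simps)
    also have "\<dots> \<le> 4 * K * (\<rho> * ?d) + 4 * L"
      using mult_right_mono[of \<rho> 1 "4 * L"] \<rho> KL by simp
    finally have "D t powr p \<le> (4 * K * (\<rho> * ?d) + 4 * L) powr p"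
      using p by (intro powr_mono2) (auto simp: D_def)
    also have "\<dots> \<le> (4 * K * (\<rho> * ?d)) powr p + (4 * L) powr p"
      using KL \<rho> p by (intro add_powr_le) auto
    also have "(4 * K * (\<rho> * ?d)) powr p = (4 * K) powr p * (\<rho> * ?d) powr p"
      by (rule powr_mult)
    finally have "\<rho>\<^sup>2 * D t powr p \<le> \<rho>\<^sup>2 * ((4 * K) powr p * (\<rho> * ?d) powr p + (4 * L) powr p)"
      by (rule mult_left_mono) simp
    then have "ennreal (\<rho>\<^sup>2 * D t powr p)
        \<le> ennreal ((4 * K) powr p * (\<rho>\<^sup>2 * (\<rho> * ?d) powr p) + \<rho>\<^sup>2 * (4 * L) powr p)"
      by (intro ennreal_leI) (simp add: algebra_simps)
    also have "\<dots> = ennreal ((4 * K) powr p) * ennreal (\<rho>\<^sup>2 * (\<rho> * ?d) powr p) + ennreal (\<rho>\<^sup>2 * (4 * L) powr p)"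
      by (simp add: ennreal_mult)
    also have "\<dots> \<le> ennreal ((4 * K) powr p) * (ennreal c * X t) + ennreal (\<rho>\<^sup>2 * (4 * L) powr p)"
      using \<sigma> by (intro add_right_mono mult_left_mono X) auto
    finally show ?thesis .
  qed
  have [measurable]: "X \<in> borel_measurable borel"
  proof -
    have W: "indicator {t - 2 * \<rho>..t + 2 * \<rho>} y = (if \<bar>y - t\<bar> \<le> 2 * \<rho> then 1 else 0 :: ennreal)" for t y
      by (auto simp: indicator_def)
    show ?thesis unfolding X_def area_integral_def W by simp
  qed
  have intX: "(\<integral>\<^sup>+t. ?J t * X t \<partial>lborel) \<le> ennreal (96 * \<rho>\<^sup>2 * A)"
  proof -
    have "(\<integral>\<^sup>+t. ?J t * X t \<partial>lborel) \<le> ennreal (12 * \<rho> * A * ((s2 + 2 * \<rho>) - (s1 - 2 * \<rho>)))"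
      unfolding X_def
    proof (rule nn_integral_sliding_window[OF g_meas])
      show "2 * \<rho> \<le> 2 * pi" using \<rho> pi_gt3 by linarith
      show "g (w + 2 * pi * \<i>) = g w" for w
        using per[of w] by (simp add: g_def indicator_def)
      show "(\<integral>\<^sup>+y. ?J y * g (Complex x y) \<partial>lborel) \<le> ennreal A" if "x \<in> {s1 - 2 * \<rho>..s2 + 2 * \<rho>}" for x
      proof -
        have "x < 0" using that \<rho> by auto
        have "(\<integral>\<^sup>+y. ?J y * g (Complex x y) \<partial>lborel)
            = (\<integral>\<^sup>+y. ?J y * ennreal (\<bar>Re (\<Phi> (Complex x y))\<bar> powr p) \<partial>lborel)"
          using \<open>x < 0\<close> by (simp add: g_def)
        also have "\<dots> = ennreal (integral {0..2 * pi} (\<lambda>t. \<bar>Re (\<Phi> (Complex x t))\<bar> powr p))"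
          by (rule nn_integral_eq_integral_interval[OF cU[OF \<open>x < 0\<close>]]) simp
        also have "\<dots> \<le> ennreal A" by (intro ennreal_leI A \<open>x < 0\<close>)
        finally show ?thesis .
      qed
    qed (use \<rho> s A0 in auto)
    \<comment> \<open>The rectangle has width \<open>s2 - s1 + 4 * \<rho>\<close>, at most
      \<open>8 * \<rho>\<close>; thus 96 = 12 * 8.\<close>
    also have "\<dots> \<le> ennreal (12 * \<rho> * A * (8 * \<rho>))"
      using \<rho> A0 by (intro ennreal_leI mult_left_mono) auto
    finally show ?thesis by (simp add: power2_eq_square mult_ac)
  qed
  define C where "C = (4 * K) powr p * c * 96 * A + 2 * pi * (4 * L) powr p"
  have "ennreal (\<rho>\<^sup>2 * integral {0..2 * pi} (\<lambda>t. D t powr p)) = ennreal (integral {0..2 * pi} (\<lambda>t. \<rho>\<^sup>2 * D t powr p))"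
    by simp
  also have "\<dots> = (\<integral>\<^sup>+t. ?J t * ennreal (\<rho>\<^sup>2 * D t powr p) \<partial>lborel)"
    by (rule nn_integral_eq_integral_interval[symmetric]) (auto intro!: continuous_intros cD)
  also have "\<dots> \<le> (\<integral>\<^sup>+t. ennreal ((4 * K) powr p) * (ennreal c * (?J t * X t)) + ?J t * ennreal (\<rho>\<^sup>2 * (4 * L) powr p) \<partial>lborel)"
    using mult_left_mono[OF D, of "?J _"] by (intro nn_integral_mono) (simp add: distrib_left mult_ac)
  also have "\<dots> = ennreal ((4 * K) powr p) * (ennreal c * (\<integral>\<^sup>+t. ?J t * X t \<partial>lborel)) + ennreal (2 * pi) * ennreal (\<rho>\<^sup>2 * (4 * L) powr p)"
    by (subst nn_integral_add) (auto simp: nn_integral_cmult nn_integral_multc)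
  also have "\<dots> \<le> ennreal ((4 * K) powr p) * (ennreal c * ennreal (96 * \<rho>\<^sup>2 * A)) + ennreal (2 * pi) * ennreal (\<rho>\<^sup>2 * (4 * L) powr p)"
    by (intro add_right_mono mult_left_mono intX) auto
  also have "\<dots> = ennreal (\<rho>\<^sup>2 * C)"
    using A0 by (simp add: C_def c_def ennreal_mult[symmetric] ennreal_plus[symmetric] algebra_simps del: ennreal_plus)
  finally have "\<rho>\<^sup>2 * integral {0..2 * pi} (\<lambda>t. D t powr p) \<le> \<rho>\<^sup>2 * C"
    using A0 by (subst (asm) ennreal_le_iff) (auto simp: C_def c_def)
  then show ?thesis using \<rho> by (simp add: D_def C_def c_def)
qed

text \<open>For p < 1 the p-th power is subadditive, so each halving of |s| adds at most the fixed
  amount \<open>C\<close> to the mean; the number of halvings starting from s = -1 is about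
  log2(1/|s|).\<close>

lemma integral_powr_growth:
  fixes \<Phi> \<Gamma> :: "complex \<Rightarrow> complex"
  assumes hol: "\<Phi> holomorphic_on {w. Re w < 0}" "\<Gamma> holomorphic_on {w. Re w < 0}"
    and per: "\<And>w. \<Phi> (w + 2 * pi * \<i>) = \<Phi> w"
    and le: "\<And>w. Re w < 0 \<Longrightarrow> cmod (deriv \<Gamma> w) \<le> K * cmod (deriv \<Phi> w) + L"
    and KL: "0 \<le> K" "0 \<le> L" and p: "0 < p" "p < 1"
    and A: "\<And>s. s < 0 \<Longrightarrow> integral {0..2 * pi} (\<lambda>t. \<bar>Re (\<Phi> (Complex s t))\<bar> powr p) \<le> A"
  obtains a b where "0 \<le> a" "0 \<le> b"
    "\<And>s. -1 \<le> s \<Longrightarrow> s < 0 \<Longrightarrow>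
      integral {0..2 * pi} (\<lambda>t. \<bar>Re (\<Gamma> (Complex s t))\<bar> powr p) \<le> a + b * ln (1 / \<bar>s\<bar>)"
proof -
  define J where "J s = integral {0..2 * pi} (\<lambda>t. \<bar>Re (\<Gamma> (Complex s t))\<bar> powr p)" for s
  define C where "C = max 0 ((4 * K) powr p * (2 powr p * 4 powr (1 / p)) * 96 * A + 2 * pi * (4 * L) powr p)"
  have slice: "continuous_on UNIV (\<lambda>t. \<Gamma> (Complex s t))" if "s < 0" for s
    unfolding Complex_eq
    by (intro continuous_on_compose2[OF holomorphic_on_imp_continuous_on[OF hol(2)]] continuous_intros)
       (use that in auto)
  have int: "(\<lambda>t. \<bar>Re (\<Gamma> (Complex s t))\<bar> powr p) integrable_on {0..2 * pi}" if "s < 0" for s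
    using continuous_on_norm_powr[OF continuous_on_Re[OF slice[OF that]] p(1)]
    by (auto intro: integrable_continuous_real continuous_on_subset)
  have J0: "0 \<le> J s" if "s < 0" for s
    unfolding J_def by (intro integral_nonneg int that) simp
  have step: "J s2 \<le> J s1 + C" if s: "-1 \<le> s1" "s1 \<le> s2" "s2 \<le> s1 / 2" "s1 < 0" for s1 s2
  proof (cases "s1 = s2")
    case False
    have "s2 < 0" using s by linarith
    let ?D = "\<lambda>t. \<bar>Re (\<Gamma> (Complex s2 t)) - Re (\<Gamma> (Complex s1 t))\<bar> powr p"
    have "continuous_on UNIV (\<lambda>t. Re (\<Gamma> (Complex s2 t)) - Re (\<Gamma> (Complex s1 t)))"
      by (intro continuous_intros slice \<open>s2 < 0\<close> s)
    from continuous_on_norm_powr[OF this p(1)]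
    have iD: "?D integrable_on {0..2 * pi}"
      by (auto intro: integrable_continuous_real continuous_on_subset)
    have "J s2 \<le> integral {0..2 * pi} (\<lambda>t. \<bar>Re (\<Gamma> (Complex s1 t))\<bar> powr p + ?D t)"
      unfolding J_def
    proof (intro integral_le int integrable_add iD \<open>s2 < 0\<close> s)
      fix t
      have "\<bar>Re (\<Gamma> (Complex s2 t))\<bar> powr p
          \<le> (\<bar>Re (\<Gamma> (Complex s1 t))\<bar> + \<bar>Re (\<Gamma> (Complex s2 t)) - Re (\<Gamma> (Complex s1 t))\<bar>) powr p"
        using p by (intro powr_mono2) auto
      also have "\<dots> \<le> \<bar>Re (\<Gamma> (Complex s1 t))\<bar> powr p + ?D t"
        using p by (intro add_powr_le) auto
      finally show "\<bar>Re (\<Gamma> (Complex s2 t))\<bar> powr p \<le> \<bar>Re (\<Gamma> (Complex s1 t))\<bar> powr p + ?D t" .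
    qed
    also have "\<dots> = J s1 + integral {0..2 * pi} ?D"
      unfolding J_def by (intro integral_add int iD s)
    also have "integral {0..2 * pi} ?D \<le> C"
      using integral_powr_increment_le[OF hol per le KL p A s(1) _ s(3,4)] False s(2)
      by (simp add: C_def)
    finally show ?thesis by simp
  qed (simp add: C_def)
  \<comment> \<open>For s > -1/2 the step from \<open>2 * s\<close> lowers \<open>k\<close> by one;
    for s <= -1/2 a single step from -1 is enough.\<close>
  have dyadic: "J s \<le> J (-1) + (real k + 1) * C" if "-1 \<le> s" "s < 0" "(1 / 2) ^ k \<le> \<bar>s\<bar>" for k s
    using that
  proof (induction k arbitrary: s)
    case 0
    then have "s = -1" by simp
    then show ?case by (simp add: C_def)
  next
    case (Suc k)
    show ?case
    proof (cases "s \<le> - 1 / 2")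
      case True
      have "J s \<le> J (-1) + C" using Suc.prems True by (intro step) auto
      moreover have "0 \<le> (1 + real k) * C" by (simp add: C_def)
      ultimately show ?thesis by (simp add: algebra_simps)
    next
      case False
      have "J s \<le> J (2 * s) + C" using Suc.prems False by (intro step) auto
      also have "J (2 * s) \<le> J (-1) + (real k + 1) * C"
        using Suc.prems False by (intro Suc.IH) auto
      finally show ?thesis by (simp add: algebra_simps)
    qed
  qed
  show ?thesis
  proof
    show "0 \<le> J (-1) + 2 * C" using J0[of "-1"] by (simp add: C_def)
    show "0 \<le> C / ln 2" by (simp add: C_def)
    fix s :: real assume s: "-1 \<le> s" "s < 0"
    define k where "k = nat \<lceil>log 2 (1 / \<bar>s\<bar>)\<rceil>"
    have "1 / 1 \<le> 1 / \<bar>s\<bar>" using s by (intro divide_left_mono) auto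
    then have l0: "0 \<le> log 2 (1 / \<bar>s\<bar>)" using s by (subst zero_le_log_cancel_iff) auto
    then have k: "log 2 (1 / \<bar>s\<bar>) \<le> real k" "real k \<le> log 2 (1 / \<bar>s\<bar>) + 1"
      unfolding k_def by linarith+
    have "1 / \<bar>s\<bar> \<le> 2 ^ k"
      using k(1) s by (simp add: log_le_iff powr_realpow)
    then have "(1 / 2) ^ k \<le> \<bar>s\<bar>" using s by (simp add: power_one_over field_simps)
    then have "J s \<le> J (-1) + (real k + 1) * C" by (rule dyadic[OF s])
    also have "\<dots> \<le> J (-1) + (log 2 (1 / \<bar>s\<bar>) + 2) * C"
      using k(2) by (intro add_left_mono mult_right_mono) (auto simp: C_def)
    also have "\<dots> = (J (-1) + 2 * C) + C / ln 2 * ln (1 / \<bar>s\<bar>)"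
      by (simp add: log_def algebra_simps)
    finally show "integral {0..2 * pi} (\<lambda>t. \<bar>Re (\<Gamma> (Complex s t))\<bar> powr p)
        \<le> (J (-1) + 2 * C) + C / ln 2 * ln (1 / \<bar>s\<bar>)" by (simp add: J_def)
  qed
qed

theorem integral_mean_Im_bigo:
  assumes f: "harmonic_quasiregular K K' f" "0 \<le> K" "0 \<le> K'" and p: "0 < p" "p < 1"
    and u: "(\<lambda>z. Re (f z)) \<in> harmonic_hardy p"
  shows "(\<lambda>r. integral_mean p r (\<lambda>z. Im (f z))) \<in> O[at_left 1](\<lambda>r. ln (1 / (1 - r)) powr (1 / p))"
proof -
  obtain F G where FG: "F holomorphic_on unit_disc" "G holomorphic_on unit_disc"
    "\<And>z. z \<in> unit_disc \<Longrightarrow> Re (f z) = Re (F z)" "\<And>z. z \<in> unit_disc \<Longrightarrow> Im (f z) = Re (G z)"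
    "\<And>z. z \<in> unit_disc \<Longrightarrow> cmod (deriv G z) \<le> K * cmod (deriv F z) + sqrt K'"
    using harmonic_quasiregular_holomorphic_parts[OF f] by blast
  have K'0: "0 \<le> sqrt K'" using f(3) by simp
  obtain A where A: "\<And>r. r \<in> {0..<1} \<Longrightarrow>
      integral {0..2 * pi} (\<lambda>\<theta>. norm (Re (f (complex_of_real r * cis \<theta>))) powr p) \<le> A"
    using u unfolding harmonic_hardy_iff[OF p(1)] by blast
  have A': "integral {0..2 * pi} (\<lambda>t. \<bar>Re (F (exp (Complex s t)))\<bar> powr p) \<le> A" if "s < 0" for s
  proof -
    have "Re (F (exp (Complex s t))) = Re (f (complex_of_real (exp s) * cis t))" for t
      using that FG(3)[of "exp (Complex s t)"] by (simp add: exp_eq_polar norm_mult)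
    then show ?thesis using A[of "exp s"] that by simp
  qed
  obtain a b where ab: "0 \<le> a" "0 \<le> b" "\<And>s. -1 \<le> s \<Longrightarrow> s < 0 \<Longrightarrow>
      integral {0..2 * pi} (\<lambda>t. \<bar>Re (G (exp (Complex s t)))\<bar> powr p) \<le> a + b * ln (1 / \<bar>s\<bar>)"
    by (rule integral_powr_growth[OF holomorphic_disc_comp_exp(1)[OF FG(1)]
        holomorphic_disc_comp_exp(1)[OF FG(2)] holomorphic_disc_comp_exp(3)[OF FG(1)]
        deriv_comp_exp_le[OF FG(1,2,5) K'0] f(2) K'0 p A']) (assumption+, rule that)
  \<comment> \<open>Beyond \<open>r0\<close> two things hold: ln r >= -1, so the growth estimate
    applies, and ln(1/(1 - r)) >= 1, so the additive constant \<open>a\<close> is absorbed by the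
    logarithm. The inequality |ln r| >= 1 - r then converts the variable.\<close>
  define r0 :: real where "r0 = max (exp (-1)) (1 - exp (-1))"
  have "r0 < 1" by (simp add: r0_def)
  have main: "norm (integral_mean p r (\<lambda>z. Im (f z)))
      \<le> (a + b) powr (1 / p) * norm (ln (1 / (1 - r)) powr (1 / p))" if r: "r0 < r" "r < 1" for r
  proof -
    have r': "exp (-1) \<le> r" "1 - exp (-1) \<le> r" "0 < r"
      using r exp_gt_zero[of "-1::real"] by (auto simp: r0_def)
    have ln1: "1 \<le> ln (1 / (1 - r))"
    proof -
      have "1 - r \<le> exp (-1)" using r' by simp
      then have "exp 1 \<le> 1 / (1 - r)" using r by (simp add: exp_minus field_simps)
      then show ?thesis using r by (subst ln_ge_iff) auto
    qed
    have s: "-1 \<le> ln r" "ln r < 0" using r r' by (auto simp: ln_ge_iff)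
    have "1 / \<bar>ln r\<bar> \<le> 1 / (1 - r)"
      using r s ln_le_minus_one[OF r'(3)] by (intro frac_le) auto
    then have ln2: "ln (1 / \<bar>ln r\<bar>) \<le> ln (1 / (1 - r))"
      using s r by (subst ln_le_cancel_iff) auto
    let ?I = "integral {0..2 * pi} (\<lambda>\<theta>. norm (Im (f (complex_of_real r * cis \<theta>))) powr p)"
    have "?I = integral {0..2 * pi} (\<lambda>t. \<bar>Re (G (exp (Complex (ln r) t)))\<bar> powr p)"
      using FG(4) r r' by (simp add: exp_Complex_ln norm_mult)
    also have "\<dots> \<le> a + b * ln (1 / \<bar>ln r\<bar>)" by (rule ab(3)[OF s])
    also have "\<dots> \<le> a * ln (1 / (1 - r)) + b * ln (1 / (1 - r))"
      using ab(1,2) ln1 ln2 mult_left_mono[of 1 "ln (1 / (1 - r))" a] by (intro add_mono mult_left_mono) auto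
    finally have I: "?I \<le> (a + b) * ln (1 / (1 - r))" by (simp add: distrib_right)
    have I0: "0 \<le> ?I"
      by (cases "(\<lambda>\<theta>. norm (Im (f (complex_of_real r * cis \<theta>))) powr p) integrable_on {0..2 * pi}")
         (auto intro: integral_nonneg simp: not_integrable_integral)
    have "1 / (2 * pi) * ?I \<le> 1 * ?I"
      using I0 pi_gt3 by (intro mult_right_mono) (auto simp: field_simps)
    then have "integral_mean p r (\<lambda>z. Im (f z)) \<le> ((a + b) * ln (1 / (1 - r))) powr (1 / p)"
      unfolding integral_mean_def using I I0 p by (intro powr_mono2) auto
    also have "\<dots> = (a + b) powr (1 / p) * ln (1 / (1 - r)) powr (1 / p)"
      by (rule powr_mult)
    finally show ?thesis by (simp add: integral_mean_def)
  qed
  have "eventually (\<lambda>r. r \<in> {r0<..<1}) (at_left 1)"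
    by (rule eventually_at_left_real[OF \<open>r0 < 1\<close>])
  then have "eventually (\<lambda>r. norm (integral_mean p r (\<lambda>z. Im (f z)))
      \<le> (a + b) powr (1 / p) * norm (ln (1 / (1 - r)) powr (1 / p))) (at_left 1)"
    by (rule eventually_mono) (rule main, simp_all)
  then show ?thesis by (rule bigoI)
qed

section \<open>Sharpness\<close>

lemma lipschitz_imp_abs_continuous:
  fixes g :: "real \<Rightarrow> 'a::real_normed_vector"
  assumes "0 \<le> L" "\<And>x y. x \<in> {s..t} \<Longrightarrow> y \<in> {s..t} \<Longrightarrow> norm (g x - g y) \<le> L * \<bar>x - y\<bar>"
  shows "abs_continuous_on_interval s t g"
  unfolding abs_continuous_on_interval_def
proof (intro allI impI)
  fix \<epsilon> :: real assume "\<epsilon> > 0"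
  show "\<exists>\<delta>>0. \<forall>I. finite I \<and> (\<forall>(a, b)\<in>I. s \<le> a \<and> a \<le> b \<and> b \<le> t) \<and>
        pairwise (\<lambda>(a, b) (c, d). disjnt {a<..<b} {c<..<d}) I \<and> (\<Sum>(a, b)\<in>I. b - a) < \<delta>
        \<longrightarrow> (\<Sum>(a, b)\<in>I. norm (g b - g a)) < \<epsilon>"
  proof (intro exI[of _ "\<epsilon> / (L + 1)"] conjI allI impI)
    show "0 < \<epsilon> / (L + 1)" using \<open>\<epsilon> > 0\<close> assms(1) by simp
    fix I assume I: "finite I \<and> (\<forall>(a, b)\<in>I. s \<le> a \<and> a \<le> b \<and> b \<le> t) \<and>
        pairwise (\<lambda>(a, b) (c, d). disjnt {a<..<b} {c<..<d}) I \<and> (\<Sum>(a, b)\<in>I. b - a) < \<epsilon> / (L + 1)"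
    have "(\<Sum>(a, b)\<in>I. norm (g b - g a)) \<le> (\<Sum>(a, b)\<in>I. L * (b - a))"
    proof (rule sum_mono, clarify)
      fix a b assume "(a, b) \<in> I"
      then have "s \<le> a" "a \<le> b" "b \<le> t" using I by auto
      then show "norm (g b - g a) \<le> L * (b - a)" using assms(2)[of b a] by simp
    qed
    also have "\<dots> = L * (\<Sum>(a, b)\<in>I. b - a)" by (simp add: sum_distrib_left case_prod_unfold)
    also have "\<dots> \<le> L * (\<epsilon> / (L + 1))" using I assms(1) by (intro mult_left_mono) auto
    also have "\<dots> < \<epsilon>" using \<open>\<epsilon> > 0\<close> assms(1) by (simp add: field_simps)
    finally show "(\<Sum>(a, b)\<in>I. norm (g b - g a)) < \<epsilon>" .
  qed
qed

lemma continuous_imp_locally_L2: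
  assumes "continuous_on S g"
  shows "locally_L2_on g S"
  unfolding locally_L2_on_def
proof (intro allI impI)
  fix C assume C: "compact C \<and> C \<subseteq> S"
  then have c: "continuous_on C g" using assms continuous_on_subset by blast
  then have "(\<lambda>z. indicator C z *\<^sub>R g z) \<in> borel_measurable borel"
    using C by (intro borel_measurable_continuous_on_indicator) (auto intro: borel_compact)
  then have "set_borel_measurable lebesgue C g"
    unfolding set_borel_measurable_def by (intro measurable_completion) simp
  moreover have "integrable lborel (\<lambda>z. indicator C z *\<^sub>R (cmod (g z))\<^sup>2)"
    using C by (intro borel_integrable_compact continuous_intros c) auto
  then have "set_integrable lebesgue C (\<lambda>z. (cmod (g z))\<^sup>2)"
    unfolding set_integrable_def by (subst integrable_completion) auto
  ultimately show "set_borel_measurable lebesgue C g \<and> set_integrable lebesgue C (\<lambda>z. (cmod (g z))\<^sup>2)" ..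
qed

text \<open>On a compact rectangle the derivative is bounded, so the function is Lipschitz there,
  and this holds on every line, not just on almost every one.\<close>

lemma ACL_on_holomorphic:
  assumes "f holomorphic_on S" "open S"
  shows "ACL_on f S"
  unfolding ACL_on_def
proof (intro conjI allI impI)
  show "continuous_on S f" by (rule holomorphic_on_imp_continuous_on[OF assms(1)])
  fix a b assume ab: "cbox a b \<subseteq> S"
  have "continuous_on (cbox a b) (deriv f)"
    by (rule continuous_on_subset[OF holomorphic_on_imp_continuous_on[OF holomorphic_deriv[OF assms]] ab])
  then have "compact (deriv f ` cbox a b)" by (rule compact_continuous_image[OF _ compact_cbox])
  then have "bounded (deriv f ` cbox a b)" by (rule compact_imp_bounded)
  then obtain L where L: "0 < L" "\<forall>w\<in>deriv f ` cbox a b. cmod w \<le> L"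
    unfolding bounded_pos by (elim exE conjE) (rule that)
  have lip: "cmod (f w - f z) \<le> L * cmod (w - z)" if "w \<in> cbox a b" "z \<in> cbox a b" for w z
  proof (rule field_differentiable_bound[OF convex_box(1)])
    show "(f has_field_derivative deriv f v) (at v within cbox a b)" if "v \<in> cbox a b" for v
      using that ab by (intro holomorphic_derivI[OF assms]) blast
    show "cmod (deriv f v) \<le> L" if "v \<in> cbox a b" for v using L(2) that by simp
  qed (rule that)+
  have "abs_continuous_on_interval (Re a) (Re b) (\<lambda>x. f (Complex x y))" if "y \<in> {Im a..Im b}" for y
  proof (rule lipschitz_imp_abs_continuous[of L])
    fix x x' assume "x \<in> {Re a..Re b}" "x' \<in> {Re a..Re b}"
    then have "cmod (f (Complex x y) - f (Complex x' y)) \<le> L * cmod (Complex x y - Complex x' y)"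
      using that by (intro lip) (auto simp: in_cbox_complex_iff)
    moreover have "cmod (Complex x y - Complex x' y) = \<bar>x - x'\<bar>" by (simp add: cmod_def)
    ultimately show "cmod (f (Complex x y) - f (Complex x' y)) \<le> L * \<bar>x - x'\<bar>" by simp
  qed (use L in simp)
  then show "AE y in lebesgue. y \<in> {Im a..Im b} \<longrightarrow>
      abs_continuous_on_interval (Re a) (Re b) (\<lambda>x. f (Complex x y))" by simp
  have "abs_continuous_on_interval (Im a) (Im b) (\<lambda>y. f (Complex x y))" if "x \<in> {Re a..Re b}" for x
  proof (rule lipschitz_imp_abs_continuous[of L])
    fix y y' assume "y \<in> {Im a..Im b}" "y' \<in> {Im a..Im b}"
    then have "cmod (f (Complex x y) - f (Complex x y')) \<le> L * cmod (Complex x y - Complex x y')"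
      using that by (intro lip) (auto simp: in_cbox_complex_iff)
    moreover have "cmod (Complex x y - Complex x y') = \<bar>y - y'\<bar>" by (simp add: cmod_def)
    ultimately show "cmod (f (Complex x y) - f (Complex x y')) \<le> L * \<bar>y - y'\<bar>" by simp
  qed (use L in simp)
  then show "AE x in lebesgue. x \<in> {Re a..Re b} \<longrightarrow>
      abs_continuous_on_interval (Im a) (Im b) (\<lambda>y. f (Complex x y))" by simp
qed

text \<open>For holomorphic \<open>f\<close> the derivative with respect to the conjugate variable
  vanishes, so \<open>(Lambda f z)^2 = Jacobian f z\<close> and the inequality reduces to 1 <=
  K.\<close>

lemma harmonic_quasiregular_holomorphic:
  assumes f: "f holomorphic_on unit_disc" and K: "1 \<le> K" "0 \<le> K'"
  shows "harmonic_quasiregular K K' f"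
proof -
  note C1 = C1_on_holomorphic[OF f open_ball]
  have J: "Jacobian f z = (cmod (deriv f z))\<^sup>2" "Lambda f z = cmod (deriv f z)" if "z \<in> unit_disc" for z
    using C1(2,3)[OF that]
    by (simp_all add: Jacobian_def Lambda_def wirtinger_z_def wirtinger_zbar_def flip: mult.assoc)
  have "(Lambda f z)\<^sup>2 \<le> K * Jacobian f z + K'" if "z \<in> unit_disc" for z
    using mult_right_mono[OF K(1), of "(cmod (deriv f z))\<^sup>2"] K(2) by (simp add: J[OF that])
  then show ?thesis
    unfolding harmonic_quasiregular_def quasiregular_def ACL2_on_def
    using harmonic_on_holomorphic[OF f open_ball] ACL_on_holomorphic[OF f open_ball]
      continuous_imp_locally_L2[OF C1_onD(3)[OF C1(1)]] continuous_imp_locally_L2[OF C1_onD(4)[OF C1(1)]]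
    by (simp add: J)
qed

section \<open>Estimates for powers of the Cayley transform\<close>

lemma abs_Im_power_le: "\<bar>Im (\<zeta> ^ Suc m)\<bar> \<le> real (Suc m) * cmod \<zeta> ^ m * \<bar>Im \<zeta>\<bar>"
proof (induction m)
  case (Suc m)
  have "\<bar>Im (\<zeta> ^ Suc (Suc m))\<bar> = \<bar>Re \<zeta> * Im (\<zeta> ^ Suc m) + Im \<zeta> * Re (\<zeta> ^ Suc m)\<bar>" by simp
  also have "\<dots> \<le> \<bar>Re \<zeta>\<bar> * \<bar>Im (\<zeta> ^ Suc m)\<bar> + \<bar>Im \<zeta>\<bar> * \<bar>Re (\<zeta> ^ Suc m)\<bar>"
    by (metis abs_mult abs_triangle_ineq)
  also have "\<dots> \<le> cmod \<zeta> * (real (Suc m) * cmod \<zeta> ^ m * \<bar>Im \<zeta>\<bar>) + \<bar>Im \<zeta>\<bar> * cmod \<zeta> ^ Suc m"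
    using abs_Re_le_cmod[of "\<zeta> ^ Suc m"] abs_Re_le_cmod[of \<zeta>]
    by (intro add_mono mult_mono Suc.IH) (auto simp: norm_power norm_mult)
  also have "\<dots> = real (Suc (Suc m)) * cmod \<zeta> ^ Suc m * \<bar>Im \<zeta>\<bar>" by (simp add: algebra_simps)
  finally show ?case .
qed simp

text \<open>The conformal map of the disc onto the right half-plane, sending 0 to 1 and the unit
  circle minus the point 1 to the imaginary axis.\<close>

definition cayley :: "complex \<Rightarrow> complex" where
  "cayley z = (1 + z) / (1 - z)"

text \<open>The rotation by a power of i is chosen so that the real part vanishes together with
  \<open>Re w\<close>. Writing the product as \<open>- \<i> * (\<i> * w) ^ Suc m\<close> reduces the
  estimate to the imaginary part of a power.\<close>

lemma abs_Re_rotated_power_le: "\<bar>Re (\<i> ^ m * w ^ Suc m)\<bar> \<le> real (Suc m) * cmod w ^ m * \<bar>Re w\<bar>"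
proof -
  have "\<i> ^ m * w ^ Suc m = - \<i> * (\<i> * w) ^ Suc m" by (simp add: power_mult_distrib mult_ac)
  then have "Re (\<i> ^ m * w ^ Suc m) = Im ((\<i> * w) ^ Suc m)" by simp
  then show ?thesis using abs_Im_power_le[of "\<i> * w" m] by (simp add: norm_mult)
qed

text \<open>The real part is the Poisson kernel (1 - |z|^2)/|1 - z|^2.\<close>

lemma cayley_bounds:
  assumes "cmod z < 1"
  shows "cmod (cayley z) \<le> 2 / cmod (1 - z)"
    and "0 \<le> Re (cayley z)" "Re (cayley z) \<le> 2 * (1 - cmod z) / (cmod (1 - z))\<^sup>2"
proof -
  have "cmod (1 + z) \<le> 2" using norm_triangle_ineq[of 1 z] assms by simp
  then show "cmod (cayley z) \<le> 2 / cmod (1 - z)"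
    unfolding cayley_def norm_divide by (intro divide_right_mono) auto
  have re: "Re (cayley z) = (1 - (cmod z)\<^sup>2) / (cmod (1 - z))\<^sup>2"
    unfolding cayley_def Re_divide' cmod_power2 by (simp add: algebra_simps power2_eq_square)
  have "(cmod z)\<^sup>2 \<le> 1" using assms by (simp add: power_le_one)
  then show "0 \<le> Re (cayley z)" by (simp add: re)
  have "1 - (cmod z)\<^sup>2 = (1 - cmod z) * (1 + cmod z)" by (simp add: power2_eq_square algebra_simps)
  also have "\<dots> \<le> (1 - cmod z) * 2" using assms by (intro mult_left_mono) auto
  finally have "1 - (cmod z)\<^sup>2 \<le> 2 * (1 - cmod z)" by simp
  then show "Re (cayley z) \<le> 2 * (1 - cmod z) / (cmod (1 - z))\<^sup>2"
    unfolding re by (intro divide_right_mono) auto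
qed

text \<open>For large angles the real part of 1 - r e^(i theta) is at least 1/2; for small radii 1 -
  r is; otherwise the imaginary part is at least theta/4 in modulus. The constant 10 covers all
  three cases.\<close>

lemma le_dist_one_circle:
  assumes r: "0 \<le> r" "r < 1" and \<theta>: "0 \<le> \<theta>" "\<theta> \<le> pi"
  shows "1 - r + \<theta> \<le> 10 * cmod (1 - complex_of_real r * cis \<theta>)"
proof -
  let ?d = "cmod (1 - complex_of_real r * cis \<theta>)"
  have d1: "1 - r \<le> ?d"
    using norm_triangle_ineq2[of 1 "complex_of_real r * cis \<theta>"] r by (simp add: norm_mult)
  have re: "1 - r * cos \<theta> \<le> ?d"
    using complex_Re_le_cmod[of "1 - complex_of_real r * cis \<theta>"] by simp
  have im: "r * sin \<theta> \<le> ?d"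
    using abs_Im_le_cmod[of "1 - complex_of_real r * cis \<theta>"] by simp
  have pi4: "pi < 4" by (rule pi_less_4)
  consider "pi / 3 \<le> \<theta>" | "r \<le> 1 / 2" | "\<theta> < pi / 3" "1 / 2 < r" by linarith
  then show ?thesis
  proof cases
    case 1
    have "cos \<theta> \<le> cos (pi / 3)" using 1 \<theta> by (intro cos_monotone_0_pi_le) auto
    then have "r * cos \<theta> \<le> r * (1 / 2)" using r by (intro mult_left_mono) (auto simp: cos_60)
    then show ?thesis using re r \<theta> pi4 by linarith
  next
    case 2
    then show ?thesis using d1 r \<theta> pi4 by linarith
  next
    case 3
    have "\<theta> / 2 \<le> sin \<theta>"
    proof (cases "\<theta> = 0")
      case False
      then obtain \<xi> where \<xi>: "0 < \<xi>" "\<xi> < \<theta>" "sin \<theta> - sin 0 = (\<theta> - 0) * cos \<xi>"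
        using MVT2[of 0 \<theta> sin cos] \<theta> by (auto intro: DERIV_sin)
      have "cos (pi / 3) \<le> cos \<xi>" using \<xi> 3 \<theta> by (intro cos_monotone_0_pi_le) auto
      then have "\<theta> * (1 / 2) \<le> \<theta> * cos \<xi>" using \<theta> by (intro mult_left_mono) (auto simp: cos_60)
      then show ?thesis using \<xi> by simp
    qed simp
    then have "1 / 2 * (\<theta> / 2) \<le> r * sin \<theta>" using 3 \<theta> by (intro mult_mono) auto
    then show ?thesis using d1 im r by linarith
  qed
qed

text \<open>A negative exponent reverses the preceding lower bound. The lower half of the circle is
  reduced to the upper one by conjugation, and the sum of both terms serves all angles at
  once.\<close>

lemma dist_one_circle_powr_le:
  assumes r: "0 \<le> r" "r < 1" and \<theta>: "0 \<le> \<theta>" "\<theta> \<le> 2 * pi" and \<beta>: "\<beta> \<le> 0"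
  shows "cmod (1 - complex_of_real r * cis \<theta>) powr \<beta>
    \<le> 10 powr (- \<beta>) * ((1 - r + \<theta>) powr \<beta> + (1 - r + (2 * pi - \<theta>)) powr \<beta>)"
proof -
  have *: "x powr \<beta> \<le> 10 powr (- \<beta>) * y powr \<beta>" if "0 < y" "y \<le> 10 * x" for x y :: real
  proof -
    have "x powr \<beta> \<le> (y / 10) powr \<beta>" using that \<beta> by (intro powr_mono2') auto
    then show ?thesis using that by (simp add: powr_divide powr_minus field_simps)
  qed
  show ?thesis
  proof (cases "\<theta> \<le> pi")
    case True
    have "cmod (1 - complex_of_real r * cis \<theta>) powr \<beta> \<le> 10 powr (- \<beta>) * (1 - r + \<theta>) powr \<beta>"
      using r \<theta> True by (intro * le_dist_one_circle) auto
    also have "\<dots> \<le> 10 powr (- \<beta>) * ((1 - r + \<theta>) powr \<beta> + (1 - r + (2 * pi - \<theta>)) powr \<beta>)"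
      by (intro mult_left_mono) auto
    finally show ?thesis .
  next
    case False
    have "cis \<theta> = cnj (cis (2 * pi - \<theta>))" by (simp add: complex_eq_iff)
    then have "1 - complex_of_real r * cis \<theta> = cnj (1 - complex_of_real r * cis (2 * pi - \<theta>))" by simp
    then have eq: "cmod (1 - complex_of_real r * cis \<theta>) = cmod (1 - complex_of_real r * cis (2 * pi - \<theta>))"
      by (simp only: complex_mod_cnj)
    have "cmod (1 - complex_of_real r * cis \<theta>) powr \<beta> \<le> 10 powr (- \<beta>) * (1 - r + (2 * pi - \<theta>)) powr \<beta>"
      unfolding eq using r \<theta> False by (intro * le_dist_one_circle) auto
    also have "\<dots> \<le> 10 powr (- \<beta>) * ((1 - r + \<theta>) powr \<beta> + (1 - r + (2 * pi - \<theta>)) powr \<beta>)"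
      by (intro mult_left_mono) auto
    finally show ?thesis .
  qed
qed

lemma integral_shifted_powr_le:
  fixes \<delta> \<alpha> :: real
  assumes "0 < \<delta>" "0 < \<alpha>"
  shows "(\<lambda>\<theta>. (\<delta> + \<theta>) powr (- 1 - \<alpha>)) integrable_on {0..2 * pi}"
    and "integral {0..2 * pi} (\<lambda>\<theta>. (\<delta> + \<theta>) powr (- 1 - \<alpha>)) \<le> \<delta> powr (- \<alpha>) / \<alpha>"
    and "(\<lambda>\<theta>. (\<delta> + (2 * pi - \<theta>)) powr (- 1 - \<alpha>)) integrable_on {0..2 * pi}"
    and "integral {0..2 * pi} (\<lambda>\<theta>. (\<delta> + (2 * pi - \<theta>)) powr (- 1 - \<alpha>)) \<le> \<delta> powr (- \<alpha>) / \<alpha>"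
proof -
  define P where "P x = - (x powr (- \<alpha>)) / \<alpha>" for x :: real
  have P: "(P has_real_derivative x powr (- 1 - \<alpha>)) (at x)" if "0 < x" for x
    unfolding P_def
    using DERIV_cdivide[OF DERIV_minus[OF has_real_derivative_powr[OF that, of "- \<alpha>"]], of \<alpha>] assms(2)
    by (simp add: minus_diff_commute)
  have d1: "((\<lambda>\<theta>. P (\<delta> + \<theta>)) has_real_derivative (\<delta> + \<theta>) powr (- 1 - \<alpha>)) (at \<theta>)" if "0 \<le> \<theta>" for \<theta>
  proof -
    have "((\<lambda>\<theta>. \<delta> + \<theta>) has_real_derivative 1) (at \<theta>)"
      by (rule derivative_eq_intros refl)+ simp
    from DERIV_chain2[OF P this] show ?thesis using that assms by simp
  qed
  have d2: "((\<lambda>\<theta>. - P (\<delta> + (2 * pi - \<theta>))) has_real_derivative (\<delta> + (2 * pi - \<theta>)) powr (- 1 - \<alpha>)) (at \<theta>)"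
    if "\<theta> \<le> 2 * pi" for \<theta>
  proof -
    have "((\<lambda>\<theta>. \<delta> + (2 * pi - \<theta>)) has_real_derivative - 1) (at \<theta>)"
      by (rule derivative_eq_intros refl)+ simp
    from DERIV_minus[OF DERIV_chain2[OF P this]] show ?thesis using that assms by simp
  qed
  have i1: "((\<lambda>\<theta>. (\<delta> + \<theta>) powr (- 1 - \<alpha>)) has_integral P (\<delta> + 2 * pi) - P (\<delta> + 0)) {0..2 * pi}"
    using d1 by (intro fundamental_theorem_of_calculus)
      (auto simp: has_real_derivative_iff_has_vector_derivative intro: has_vector_derivative_at_within)
  have i2: "((\<lambda>\<theta>. (\<delta> + (2 * pi - \<theta>)) powr (- 1 - \<alpha>)) has_integral
      - P (\<delta> + (2 * pi - 2 * pi)) - - P (\<delta> + (2 * pi - 0))) {0..2 * pi}"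
    using d2 by (intro fundamental_theorem_of_calculus)
      (auto simp: has_real_derivative_iff_has_vector_derivative intro: has_vector_derivative_at_within)
  have "0 \<le> (\<delta> + 2 * pi) powr (- \<alpha>) / \<alpha>" using assms by simp
  then have le: "P (\<delta> + 2 * pi) - P \<delta> \<le> \<delta> powr (- \<alpha>) / \<alpha>" by (simp add: P_def)
  show "(\<lambda>\<theta>. (\<delta> + \<theta>) powr (- 1 - \<alpha>)) integrable_on {0..2 * pi}"
    "(\<lambda>\<theta>. (\<delta> + (2 * pi - \<theta>)) powr (- 1 - \<alpha>)) integrable_on {0..2 * pi}"
    using i1 i2 by blast+
  show "integral {0..2 * pi} (\<lambda>\<theta>. (\<delta> + \<theta>) powr (- 1 - \<alpha>)) \<le> \<delta> powr (- \<alpha>) / \<alpha>"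
    "integral {0..2 * pi} (\<lambda>\<theta>. (\<delta> + (2 * pi - \<theta>)) powr (- 1 - \<alpha>)) \<le> \<delta> powr (- \<alpha>) / \<alpha>"
    using integral_unique[OF i1] integral_unique[OF i2] le by simp_all
qed

text \<open>On the arc from 0 to pi/2 the numerator has modulus at least 1 and the denominator at
  most 1 - r + theta, so the integrand dominates 1/(1 - r + theta), whose integral produces the
  logarithm.\<close>

lemma integral_cayley_ge:
  assumes r: "0 \<le> r" "r < 1"
  shows "ln (1 / (1 - r)) \<le> integral {0..2 * pi} (\<lambda>\<theta>. cmod (cayley (complex_of_real r * cis \<theta>)))"
proof -
  let ?w = "\<lambda>\<theta>. cmod (cayley (complex_of_real r * cis \<theta>))"
  have nz: "1 - complex_of_real r * cis \<theta> \<noteq> 0" for \<theta>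
  proof
    assume "1 - complex_of_real r * cis \<theta> = 0"
    then have "cmod (complex_of_real r * cis \<theta>) = 1" by simp
    then show False using r by (simp add: norm_mult)
  qed
  have c: "continuous_on S ?w" for S
    unfolding cayley_def using nz by (intro continuous_intros) auto
  have "((\<lambda>\<theta>. 1 / (1 - r + \<theta>)) has_integral ln (1 - r + pi / 2) - ln (1 - r + 0)) {0..pi / 2}"
    using r by (intro fundamental_theorem_of_calculus)
      (auto intro!: derivative_eq_intros simp: has_real_derivative_iff_has_vector_derivative[symmetric])
  then have i: "(\<lambda>\<theta>. 1 / (1 - r + \<theta>)) integrable_on {0..pi / 2}"
    "integral {0..pi / 2} (\<lambda>\<theta>. 1 / (1 - r + \<theta>)) = ln (1 - r + pi / 2) - ln (1 - r)"
    by (auto simp: integral_unique)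
  \<comment> \<open>Here \<open>ln (1 - r + pi / 2)\<close> is dropped; it is nonnegative because
    pi/2 > 1.\<close>
  have "ln (1 / (1 - r)) \<le> ln (1 - r + pi / 2) - ln (1 - r)"
    using r pi_gt3 by (simp add: ln_div)
  also have "\<dots> \<le> integral {0..pi / 2} ?w"
    unfolding i(2)[symmetric]
  proof (rule integral_le[OF i(1) integrable_continuous_real[OF c]])
    fix \<theta> assume \<theta>: "\<theta> \<in> {0..pi / 2}"
    have "0 \<le> cos \<theta>" using \<theta> by (intro cos_ge_zero) auto
    then have "1 \<le> cmod (1 + complex_of_real r * cis \<theta>)"
      using complex_Re_le_cmod[of "1 + complex_of_real r * cis \<theta>"] r
      by (simp) (smt (verit) mult_nonneg_nonneg)
    moreover have "cmod (1 - complex_of_real r * cis \<theta>) \<le> 1 - r + \<theta>"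
    proof -
      have "1 - complex_of_real r * cis \<theta> = complex_of_real (1 - r) - complex_of_real r * (cis \<theta> - 1)"
        by (simp add: algebra_simps)
      then have "cmod (1 - complex_of_real r * cis \<theta>)
          \<le> cmod (complex_of_real (1 - r)) + cmod (complex_of_real r * (cis \<theta> - 1))"
        by (simp only: norm_triangle_ineq4)
      also have "\<dots> = (1 - r) + r * cmod (cis \<theta> - 1)"
        using r by (simp only: norm_mult norm_of_real)
      also have "cmod (cis \<theta> - 1) = 2 * \<bar>sin (\<theta> / 2)\<bar>"
        using dist_exp_i_1[of \<theta>] by (simp add: cis_conv_exp mult.commute)
      also have "\<dots> \<le> 2 * \<bar>\<theta> / 2\<bar>" by (intro mult_left_mono abs_sin_x_le_abs_x) simp
      also have "(1 - r) + r * (2 * \<bar>\<theta> / 2\<bar>) \<le> 1 - r + \<theta>"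
        using r \<theta> mult_right_mono[of r 1 \<theta>] by simp
      finally show ?thesis using r by (simp add: mult_left_mono)
    qed
    ultimately show "1 / (1 - r + \<theta>) \<le> ?w \<theta>"
      unfolding cayley_def norm_divide using nz by (intro frac_le) auto
  qed
  also have "\<dots> \<le> integral {0..2 * pi} ?w"
    using pi_gt3 by (intro integral_subset_le integrable_continuous_real c) auto
  finally show ?thesis .
qed

lemma cayley_holomorphic: "cayley holomorphic_on unit_disc"
  unfolding cayley_def by (intro holomorphic_intros) auto

theorem integral_mean_Im_bigo_sharp:
  assumes K: "1 \<le> K" "0 \<le> K'" and n: "1 \<le> n" and p: "p = 1 / real n"
  obtains f where "harmonic_quasiregular K K' f" "Im (f 0) = 0" "(\<lambda>z. Re (f z)) \<in> harmonic_hardy p"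
    "(\<lambda>r. integral_mean p r (\<lambda>z. Im (f z))) \<notin> o[at_left 1](\<lambda>r. ln (1 / (1 - r)) powr (1 / p))"
proof
  define m where "m = n - 1"
  have m: "n = Suc m" using n by (simp add: m_def)
  have p0: "0 < p" "p \<le> 1" using n by (auto simp: p)
  \<comment> \<open>As \<open>cayley 0 = 1\<close>, subtracting this imaginary constant makes the
    imaginary part vanish at 0 and leaves the real part untouched.\<close>
  define f where "f z = \<i> ^ m * cayley z ^ n - \<i> * Im (\<i> ^ m)" for z
  have hol: "f holomorphic_on unit_disc"
    unfolding f_def by (intro holomorphic_intros cayley_holomorphic)
  show "harmonic_quasiregular K K' f" by (rule harmonic_quasiregular_holomorphic[OF hol K])
  show "Im (f 0) = 0" by (simp add: f_def cayley_def)
  have cont: "continuous_on unit_disc f" by (rule holomorphic_on_imp_continuous_on[OF hol])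
  have int: "(\<lambda>\<theta>. norm (T (f (complex_of_real r * cis \<theta>))) powr p) integrable_on {0..2 * pi}"
    if "continuous_on UNIV T" "0 \<le> r" "r < 1" for r and T :: "complex \<Rightarrow> real"
    by (intro integrable_continuous_real continuous_on_norm_powr p0
        continuous_on_compose2[OF that(1) continuous_on_circle[OF cont that(2,3)]]) auto
  have cRe: "continuous_on UNIV Re" and cIm: "continuous_on UNIV Im" by (intro continuous_intros)+
  define c where "c = (real n * 2 ^ n) powr p * 10 powr (1 + p)"
  define A where "A = 2 * c / p"
  have ReA: "integral {0..2 * pi} (\<lambda>\<theta>. norm (Re (f (complex_of_real r * cis \<theta>))) powr p) \<le> A"
    if r: "r \<in> {0..<1}" for r
  proof -
    define \<delta> where "\<delta> = 1 - r"
    have \<delta>: "0 < \<delta>" using r by (simp add: \<delta>_def)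
    let ?h = "\<lambda>\<theta>. (\<delta> + \<theta>) powr (- 1 - p) + (\<delta> + (2 * pi - \<theta>)) powr (- 1 - p)"
    note S = integral_shifted_powr_le[OF \<delta> p0(1)]
    have pt: "norm (Re (f (complex_of_real r * cis \<theta>))) powr p \<le> c * \<delta> powr p * ?h \<theta>" if \<theta>: "\<theta> \<in> {0..2 * pi}" for \<theta>
    proof -
      define z where "z = complex_of_real r * cis \<theta>"
      define d where "d = cmod (1 - z)"
      have z: "cmod z = r" "cmod z < 1" using r by (auto simp: z_def norm_mult)
      have d: "0 < d" using z by (auto simp: d_def)
      note cb = cayley_bounds[OF z(2), folded d_def]
      have "\<bar>Re (f z)\<bar> = \<bar>Re (\<i> ^ m * cayley z ^ Suc m)\<bar>" by (simp add: f_def m)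
      also have "\<dots> \<le> real n * cmod (cayley z) ^ m * \<bar>Re (cayley z)\<bar>"
        unfolding m by (rule abs_Re_rotated_power_le)
      also have "\<dots> \<le> real n * (2 / d) ^ m * (2 * \<delta> / d\<^sup>2)"
        using cb z(1) d by (intro mult_mono power_mono) (auto simp: \<delta>_def)
      also have "\<dots> = real n * 2 ^ n * \<delta> * d powr (- real n - 1)"
      proof -
        have "d powr (- real n - 1) = 1 / (d ^ m * d\<^sup>2)"
        proof -
          have "- real n - 1 = - real (m + 2)" by (simp add: m)
          then show ?thesis using d by (simp only: powr_minus powr_realpow power_add inverse_eq_divide)
        qed
        then show ?thesis by (simp add: m power_divide field_simps)
      qed
      finally have "\<bar>Re (f z)\<bar> powr p \<le> (real n * 2 ^ n * \<delta> * d powr (- real n - 1)) powr p"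
        using p0 by (intro powr_mono2) auto
      \<comment> \<open>Since n p = 1, the exponent of the distance becomes -1 - p. Its integral is
        of order \<open>\<delta> powr (- p)\<close>, exactly what the factor
        \<open>\<delta> powr p\<close> compensates.\<close>
      also have "\<dots> = (real n * 2 ^ n) powr p * \<delta> powr p * d powr (- 1 - p)"
      proof -
        have "(- real n - 1) * p = - 1 - p" using n by (simp add: p field_simps)
        then show ?thesis by (simp only: powr_mult powr_powr)
      qed
      also have "\<dots> \<le> (real n * 2 ^ n) powr p * \<delta> powr p * (10 powr (1 + p) * ?h \<theta>)"
        using dist_one_circle_powr_le[of r \<theta> "- 1 - p"] r \<theta> p0
        by (intro mult_left_mono) (auto simp: d_def z_def \<delta>_def add.commute)
      finally show ?thesis by (simp add: z_def c_def mult_ac)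
    qed
    have "integral {0..2 * pi} (\<lambda>\<theta>. norm (Re (f (complex_of_real r * cis \<theta>))) powr p)
        \<le> integral {0..2 * pi} (\<lambda>\<theta>. c * \<delta> powr p * ?h \<theta>)"
      using r by (intro integral_le pt int[OF cRe] integrable_on_mult_right integrable_add S(1,3)) auto
    also have "\<dots> = c * \<delta> powr p * (integral {0..2 * pi} (\<lambda>\<theta>. (\<delta> + \<theta>) powr (- 1 - p))
        + integral {0..2 * pi} (\<lambda>\<theta>. (\<delta> + (2 * pi - \<theta>)) powr (- 1 - p)))"
      by (simp only: integral_mult_right integral_add[OF S(1,3)])
    also have "\<dots> \<le> c * \<delta> powr p * (\<delta> powr (- p) / p + \<delta> powr (- p) / p)"
      by (intro mult_left_mono add_mono S(2,4)) (auto simp: c_def)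
    also have "\<dots> = A" using \<delta> p0 by (simp add: A_def powr_minus field_simps)
    finally show ?thesis .
  qed
  show "(\<lambda>z. Re (f z)) \<in> harmonic_hardy p"
    by (rule harmonic_hardyI[OF p0(1) harmonic_on_bounded_linear[OF bounded_linear_Re open_ball
            harmonic_on_holomorphic[OF hol open_ball]] ReA])
  \<comment> \<open>Because n p = 1, |cayley| is the p-th power of |cayley^n|. Subadditivity splits
    it into the contributions of the real part, the imaginary part and the subtracted constant; the
    first is bounded by \<open>A\<close>, the last has modulus at most 1 and contributes at most 2
    pi.\<close>
  have ImB: "ln (1 / (1 - r)) - (A + 2 * pi)
      \<le> integral {0..2 * pi} (\<lambda>\<theta>. norm (Im (f (complex_of_real r * cis \<theta>))) powr p)"
    if r: "0 \<le> r" "r < 1" for r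
  proof -
    let ?a = "\<lambda>\<theta>. norm (Re (f (complex_of_real r * cis \<theta>))) powr p"
    let ?b = "\<lambda>\<theta>. norm (Im (f (complex_of_real r * cis \<theta>))) powr p"
    have pt: "cmod (cayley z) \<le> norm (Re (f z)) powr p + norm (Im (f z)) powr p + 1" for z
    proof -
      have "cmod (cayley z) = (cmod (cayley z) ^ n) powr p"
        using n by (cases "cayley z = 0") (simp_all add: p powr_powr flip: powr_realpow)
      also have "cmod (cayley z) ^ n = cmod (f z + \<i> * Im (\<i> ^ m))"
        by (simp add: f_def norm_mult norm_power)
      also have "\<dots> powr p \<le> (\<bar>Re (f z)\<bar> + (\<bar>Im (f z)\<bar> + 1)) powr p"
      proof (rule powr_mono2)
        have "\<bar>Im (\<i> ^ m)\<bar> \<le> 1" using abs_Im_le_cmod[of "\<i> ^ m"] by (simp add: norm_power)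
        then show "cmod (f z + \<i> * Im (\<i> ^ m)) \<le> \<bar>Re (f z)\<bar> + (\<bar>Im (f z)\<bar> + 1)"
          using cmod_le[of "f z + \<i> * Im (\<i> ^ m)"] by simp
      qed (use p0 in auto)
      also have "\<dots> \<le> \<bar>Re (f z)\<bar> powr p + (\<bar>Im (f z)\<bar> + 1) powr p"
        using p0 by (intro add_powr_le) auto
      also have "\<dots> \<le> \<bar>Re (f z)\<bar> powr p + (\<bar>Im (f z)\<bar> powr p + 1 powr p)"
        using p0 by (intro add_left_mono add_powr_le) auto
      finally show ?thesis by simp
    qed
    have "ln (1 / (1 - r)) \<le> integral {0..2 * pi} (\<lambda>\<theta>. cmod (cayley (complex_of_real r * cis \<theta>)))"
      by (rule integral_cayley_ge[OF r])
    also have "\<dots> \<le> integral {0..2 * pi} (\<lambda>\<theta>. ?a \<theta> + ?b \<theta> + 1)"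
    proof (rule integral_le)
      show "(\<lambda>\<theta>. cmod (cayley (complex_of_real r * cis \<theta>))) integrable_on {0..2 * pi}"
        by (intro integrable_continuous_real continuous_on_norm
            continuous_on_circle[OF holomorphic_on_imp_continuous_on[OF cayley_holomorphic] r])
      show "(\<lambda>\<theta>. ?a \<theta> + ?b \<theta> + 1) integrable_on {0..2 * pi}"
        by (intro integrable_add int[OF cRe r] int[OF cIm r] integrable_const_ivl)
    qed (rule pt)
    also have "\<dots> = integral {0..2 * pi} ?a + integral {0..2 * pi} ?b + 2 * pi"
      by (simp add: integral_add[OF integrable_add[OF int[OF cRe r] int[OF cIm r]] integrable_const_ivl]
          integral_add[OF int[OF cRe r] int[OF cIm r]] del: real_norm_def)
    finally show ?thesis using ReA[of r] r by simp
  qed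
  show "(\<lambda>r. integral_mean p r (\<lambda>z. Im (f z))) \<notin> o[at_left 1](\<lambda>r. ln (1 / (1 - r)) powr (1 / p))"
  proof
    assume o: "(\<lambda>r. integral_mean p r (\<lambda>z. Im (f z))) \<in> o[at_left 1](\<lambda>r. ln (1 / (1 - r)) powr (1 / p))"
    define B where "B = \<bar>A + 2 * pi\<bar> + 1"
    \<comment> \<open>With this threshold the little-o bound says that the integral is at most half
      of the logarithm, since 1/(4 pi) is half of the normalisation 1/(2 pi). This contradicts
      \<open>ImB\<close> once the logarithm exceeds \<open>2 * B\<close>.\<close>
    define e where "e = (1 / (4 * pi)) powr (1 / p)"
    have B: "0 \<le> B" "A + 2 * pi \<le> B" by (simp_all add: B_def)
    then have "exp (- (2 * B)) \<le> 1" by simp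
    have "0 < e" by (simp add: e_def)
    from landau_o.smallD[OF o this]
    have ev: "\<forall>\<^sub>F r in at_left 1. norm (integral_mean p r (\<lambda>z. Im (f z))) \<le> e * norm (ln (1 / (1 - r)) powr (1 / p))" .
    have "1 - exp (- (2 * B)) < (1::real)" by simp
    from eventually_at_left_real[OF this]
    have "\<forall>\<^sub>F r in at_left 1. r \<in> {1 - exp (- (2 * B))<..<1}" .
    with ev have "\<forall>\<^sub>F r in at_left (1::real). False"
    proof eventually_elim
      case (elim r)
      have r: "0 \<le> r" "r < 1" "1 - r < exp (- (2 * B))"
        using elim(2) \<open>exp (- (2 * B)) \<le> 1\<close>
        unfolding greaterThanLessThan_iff by linarith+
      let ?l = "ln (1 / (1 - r))"
      let ?I = "integral {0..2 * pi} (\<lambda>\<theta>. norm (Im (f (complex_of_real r * cis \<theta>))) powr p)"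
      have l: "2 * B < ?l"
      proof -
        have "ln (1 - r) < ln (exp (- (2 * B)))" using r by (subst ln_less_cancel_iff) auto
        then show ?thesis using r by (simp add: ln_div)
      qed
      have l0: "0 < ?l" using l B by linarith
      have I: "?l - (A + 2 * pi) \<le> ?I" by (rule ImB[OF r(1,2)])
      then have I0: "0 \<le> ?I" using l B by linarith
      have "(1 / (2 * pi) * ?I) powr (1 / p) \<le> e * ?l powr (1 / p)"
        using elim(1) by (simp add: integral_mean_def)
      also have "\<dots> = (1 / (4 * pi) * ?l) powr (1 / p)" unfolding e_def by (rule powr_mult[symmetric])
      finally have "((1 / (2 * pi) * ?I) powr (1 / p)) powr p \<le> ((1 / (4 * pi) * ?l) powr (1 / p)) powr p"
        by (rule powr_mono2[rotated 2]) (use p0 in auto)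
      then have "1 / (2 * pi) * ?I \<le> 1 / (4 * pi) * ?l"
        using p0 I0 l0 by (simp add: powr_powr)
      then have "?I \<le> ?l / 2" by (simp add: field_simps)
      then show False using I l B by linarith
    qed
    then show False by simp
  qed
qed

theorem theorem2p5:
  fixes K K' :: real
  assumes "K \<ge> 1" and "K' \<ge> 0"
  shows
    "(\<forall>(f :: complex \<Rightarrow> complex) u v.
        harmonic_quasiregular K K' f \<and> u = (\<lambda>z. Re (f z)) \<and> v = (\<lambda>z. Im (f z)) \<and> v 0 = 0 \<longrightarrow>
          (u \<in> harmonic_hardy 1 \<longrightarrow> (\<forall>q. 0 < q \<and> q < 1 \<longrightarrow> v \<in> harmonic_hardy q)) \<and>
          (bdd_above ((\<lambda>r. integral {0..2 * pi}
               (\<lambda>\<theta>. \<bar>u (complex_of_real r * cis \<theta>)\<bar> * log_plus \<bar>u (complex_of_real r * cis \<theta>)\<bar>)) ` {0..<1})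
             \<longrightarrow> v \<in> harmonic_hardy 1) \<and>
          (\<forall>p. 0 < p \<and> p < 1 \<and> u \<in> harmonic_hardy p \<longrightarrow>
             (\<lambda>r. integral_mean p r v) \<in> O[at_left 1](\<lambda>r. ln (1 / (1 - r)) powr (1 / p)))) \<and>
     (\<forall>(n::nat) p. n \<ge> 1 \<and> p = 1 / real n \<longrightarrow>
        (\<exists>(f :: complex \<Rightarrow> complex) u v.
           harmonic_quasiregular K K' f \<and> u = (\<lambda>z. Re (f z)) \<and> v = (\<lambda>z. Im (f z)) \<and> v 0 = 0 \<and>
           u \<in> harmonic_hardy p \<and>
           (\<lambda>r. integral_mean p r v) \<notin> o[at_left 1](\<lambda>r. ln (1 / (1 - r)) powr (1 / p))))"
proof (intro conjI allI impI)
  have K0: "0 \<le> K" using assms(1) by simp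
  {
    fix f :: "complex \<Rightarrow> complex" and u v
    assume *: "harmonic_quasiregular K K' f \<and> u = (\<lambda>z. Re (f z)) \<and> v = (\<lambda>z. Im (f z)) \<and> v 0 = 0"
    then have f: "harmonic_quasiregular K K' f" and uv: "u = (\<lambda>z. Re (f z))" "v = (\<lambda>z. Im (f z))" by auto
    show "v \<in> harmonic_hardy q" if "u \<in> harmonic_hardy 1" "0 < q \<and> q < 1" for q
      using Im_in_harmonic_hardy_less_one[OF f K0 assms(2)] that unfolding uv by blast
    show "v \<in> harmonic_hardy 1"
      if "bdd_above ((\<lambda>r. integral {0..2 * pi}
        (\<lambda>\<theta>. \<bar>u (complex_of_real r * cis \<theta>)\<bar> * log_plus \<bar>u (complex_of_real r * cis \<theta>)\<bar>)) ` {0..<1})"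
      unfolding uv by (rule Im_in_harmonic_hardy_one[OF f K0 assms(2) that[unfolded uv]])
    show "(\<lambda>r. integral_mean p r v) \<in> O[at_left 1](\<lambda>r. ln (1 / (1 - r)) powr (1 / p))"
      if "0 < p \<and> p < 1 \<and> u \<in> harmonic_hardy p" for p
      using integral_mean_Im_bigo[OF f K0 assms(2), of p] that unfolding uv by blast
  next
    fix n :: nat and p :: real
    assume np: "n \<ge> 1 \<and> p = 1 / real n"
    obtain f where "harmonic_quasiregular K K' f" "Im (f 0) = 0" "(\<lambda>z. Re (f z)) \<in> harmonic_hardy p"
      "(\<lambda>r. integral_mean p r (\<lambda>z. Im (f z))) \<notin> o[at_left 1](\<lambda>r. ln (1 / (1 - r)) powr (1 / p))"
      using np by (elim conjE) (rule integral_mean_Im_bigo_sharp[OF assms])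
    then show "\<exists>(f :: complex \<Rightarrow> complex) u v.
      harmonic_quasiregular K K' f \<and> u = (\<lambda>z. Re (f z)) \<and> v = (\<lambda>z. Im (f z)) \<and> v 0 = 0 \<and>
      u \<in> harmonic_hardy p \<and>
      (\<lambda>r. integral_mean p r v) \<notin> o[at_left 1](\<lambda>r. ln (1 / (1 - r)) powr (1 / p))"
      by blast
  }
qed

end
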